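(* Let $k\geq 1$ and let $\mathcal{M}$ be a countable homogeneous structure in a finite relational language in which every relation symbol has arity $k+1$, such that $\mathrm{Aut}(M)$ acts transitively on $k$-tuples of distinct elements, $\mathrm{Age}(M)$ is $k$-overlap closed, and $\mathrm{Age}(M)$ has disjoint $n$-amalgamation for $n=2,3$. Then every $\mathrm{Aut}(M)$-invariant Keisler measure on $M$ in a single variable $x$ is exchangeable. Moreover: (1) if $\mathrm{Age}(M)$ has disjoint $n$-amalgamation for all $n\geq 2$, then there is an invariant Keisler measure $\mu$ in the variable $x$ assigning positive measure to every formula (with parameters) in $x$ which does not fork over $\emptyset$; (2) if $\mathrm{Age}(M)$ fails disjoint $n$-amalgamation for some $n$, then $F(\emptyset)\subsetneq\mathcal{O}(\emptyset)$.
   Context: Relations are injective (never hold on tuples with repeated entries). A homogeneous structure is one in which every isomorphism between finite substructures extends to an automorphism; $\mathrm{Age}(M)$ is the class of finite structures embeddable in $M$ (labelled on finite subsets of $\mathbb{N}$). For a hereditary class $\mathcal{C}$, $\mathcal{C}[r]$ denotes its members with domain $[r]$. $k$-overlap closed: a class $\mathcal{C}$ of relational structures with all arities $>k$ is $k$-overlap closed if for every $r>k$ there are constants $C(r),\alpha(r)>0$ such that for arbitrarily large $n$ there is an $r$-uniform hypergraph $\mathbb{K}$ on $n$ vertices with at least $C(r)n^{k+\alpha(r)}$ hyperedges, no two hyperedges meeting in more than $k$ vertices, and such that for all $H_1,H_2\in\mathcal{C}[r]$ and every structure $G_0$ on the vertices of $\mathbb{K}$ whose induced substructure on each hyperedge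 is isomorphic to $H_1$ or $H_2$, there is an injective homomorphism of $G_0$ into a member of $\mathcal{C}$ with $n$ elements that restricts to an embedding on each hyperedge. Disjoint $n$-amalgamation: for $A\in\mathcal{C}$ with domain $[m]$ and pairwise disjoint nonempty finite sets $k_1,\dots,k_n\subseteq\mathbb{N}\setminus[m]$, a disjoint $n$-amalgamation problem over $A$ is a family $(B_I)_{I\subsetneq[n]}$ of members of $\mathcal{C}$ with $B_I$ having domain $[m]\cup\bigcup_{i\in I}k_i$, $B_I\restriction[m]=A$, and $B_I, B_J$ agreeing on $[m]\cup\bigcup_{i\in I\cap J}k_i$; a solution is $B\in\mathcal{C}$ on $[m]\cup\bigcup_{i\le n}k_i$ restricting to each $B_I$. $\mathcal{C}$ has disjoint $n$-amalgamation if every such problem has a solution. A Keisler measure on $M$ in the variable $x$ is a regular Borel probability measure on the type space $S_x(M)$; it is invariant if invariant under the action of $\mathrm{Aut}(M)$; $\mu(\phi(x,\bar a))$ denotes the measure of the clopen set of types containing $\phi(x,\bar a)$. Such a measure $\mu$ is called exchangeable if for every $n$, all $n$-tuples $\bar a,\bar b$ of pairwise distinct elements of $M$, and every formula $\phi(x,y_1,\dots,y_n)$ which is a Boolean combination of atomic formulas each mentioning $x$, $\mu(\phi(x,\bar a))=\mu(\phi(x,\bar b))$ (equivalently, the induced random expansion of $M$ recording which atomic relations hold between $x$ and tuples of $M$ is invariant under all permutations of $M$). Forking: working in a sufficiently saturated, strongly homogeneous elementary extension $\mathbb{M}$ of $M$, a formula $\phi(x,b)$ divides over $\emptyset$ if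 there are $q<\omega$ and realisations $(b_i)_{i<\omega}$ of $\mathrm{tp}(b)$ with $\{\phi(x,b_i)\}$ $q$-inconsistent; it forks over $\emptyset$ if it implies a finite disjunction of formulas dividing over $\emptyset$. $F(\emptyset)$ is the ideal of definable sets forking over $\emptyset$, and $\mathcal{O}(\emptyset)$ is the ideal of definable sets which are universally measure zero, i.e. assigned measure zero by every invariant Keisler measure. *)

theory Defs
  imports "HOL-Probability.Probability"
begin

section \<open>Relational structures\<close>

text \<open>A relational language is a partial map sending each of its symbols to its arity; its symbols
  form the domain of the map. A structure has an explicit carrier, so that finite structures on
  subsets of the natural numbers and elementary extensions are handled by the same type.\<close>

type_synonym 'r language = "'r \<Rightarrow> nat option"

record ('r, 'a) rstruct =
  univ :: "'a set"
  interp :: "'r \<Rightarrow> 'a list set"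

text \<open>Relations are injective: they hold on tuples without repetition only.\<close>

definition is_structure :: "'r language \<Rightarrow> ('r, 'a) rstruct \<Rightarrow> bool" where
  "is_structure L M \<longleftrightarrow>
     (\<forall>R. \<forall>t \<in> interp M R. L R = Some (length t) \<and> set t \<subseteq> univ M \<and> distinct t)"

definition induced :: "('r, 'a) rstruct \<Rightarrow> 'a set \<Rightarrow> ('r, 'a) rstruct" where
  "induced M A = \<lparr>univ = univ M \<inter> A, interp = (\<lambda>R. {t \<in> interp M R. set t \<subseteq> A})\<rparr>"

definition injective_hom :: "('a \<Rightarrow> 'b) \<Rightarrow> ('r, 'a) rstruct \<Rightarrow> ('r, 'b) rstruct \<Rightarrow> bool" where
  "injective_hom f M N \<longleftrightarrow> inj_on f (univ M) \<and> f ` univ M \<subseteq> univ N \<and>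
     (\<forall>R t. set t \<subseteq> univ M \<longrightarrow> t \<in> interp M R \<longrightarrow> map f t \<in> interp N R)"

definition embedding :: "('a \<Rightarrow> 'b) \<Rightarrow> ('r, 'a) rstruct \<Rightarrow> ('r, 'b) rstruct \<Rightarrow> bool" where
  "embedding f M N \<longleftrightarrow> inj_on f (univ M) \<and> f ` univ M \<subseteq> univ N \<and>
     (\<forall>R t. set t \<subseteq> univ M \<longrightarrow> (t \<in> interp M R \<longleftrightarrow> map f t \<in> interp N R))"

definition isomorphism :: "('a \<Rightarrow> 'b) \<Rightarrow> ('r, 'a) rstruct \<Rightarrow> ('r, 'b) rstruct \<Rightarrow> bool" where
  "isomorphism f M N \<longleftrightarrow> embedding f M N \<and> f ` univ M = univ N"

definition isomorphic :: "('r, 'a) rstruct \<Rightarrow> ('r, 'b) rstruct \<Rightarrow> bool" where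
  "isomorphic M N \<longleftrightarrow> (\<exists>f. isomorphism f M N)"

definition automorphism :: "('r, 'a) rstruct \<Rightarrow> ('a \<Rightarrow> 'a) \<Rightarrow> bool" where
  "automorphism M g \<longleftrightarrow> isomorphism g M M"

definition homogeneous :: "('r, 'a) rstruct \<Rightarrow> bool" where
  "homogeneous M \<longleftrightarrow>
     (\<forall>A B f. A \<subseteq> univ M \<longrightarrow> B \<subseteq> univ M \<longrightarrow> finite A \<longrightarrow> finite B \<longrightarrow>
        isomorphism f (induced M A) (induced M B) \<longrightarrow>
        (\<exists>g. automorphism M g \<and> (\<forall>a \<in> A. g a = f a)))"

definition tuple_transitive :: "nat \<Rightarrow> ('r, 'a) rstruct \<Rightarrow> bool" where
  "tuple_transitive k M \<longleftrightarrow>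
     (\<forall>s t. length s = k \<longrightarrow> length t = k \<longrightarrow> distinct s \<longrightarrow> distinct t \<longrightarrow>
        set s \<subseteq> univ M \<longrightarrow> set t \<subseteq> univ M \<longrightarrow> (\<exists>g. automorphism M g \<and> map g s = t))"

section \<open>Classes of finite structures\<close>

definition age :: "'r language \<Rightarrow> ('r, 'a) rstruct \<Rightarrow> ('r, nat) rstruct set" where
  "age L M = {A. is_structure L A \<and> finite (univ A) \<and> (\<exists>f. embedding f A M)}"

definition members_on :: "('r, nat) rstruct set \<Rightarrow> nat \<Rightarrow> ('r, nat) rstruct set" where
  "members_on \<C> r = {H \<in> \<C>. univ H = {1..r}}"

text \<open>\<open>pasted L V E H\<^sub>1 H\<^sub>2 G\<close>: the structure \<open>G\<close> on the vertex set \<open>V\<close> is obtained by putting a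
  copy of \<open>H\<^sub>1\<close> or of \<open>H\<^sub>2\<close> on each hyperedge in \<open>E\<close>. No relation holds in \<open>G\<close> other than
  those coming from the hyperedges; without this proviso the extension property
  in \<open>overlap_closed\<close> would ask for completions of unrelated
  configurations outside the hyperedges, and would fail for, say, tetrahedron-free 3-hypergraphs.\<close>

definition pasted ::
  "'r language \<Rightarrow> nat set \<Rightarrow> nat set set \<Rightarrow> ('r, nat) rstruct \<Rightarrow> ('r, nat) rstruct
     \<Rightarrow> ('r, nat) rstruct \<Rightarrow> bool" where
  "pasted L V E H\<^sub>1 H\<^sub>2 G \<longleftrightarrow>
     is_structure L G \<and> univ G = V \<and>
     (\<forall>e \<in> E. isomorphic (induced G e) H\<^sub>1 \<or> isomorphic (induced G e) H\<^sub>2) \<and>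
     (\<forall>R. \<forall>t \<in> interp G R. \<exists>e \<in> E. set t \<subseteq> e)"

definition overlap_closed :: "nat \<Rightarrow> 'r language \<Rightarrow> ('r, nat) rstruct set \<Rightarrow> bool" where
  "overlap_closed k L \<C> \<longleftrightarrow>
     (\<forall>R n. L R = Some n \<longrightarrow> k < n) \<and>
     (\<forall>r > k. \<exists>c > 0. \<exists>\<alpha> > 0. \<forall>n\<^sub>0. \<exists>n \<ge> n\<^sub>0. \<exists>(V :: nat set) (E :: nat set set).
        finite V \<and> card V = n \<and>
        (\<forall>e \<in> E. e \<subseteq> V \<and> card e = r) \<and>
        real (card E) \<ge> c * real n powr (real k + \<alpha>) \<and>
        (\<forall>e \<in> E. \<forall>e' \<in> E. e \<noteq> e' \<longrightarrow> card (e \<inter> e') \<le> k) \<and>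
        (\<forall>H\<^sub>1 \<in> members_on \<C> r. \<forall>H\<^sub>2 \<in> members_on \<C> r. \<forall>G\<^sub>0. pasted L V E H\<^sub>1 H\<^sub>2 G\<^sub>0 \<longrightarrow>
           (\<exists>G \<in> \<C>. card (univ G) = n \<and>
              (\<exists>f. injective_hom f G\<^sub>0 G \<and> (\<forall>e \<in> E. embedding f (induced G\<^sub>0 e) G)))))"

text \<open>The blocks are \<open>K 1, \<dots>, K n\<close>; only the values \<open>B I\<close> for proper subsets \<open>I\<close> of \<open>{1..n}\<close> matter.\<close>

definition amalgamation_problem ::
  "nat \<Rightarrow> ('r, nat) rstruct set \<Rightarrow> nat \<Rightarrow> ('r, nat) rstruct \<Rightarrow> (nat \<Rightarrow> nat set)
     \<Rightarrow> (nat set \<Rightarrow> ('r, nat) rstruct) \<Rightarrow> bool" where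
  "amalgamation_problem n \<C> m A K B \<longleftrightarrow>
     A \<in> \<C> \<and> univ A = {1..m} \<and>
     (\<forall>i \<in> {1..n}. finite (K i) \<and> K i \<noteq> {} \<and> K i \<inter> {1..m} = {}) \<and>
     disjoint_family_on K {1..n} \<and>
     (\<forall>I. I \<subset> {1..n} \<longrightarrow>
        B I \<in> \<C> \<and> univ (B I) = {1..m} \<union> (\<Union>i \<in> I. K i) \<and> induced (B I) {1..m} = A) \<and>
     (\<forall>I J. I \<subset> {1..n} \<longrightarrow> J \<subset> {1..n} \<longrightarrow>
        induced (B I) ({1..m} \<union> (\<Union>i \<in> I \<inter> J. K i)) = induced (B J) ({1..m} \<union> (\<Union>i \<in> I \<inter> J. K i)))"

definition disjoint_amalgamation :: "nat \<Rightarrow> ('r, nat) rstruct set \<Rightarrow> bool" where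
  "disjoint_amalgamation n \<C> \<longleftrightarrow>
     (\<forall>m A K B. amalgamation_problem n \<C> m A K B \<longrightarrow>
        (\<exists>S \<in> \<C>. univ S = {1..m} \<union> (\<Union>i \<in> {1..n}. K i) \<and>
           (\<forall>I. I \<subset> {1..n} \<longrightarrow> induced S ({1..m} \<union> (\<Union>i \<in> I. K i)) = B I)))"

section \<open>First-order formulas and types\<close>

text \<open>Formulas carry parameters (constants) from a type \<open>'c\<close>. The distinguished variable \<open>x\<close> is
  \<open>Var 0\<close>. With \<open>'c = 'a\<close> these are formulas with parameters in a structure over \<open>'a\<close>. A formula
  \<open>\<phi>(x, y\<^sub>0, \<dots>, y\<^sub>n\<^sub>-\<^sub>1)\<close> without parameters is represented with \<open>'c = nat\<close>, the constant \<open>Par i\<close>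
  playing the role of the variable \<open>y\<^sub>i\<close>; then \<open>\<phi>(x, b)\<close> is obtained by renaming constants.\<close>

datatype 'c tm = Var nat | Par 'c

datatype (fm_symbols: 'r, params: 'c) fm =
    Rel 'r "'c tm list"
  | Eq "'c tm" "'c tm"
  | Neg "('r, 'c) fm"
  | Conj "('r, 'c) fm" "('r, 'c) fm"
  | Ex nat "('r, 'c) fm"
  for map: map_fm

definition inst :: "('r, nat) fm \<Rightarrow> 'a list \<Rightarrow> ('r, 'a) fm" where
  "inst \<theta> b = map_fm id (\<lambda>i. b ! i) \<theta>"

fun tm_vars :: "'c tm \<Rightarrow> nat set" where
  "tm_vars (Var i) = {i}"
| "tm_vars (Par c) = {}"

fun free_vars :: "('r, 'c) fm \<Rightarrow> nat set" where
  "free_vars (Rel R ts) = (\<Union>t \<in> set ts. tm_vars t)"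
| "free_vars (Eq s t) = tm_vars s \<union> tm_vars t"
| "free_vars (Neg \<phi>) = free_vars \<phi>"
| "free_vars (Conj \<phi> \<psi>) = free_vars \<phi> \<union> free_vars \<psi>"
| "free_vars (Ex i \<phi>) = free_vars \<phi> - {i}"

fun well_formed :: "'r language \<Rightarrow> ('r, 'c) fm \<Rightarrow> bool" where
  "well_formed L (Rel R ts) \<longleftrightarrow> L R = Some (length ts)"
| "well_formed L (Eq s t) \<longleftrightarrow> True"
| "well_formed L (Neg \<phi>) \<longleftrightarrow> well_formed L \<phi>"
| "well_formed L (Conj \<phi> \<psi>) \<longleftrightarrow> well_formed L \<phi> \<and> well_formed L \<psi>"
| "well_formed L (Ex i \<phi>) \<longleftrightarrow> well_formed L \<phi>"

fun tm_val :: "(nat \<Rightarrow> 'a) \<Rightarrow> 'a tm \<Rightarrow> 'a" where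
  "tm_val \<sigma> (Var i) = \<sigma> i"
| "tm_val \<sigma> (Par c) = c"

fun sat :: "('r, 'a) rstruct \<Rightarrow> (nat \<Rightarrow> 'a) \<Rightarrow> ('r, 'a) fm \<Rightarrow> bool" where
  "sat M \<sigma> (Rel R ts) \<longleftrightarrow> map (tm_val \<sigma>) ts \<in> interp M R"
| "sat M \<sigma> (Eq s t) \<longleftrightarrow> tm_val \<sigma> s = tm_val \<sigma> t"
| "sat M \<sigma> (Neg \<phi>) \<longleftrightarrow> \<not> sat M \<sigma> \<phi>"
| "sat M \<sigma> (Conj \<phi> \<psi>) \<longleftrightarrow> sat M \<sigma> \<phi> \<and> sat M \<sigma> \<psi>"
| "sat M \<sigma> (Ex i \<phi>) \<longleftrightarrow> (\<exists>a \<in> univ M. sat M (\<sigma>(i := a)) \<phi>)"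

definition formulas :: "'r language \<Rightarrow> nat set \<Rightarrow> 'c set \<Rightarrow> ('r, 'c) fm set" where
  "formulas L X C = {\<phi>. well_formed L \<phi> \<and> free_vars \<phi> \<subseteq> X \<and> params \<phi> \<subseteq> C}"

abbreviation x_formulas :: "'r language \<Rightarrow> 'c set \<Rightarrow> ('r, 'c) fm set" where
  "x_formulas L C \<equiv> formulas L {0} C"

abbreviation sentences :: "'r language \<Rightarrow> 'c set \<Rightarrow> ('r, 'c) fm set" where
  "sentences L C \<equiv> formulas L {} C"

text \<open>The element \<open>a\<close> satisfies \<open>\<phi>(x)\<close>; variables other than \<open>Var 0\<close> do not occur freely in \<open>\<phi>\<close>, so
  that their values are immaterial.\<close>

definition satisfies :: "('r, 'a) rstruct \<Rightarrow> 'a \<Rightarrow> ('r, 'a) fm \<Rightarrow> bool" where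
  "satisfies M a \<phi> \<longleftrightarrow> sat M (\<lambda>_. a) \<phi>"

definition true_in :: "('r, 'a) rstruct \<Rightarrow> ('r, 'a) fm \<Rightarrow> bool" where
  "true_in M \<phi> \<longleftrightarrow> (\<forall>\<sigma>. sat M \<sigma> \<phi>)"

definition defined_set :: "('r, 'a) rstruct \<Rightarrow> ('r, 'a) fm \<Rightarrow> 'a set" where
  "defined_set M \<phi> = {a \<in> univ M. satisfies M a \<phi>}"

definition finitely_satisfiable :: "('r, 'a) rstruct \<Rightarrow> ('r, 'a) fm set \<Rightarrow> bool" where
  "finitely_satisfiable M p \<longleftrightarrow>
     (\<forall>q. finite q \<longrightarrow> q \<subseteq> p \<longrightarrow> (\<exists>a \<in> univ M. \<forall>\<phi> \<in> q. satisfies M a \<phi>))"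

definition type_space :: "'r language \<Rightarrow> ('r, 'a) rstruct \<Rightarrow> ('r, 'a) fm set set" where
  "type_space L M = {p. p \<subseteq> x_formulas L (univ M) \<and> finitely_satisfiable M p \<and>
     (\<forall>\<phi> \<in> x_formulas L (univ M). \<phi> \<in> p \<or> Neg \<phi> \<in> p)}"

definition types_containing ::
  "'r language \<Rightarrow> ('r, 'a) rstruct \<Rightarrow> ('r, 'a) fm \<Rightarrow> ('r, 'a) fm set set" where
  "types_containing L M \<phi> = {p \<in> type_space L M. \<phi> \<in> p}"

definition type_topology :: "'r language \<Rightarrow> ('r, 'a) rstruct \<Rightarrow> ('r, 'a) fm set topology" where
  "type_topology L M = topology_generated_by (types_containing L M ` x_formulas L (univ M))"

section \<open>Keisler measures\<close>

definition keisler_measure ::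
  "'r language \<Rightarrow> ('r, 'a) rstruct \<Rightarrow> ('r, 'a) fm set measure \<Rightarrow> bool" where
  "keisler_measure L M \<mu> \<longleftrightarrow>
     prob_space \<mu> \<and>
     space \<mu> = type_space L M \<and>
     sets \<mu> = sigma_sets (type_space L M) {U. openin (type_topology L M) U} \<and>
     (\<forall>A \<in> sets \<mu>.
        emeasure \<mu> A = (INF U \<in> {U. openin (type_topology L M) U \<and> A \<subseteq> U}. emeasure \<mu> U) \<and>
        emeasure \<mu> A = (SUP K \<in> {K. compactin (type_topology L M) K \<and> K \<subseteq> A}. emeasure \<mu> K))"

text \<open>An automorphism \<open>g\<close> acts on formulas by moving parameters, and thereby on types.\<close>

definition type_action :: "('a \<Rightarrow> 'a) \<Rightarrow> ('r, 'a) fm set \<Rightarrow> ('r, 'a) fm set" where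
  "type_action g p = map_fm id g ` p"

definition invariant_measure :: "('r, 'a) rstruct \<Rightarrow> ('r, 'a) fm set measure \<Rightarrow> bool" where
  "invariant_measure M \<mu> \<longleftrightarrow>
     (\<forall>g. automorphism M g \<longrightarrow> (\<forall>A \<in> sets \<mu>. emeasure \<mu> (type_action g ` A) = emeasure \<mu> A))"

definition invariant_keisler_measure ::
  "'r language \<Rightarrow> ('r, 'a) rstruct \<Rightarrow> ('r, 'a) fm set measure \<Rightarrow> bool" where
  "invariant_keisler_measure L M \<mu> \<longleftrightarrow> keisler_measure L M \<mu> \<and> invariant_measure M \<mu>"

fun atoms_mention_x :: "('r, 'c) fm \<Rightarrow> bool" where
  "atoms_mention_x (Rel R ts) \<longleftrightarrow> Var 0 \<in> set ts"
| "atoms_mention_x (Eq s t) \<longleftrightarrow> s = Var 0 \<or> t = Var 0"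
| "atoms_mention_x (Neg \<phi>) \<longleftrightarrow> atoms_mention_x \<phi>"
| "atoms_mention_x (Conj \<phi> \<psi>) \<longleftrightarrow> atoms_mention_x \<phi> \<and> atoms_mention_x \<psi>"
| "atoms_mention_x (Ex i \<phi>) \<longleftrightarrow> False"

definition exchangeable ::
  "'r language \<Rightarrow> ('r, 'a) rstruct \<Rightarrow> ('r, 'a) fm set measure \<Rightarrow> bool" where
  "exchangeable L M \<mu> \<longleftrightarrow>
     (\<forall>n a b. length a = n \<longrightarrow> length b = n \<longrightarrow> distinct a \<longrightarrow> distinct b \<longrightarrow>
        set a \<subseteq> univ M \<longrightarrow> set b \<subseteq> univ M \<longrightarrow>
        (\<forall>\<phi> \<in> x_formulas L {..<n}. atoms_mention_x \<phi> \<longrightarrow>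
           measure \<mu> (types_containing L M (inst \<phi> a)) =
           measure \<mu> (types_containing L M (inst \<phi> b))))"

section \<open>Saturated elementary extensions and forking\<close>

definition elementary_extension ::
  "'r language \<Rightarrow> ('r, 'a) rstruct \<Rightarrow> ('r, 'a) rstruct \<Rightarrow> bool" where
  "elementary_extension L M N \<longleftrightarrow>
     is_structure L N \<and> univ M \<subseteq> univ N \<and> induced N (univ M) = M \<and>
     (\<forall>\<phi> \<in> formulas L UNIV (univ M). \<forall>\<sigma>. range \<sigma> \<subseteq> univ M \<longrightarrow> (sat M \<sigma> \<phi> \<longleftrightarrow> sat N \<sigma> \<phi>))"

definition saturated :: "'r language \<Rightarrow> ('r, 'a) rstruct \<Rightarrow> bool" where
  "saturated L N \<longleftrightarrow>
     (\<forall>C p. C \<subseteq> univ N \<longrightarrow> countable C \<longrightarrow> p \<subseteq> x_formulas L C \<longrightarrow> finitely_satisfiable N p \<longrightarrow>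
        (\<exists>a \<in> univ N. \<forall>\<phi> \<in> p. satisfies N a \<phi>))"

definition strongly_homogeneous :: "'r language \<Rightarrow> ('r, 'a) rstruct \<Rightarrow> bool" where
  "strongly_homogeneous L N \<longleftrightarrow>
     (\<forall>C f. C \<subseteq> univ N \<longrightarrow> countable C \<longrightarrow> f ` C \<subseteq> univ N \<longrightarrow>
        (\<forall>\<phi> \<in> sentences L C. true_in N \<phi> \<longleftrightarrow> true_in N (map_fm id f \<phi>)) \<longrightarrow>
        (\<exists>g. automorphism N g \<and> (\<forall>c \<in> C. g c = f c)))"

text \<open>For an infinite countable structure \<open>M\<close> in a finite language, ``sufficiently'' saturated and
  strongly homogeneous is taken at the cardinal \<open>|M|\<^sup>+ = \<aleph>\<^sub>1\<close>, hence the countable parameter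
  sets above. The extension \<open>N\<close> lives on the same type as \<open>M\<close>, whose carrier may be a small
  subset of that type.\<close>

definition monster :: "'r language \<Rightarrow> ('r, 'a) rstruct \<Rightarrow> ('r, 'a) rstruct \<Rightarrow> bool" where
  "monster L M N \<longleftrightarrow> elementary_extension L M N \<and> saturated L N \<and> strongly_homogeneous L N"

definition tuple_type :: "'r language \<Rightarrow> ('r, 'a) rstruct \<Rightarrow> 'a list \<Rightarrow> ('r, nat) fm set" where
  "tuple_type L N b = {\<theta> \<in> sentences L {..<length b}. true_in N (inst \<theta> b)}"

text \<open>\<open>\<theta>(x, b)\<close> divides over the empty set. Inconsistency refers to the indexed family: any \<open>q\<close>
  formulas with distinct indices have no common solution (the tuples \<open>bs i\<close> may repeat).\<close>

definition divides :: "'r language \<Rightarrow> ('r, 'a) rstruct \<Rightarrow> ('r, nat) fm \<Rightarrow> 'a list \<Rightarrow> bool" where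
  "divides L N \<theta> b \<longleftrightarrow>
     (\<exists>(q :: nat) (bs :: nat \<Rightarrow> 'a list).
        (\<forall>i. length (bs i) = length b \<and> set (bs i) \<subseteq> univ N \<and>
             tuple_type L N (bs i) = tuple_type L N b) \<and>
        (\<forall>I. finite I \<longrightarrow> card I = q \<longrightarrow>
           \<not> (\<exists>a \<in> univ N. \<forall>i \<in> I. satisfies N a (inst \<theta> (bs i)))))"

definition forks :: "'r language \<Rightarrow> ('r, 'a) rstruct \<Rightarrow> ('r, 'a) fm \<Rightarrow> bool" where
  "forks L N \<phi> \<longleftrightarrow>
     (\<exists>D :: (('r, nat) fm \<times> 'a list) set. finite D \<and>
        (\<forall>(\<theta>, b) \<in> D. set b \<subseteq> univ N \<and> \<theta> \<in> x_formulas L {..<length b} \<and> divides L N \<theta> b) \<and>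
        (\<forall>a \<in> univ N. satisfies N a \<phi> \<longrightarrow> (\<exists>(\<theta>, b) \<in> D. satisfies N a (inst \<theta> b))))"

text \<open>The ideals \<open>F(\<emptyset>)\<close> and \<open>O(\<emptyset>)\<close> of subsets of \<open>M\<close> definable in the variable \<open>x\<close> with parameters.\<close>

definition forking_ideal ::
  "'r language \<Rightarrow> ('r, 'a) rstruct \<Rightarrow> ('r, 'a) rstruct \<Rightarrow> 'a set set" where
  "forking_ideal L M N = {defined_set M \<phi> |\<phi>. \<phi> \<in> x_formulas L (univ M) \<and> forks L N \<phi>}"

definition measure_zero_ideal :: "'r language \<Rightarrow> ('r, 'a) rstruct \<Rightarrow> 'a set set" where
  "measure_zero_ideal L M =
     {defined_set M \<phi> |\<phi>. \<phi> \<in> x_formulas L (univ M) \<and>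
        (\<forall>\<mu>. invariant_keisler_measure L M \<mu> \<longrightarrow> measure \<mu> (types_containing L M \<phi>) = 0)}"

end

theory Submission
  imports Defs "HOL-Library.Ramsey"
begin

text \<open>
Exchangeability. Suppose that an invariant measure gave two copies \<open>a\<close>, \<open>b\<close> of the structures
\<open>H\<^sub>1\<close>, \<open>H\<^sub>2\<close> different probabilities for the event \<open>\<phi>\<close>. Paste \<open>H\<^sub>1\<close> or \<open>H\<^sub>2\<close> on each of the
\<open>m \<ge> C n\<^bsup>k+\<alpha>\<^esup>\<close> hyperedges of an overlap-free hypergraph. For each of the \<open>2\<^bsup>m\<^esup>\<close> choices some
pattern of \<open>x\<close> over the \<open>n\<close> vertices correlates with the choice at least as well as expected. There are
only \<open>2\<^bsup>O(n^k)\<^esup>\<close> patterns, and comparing exponential moments gives \<open>\<rho>\<^bsup>m\<^esup> \<le> 2\<^bsup>O(n^k)\<^esup>\<close> for some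
\<open>\<rho> > 1\<close>, which is absurd.

(1) With all amalgamation properties the allowed relations between \<open>x\<close> and the \<open>k\<close>-subsets of a finite
set can be chosen independently. Choosing them uniformly defines an invariant measure that is positive on
every formula with infinitely many solutions, and formulas with finitely many solutions fork.

(2) A formula that divides has measure zero, by invariance and inconsistency. By disjoint 3-amalgamation a
formula with infinitely many solutions does not fork: a dividing sequence has a subsequence that is a
sunflower, over which a solution can be amalgamated. If no formula with infinitely many solutions had
measure zero for all invariant measures, then, by exchangeability, the realised patterns over a finite set
would not depend on the structure of that set. This forces the age to consist of all structures
whose subsets of size \<open>k + 1\<close> are allowed, and such a class has disjoint \<open>n\<close>-amalgamation for all \<open>n\<close>.
\<close>

section \<open>Structures, automorphisms and amalgamation\<close>

text \<open>Members of the age are handled as pullbacks of \<open>M\<close> along injective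
  labellings by natural numbers. By homogeneity, two finite labellings have the same pullback
  exactly when an automorphism of \<open>M\<close> takes one to the other. Amalgamation in the age
  thus becomes the task of finding elements of \<open>M\<close> in a prescribed position.

  In the counting argument the exponent \<open>k\<close> of the number of patterns comes from the
  arity: a relation has \<open>k + 1\<close> places and \<open>x\<close> takes one of them. The role
  of the measure is only to supply, for each choice of copies, one type that does at least as well
  as the mean.

  The obstacle in the forking part is that dividing sequences and their parameters live in
  \<open>N\<close>, while measures, automorphisms and amalgamation concern \<open>M\<close>. Only
  finitely many sentences matter at a time: atomic diagrams of finitely many tuples and the
  solvability of finitely many conjunctions. They are moved to \<open>M\<close> by elementarity,
  with the parameters outside \<open>M\<close> quantified existentially, and homogeneity turns equal
  diagrams into automorphisms.\<close>

definition pullback :: "('r, 'a) rstruct \<Rightarrow> ('b \<Rightarrow> 'a) \<Rightarrow> 'b set \<Rightarrow> ('r, 'b) rstruct" where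
  "pullback M f V = \<lparr>univ = V, interp = (\<lambda>R. {t. set t \<subseteq> V \<and> map f t \<in> interp M R})\<rparr>"

lemma univ_pullback [simp]: "univ (pullback M f V) = V"
  and interp_pullback [simp]:
    "interp (pullback M f V) R = {t. set t \<subseteq> V \<and> map f t \<in> interp M R}"
  by (auto simp: pullback_def)

lemma induced_sel [simp]:
  "univ (induced M A) = univ M \<inter> A" "interp (induced M A) R = {t \<in> interp M R. set t \<subseteq> A}"
  by (auto simp: induced_def)

lemma rstruct_eqI:
  fixes A B :: "('r, 'a) rstruct"
  assumes "univ A = univ B" "\<And>R. interp A R = interp B R"
  shows "A = B"
  using assms by (cases A, cases B) auto

lemma induced_pullback: "induced (pullback M f V) W = pullback M f (V \<inter> W)"
  by (rule rstruct_eqI) auto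

lemma pullback_eq_iff:
  "pullback M f V = pullback N g V \<longleftrightarrow>
     (\<forall>R t. set t \<subseteq> V \<longrightarrow> map f t \<in> interp M R \<longleftrightarrow> map g t \<in> interp N R)"
  (is "?L \<longleftrightarrow> ?R")
proof
  assume ?L
  then have "interp (pullback M f V) R = interp (pullback N g V) R" for R by simp
  then show ?R by auto
next
  assume ?R then show ?L by (intro rstruct_eqI) auto
qed

text \<open>\<open>embedding\<close> tests only tuples inside \<open>univ S\<close>, so the equation
  is about \<open>induced S (univ S)\<close>. It becomes an equation for \<open>S\<close> itself
  once \<open>S\<close> is known to be a structure.\<close>

lemma embedding_pullback:
  "embedding f S M \<longleftrightarrow> inj_on f (univ S) \<and> f ` univ S \<subseteq> univ M \<and>
     induced S (univ S) = pullback M f (univ S)"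
  unfolding embedding_def
proof (intro conj_cong refl iffI)
  assume "\<forall>R t. set t \<subseteq> univ S \<longrightarrow> (t \<in> interp S R) = (map f t \<in> interp M R)"
  then show "induced S (univ S) = pullback M f (univ S)" by (intro rstruct_eqI) auto
next
  assume *: "induced S (univ S) = pullback M f (univ S)"
  have "interp (induced S (univ S)) R = interp (pullback M f (univ S)) R" for R by (simp add: *)
  then show "\<forall>R t. set t \<subseteq> univ S \<longrightarrow> (t \<in> interp S R) = (map f t \<in> interp M R)" by auto
qed

lemma is_structureD:
  assumes "is_structure L S" "t \<in> interp S R"
  shows "L R = Some (length t)" "set t \<subseteq> univ S" "distinct t"
  using assms unfolding is_structure_def by blast+

lemma induced_univ:
  assumes "is_structure L S" shows "induced S (univ S) = S"
proof (rule rstruct_eqI)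
  show "interp (induced S (univ S)) R = interp S R" for R
    using is_structureD(2)[OF assms, of _ R] by auto
qed simp

lemma is_structure_pullback:
  assumes "is_structure L M" "inj_on f V"
  shows "is_structure L (pullback M f V)"
  using assms is_structureD[OF assms(1)] unfolding is_structure_def
  by (fastforce simp: distinct_map)

lemma is_structure_induced:
  assumes "is_structure L M"
  shows "is_structure L (induced M V)"
  using assms unfolding is_structure_def by auto

lemma age_iff:
  assumes "is_structure L M"
  shows "S \<in> age L M \<longleftrightarrow> finite (univ S) \<and>
    (\<exists>f. inj_on f (univ S) \<and> f ` univ S \<subseteq> univ M \<and> S = pullback M f (univ S))"
proof
  assume "S \<in> age L M"
  then show "finite (univ S) \<and>
    (\<exists>f. inj_on f (univ S) \<and> f ` univ S \<subseteq> univ M \<and> S = pullback M f (univ S))"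
    unfolding age_def embedding_pullback using induced_univ[of L S] by auto
next
  assume *: "finite (univ S) \<and>
    (\<exists>f. inj_on f (univ S) \<and> f ` univ S \<subseteq> univ M \<and> S = pullback M f (univ S))"
  then obtain f where f: "inj_on f (univ S)" "f ` univ S \<subseteq> univ M" "S = pullback M f (univ S)"
    by blast
  have S: "is_structure L S" using is_structure_pullback[OF assms f(1)] f(3) by simp
  with f * show "S \<in> age L M"
    unfolding age_def embedding_pullback using induced_univ[OF S] by auto
qed

lemma pullback_in_age:
  assumes "is_structure L M" "finite V" "inj_on f V" "f ` V \<subseteq> univ M"
  shows "pullback M f V \<in> age L M"
  using assms by (auto simp: age_iff)

section \<open>Automorphisms and their inverses\<close>

lemma automorphismD:
  assumes "automorphism M g"
  shows "inj_on g (univ M)" "g ` univ M = univ M"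
    "\<And>R t. set t \<subseteq> univ M \<Longrightarrow> t \<in> interp M R \<longleftrightarrow> map g t \<in> interp M R"
  using assms unfolding automorphism_def isomorphism_def embedding_def by auto

lemma automorphismI:
  assumes "inj_on g (univ M)" "g ` univ M = univ M"
    "\<And>R t. set t \<subseteq> univ M \<Longrightarrow> t \<in> interp M R \<longleftrightarrow> map g t \<in> interp M R"
  shows "automorphism M g"
  using assms unfolding automorphism_def isomorphism_def embedding_def by auto

lemma automorphism_in: "automorphism M g \<Longrightarrow> a \<in> univ M \<Longrightarrow> g a \<in> univ M"
  using automorphismD(2) by blast

lemma automorphism_id: "automorphism M (\<lambda>a. a)"
  by (rule automorphismI) auto

lemma automorphism_comp:
  assumes g: "automorphism M g" and h: "automorphism M h"
  shows "automorphism M (\<lambda>a. g (h a))"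
proof (rule automorphismI)
  show "inj_on (\<lambda>a. g (h a)) (univ M)"
    using comp_inj_on[of h "univ M" g] automorphismD[OF g] automorphismD[OF h] by (simp add: comp_def)
  show "(\<lambda>a. g (h a)) ` univ M = univ M"
    using automorphismD(2)[OF g] automorphismD(2)[OF h] by (metis image_image)
  fix R and t assume t: "set t \<subseteq> univ M"
  then have "set (map h t) \<subseteq> univ M" using automorphism_in[OF h] by auto
  then show "t \<in> interp M R \<longleftrightarrow> map (\<lambda>a. g (h a)) t \<in> interp M R"
    using automorphismD(3)[OF g, of "map h t" R] automorphismD(3)[OF h t, of R] by (simp add: comp_def)
qed

text \<open>An automorphism is constrained on the carrier only, so the inverse is taken by
  \<open>inv_into\<close> and the cancellation laws hold just for elements of
  \<open>univ M\<close>.\<close>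

lemma automorphism_inverse:
  assumes g: "automorphism M g"
  obtains h where "automorphism M h" "\<And>a. a \<in> univ M \<Longrightarrow> h (g a) = a"
    "\<And>a. a \<in> univ M \<Longrightarrow> g (h a) = a"
proof
  let ?h = "inv_into (univ M) g"
  note D = automorphismD[OF g]
  show 1: "a \<in> univ M \<Longrightarrow> ?h (g a) = a" for a using D(1) by simp
  show 2: "a \<in> univ M \<Longrightarrow> g (?h a) = a" for a using D(2) by (simp add: f_inv_into_f)
  have 3: "?h a \<in> univ M" if "a \<in> univ M" for a using D(2) that inv_into_into by metis
  show "automorphism M ?h"
  proof (rule automorphismI)
    show "inj_on ?h (univ M)" using 2 by (metis inj_onI)
    show "?h ` univ M = univ M" using 1 3 automorphism_in[OF g] by force
    fix R and t assume t: "set t \<subseteq> univ M"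
    then have "set (map ?h t) \<subseteq> univ M" "map g (map ?h t) = t"
      using 2 3 by (auto simp: subset_iff intro: map_idI)
    then show "t \<in> interp M R \<longleftrightarrow> map ?h t \<in> interp M R" using D(3) by metis
  qed
qed

section \<open>Homogeneity and amalgamation in terms of labellings\<close>

locale homogeneous_structure =
  fixes k :: nat and L :: "'r language" and M :: "('r, 'a) rstruct"
  assumes k_pos: "k \<ge> 1"
    and finite_language: "finite (dom L)"
    and arity: "\<And>R n. L R = Some n \<Longrightarrow> n = k + 1"
    and struct: "is_structure L M"
    and nonempty: "univ M \<noteq> {}"
    and countable_univ: "countable (univ M)"
    and homogeneous: "homogeneous M"
begin

lemma interpD:
  assumes "t \<in> interp M R"
  shows "L R = Some (k + 1)" "length t = k + 1" "set t \<subseteq> univ M" "distinct t" "R \<in> dom L"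
    "card (set t) = k + 1"
proof -
  note * = is_structureD[OF struct assms]
  show "L R = Some (k + 1)" "length t = k + 1" "set t \<subseteq> univ M" "distinct t" "R \<in> dom L"
    using * arity[OF *(1)] by auto
  then show "card (set t) = k + 1" using distinct_card by metis
qed

text \<open>Equality of the pullbacks says that sending \<open>e v\<close> to \<open>f v\<close> is
  an isomorphism between finite induced substructures; homogeneity extends it.\<close>

lemma extend_partial_isomorphism:
  assumes V: "finite V" and e: "inj_on e V" "e ` V \<subseteq> univ M" and f: "inj_on f V" "f ` V \<subseteq> univ M"
    and eq: "pullback M e V = pullback M f V"
  obtains g where "automorphism M g" "\<And>v. v \<in> V \<Longrightarrow> g (e v) = f v"
proof -
  define h where "h = (\<lambda>a. f (inv_into V e a))"
  have h: "h (e v) = f v" if "v \<in> V" for v using that e by (simp add: h_def)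
  have "isomorphism h (induced M (e ` V)) (induced M (f ` V))"
    unfolding isomorphism_def embedding_def
  proof (intro conjI allI impI)
    show "inj_on h (univ (induced M (e ` V)))"
      using f(1) h unfolding inj_on_def by fastforce
    have "univ M \<inter> e ` V = e ` V" "univ M \<inter> f ` V = f ` V" using e f by auto
    moreover have "h ` e ` V = f ` V" using h by (simp add: image_image)
    ultimately show "h ` univ (induced M (e ` V)) = univ (induced M (f ` V))" by simp
    then show "h ` univ (induced M (e ` V)) \<subseteq> univ (induced M (f ` V))" by simp
    fix R t assume "set t \<subseteq> univ (induced M (e ` V))"
    then have t: "set t \<subseteq> e ` V" by simp
    define u where "u = map (inv_into V e) t"
    have u: "set u \<subseteq> V" using t by (auto simp: u_def inv_into_into)
    have "map e u = map (\<lambda>a. a) t"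
      unfolding u_def map_map by (rule map_cong) (use t in \<open>auto simp: f_inv_into_f\<close>)
    then have tu: "t = map e u" by simp
    have hu: "map h t = map f u" unfolding tu map_map by (rule map_cong) (use u h in auto)
    have "set (map f u) \<subseteq> f ` V" using u by auto
    then have "map h t \<in> interp (induced M (f ` V)) R \<longleftrightarrow> map f u \<in> interp M R"
      by (simp add: hu)
    also have "\<dots> \<longleftrightarrow> t \<in> interp (induced M (e ` V)) R"
      using eq[unfolded pullback_eq_iff, rule_format, OF u] t by (simp add: tu)
    finally show "t \<in> interp (induced M (e ` V)) R \<longleftrightarrow> map h t \<in> interp (induced M (f ` V)) R" ..
  qed
  moreover have "finite (e ` V)" "finite (f ` V)" using V by auto
  ultimately obtain g where "automorphism M g" "\<forall>a \<in> e ` V. g a = h a"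
    using homogeneous[unfolded homogeneous_def, rule_format, OF e(2) f(2)] by auto
  then show ?thesis using that h by auto
qed

lemma automorphism_pullback:
  assumes g: "automorphism M g" and e: "e ` V \<subseteq> univ M" and f: "\<And>v. v \<in> V \<Longrightarrow> g (e v) = f v"
  shows "pullback M e V = pullback M f V"
  unfolding pullback_eq_iff
proof (intro allI impI)
  fix R t assume t: "set t \<subseteq> V"
  then have "set (map e t) \<subseteq> univ M" "map f t = map g (map e t)" using e f by auto
  then show "map e t \<in> interp M R \<longleftrightarrow> map f t \<in> interp M R"
    using automorphismD(3)[OF g] by metis
qed

text \<open>Homogeneity turns the equations between induced structures in an amalgamation problem
  into automorphisms of \<open>M\<close>. Faces may therefore be given as labellings
  \<open>e I\<close> that agree only up to automorphism, and the solution extends each of them up to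
  automorphism.\<close>

lemma amalgamate_maps:
  fixes e :: "nat set \<Rightarrow> nat \<Rightarrow> 'a" and K :: "nat \<Rightarrow> nat set" and m :: nat
  defines "V I \<equiv> {1..m} \<union> (\<Union>i \<in> I. K i)"
  assumes amalg: "disjoint_amalgamation n (age L M)" and n: "n \<ge> 1"
    and K: "\<And>i. i \<in> {1..n} \<Longrightarrow> finite (K i) \<and> K i \<noteq> {} \<and> K i \<inter> {1..m} = {}"
    and disj: "disjoint_family_on K {1..n}"
    and e: "\<And>I. I \<subset> {1..n} \<Longrightarrow> inj_on (e I) (V I) \<and> e I ` V I \<subseteq> univ M"
    and compat: "\<And>I J. I \<subset> {1..n} \<Longrightarrow> J \<subset> {1..n} \<Longrightarrow>
      \<exists>g. automorphism M g \<and> (\<forall>v \<in> V (I \<inter> J). g (e I v) = e J v)"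
  obtains f where "inj_on f (V {1..n})" "f ` V {1..n} \<subseteq> univ M"
    "\<And>I. I \<subset> {1..n} \<Longrightarrow> \<exists>g. automorphism M g \<and> (\<forall>v \<in> V I. g (e I v) = f v)"
proof -
  define B where "B I = pullback M (e I) (V I)" for I
  have mono: "V I \<subseteq> V J" if "I \<subseteq> J" for I J using that by (auto simp: V_def)
  have fin: "finite (V I)" if "I \<subseteq> {1..n}" for I
  proof -
    have "finite I" using that finite_subset by blast
    moreover have "finite (K i)" if "i \<in> I" for i using K that \<open>I \<subseteq> {1..n}\<close> by blast
    ultimately show ?thesis by (simp add: V_def)
  qed
  \<comment> \<open>The base of the problem is the face of the empty index set, which is a proper
    face only for \<open>n \<ge> 1\<close>.\<close>
  have empty: "{} \<subset> {1..n}" using n by auto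
  have V0: "V {} = {1..m}" by (simp add: V_def)
  have ind: "induced (B I) (V (I \<inter> J)) = induced (B J) (V (I \<inter> J))"
    if IJ: "I \<subset> {1..n}" "J \<subset> {1..n}" for I J
  proof -
    obtain g where g: "automorphism M g" "\<forall>v \<in> V (I \<inter> J). g (e I v) = e J v"
      using compat[OF IJ] by blast
    have "pullback M (e I) (V (I \<inter> J)) = pullback M (e J) (V (I \<inter> J))"
      by (rule automorphism_pullback[OF g(1)]) (use g e[OF IJ(1)] mono[of "I \<inter> J" I] in auto)
    moreover have "V I \<inter> V (I \<inter> J) = V (I \<inter> J)" "V J \<inter> V (I \<inter> J) = V (I \<inter> J)"
      using mono[of "I \<inter> J" I] mono[of "I \<inter> J" J] by auto
    ultimately show ?thesis by (simp add: B_def induced_pullback)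
  qed
  have "amalgamation_problem n (age L M) m (B {}) K B"
    unfolding amalgamation_problem_def
  proof (intro conjI allI impI ballI)
    show "B {} \<in> age L M" unfolding B_def
      using e[OF empty] fin[of "{}"] by (intro pullback_in_age[OF struct]) auto
    show "univ (B {}) = {1..m}" by (simp add: B_def V0)
    show "finite (K i)" "K i \<noteq> {}" "K i \<inter> {1..m} = {}" if "i \<in> {1..n}" for i using K[OF that] by auto
    show "disjoint_family_on K {1..n}" by fact
    fix I assume I: "I \<subset> {1..n}"
    show "B I \<in> age L M" unfolding B_def
      using e[OF I] fin[of I] I by (intro pullback_in_age[OF struct]) auto
    show "univ (B I) = {1..m} \<union> (\<Union>i\<in>I. K i)" by (simp add: B_def V_def)
    have "induced (B {}) {1..m} = B {}" by (simp add: B_def induced_pullback V0)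
    then show "induced (B I) {1..m} = B {}" using ind[OF I empty] V0 by simp
    fix J assume J: "J \<subset> {1..n}"
    show "induced (B I) ({1..m} \<union> \<Union> (K ` (I \<inter> J))) = induced (B J) ({1..m} \<union> \<Union> (K ` (I \<inter> J)))"
      using ind[OF I J] by (simp add: V_def)
  qed
  with amalg[unfolded disjoint_amalgamation_def]
  have "\<exists>S \<in> age L M. univ S = {1..m} \<union> (\<Union>i \<in> {1..n}. K i) \<and>
      (\<forall>I. I \<subset> {1..n} \<longrightarrow> induced S ({1..m} \<union> (\<Union>i \<in> I. K i)) = B I)"
    by (elim allE impE)
  then obtain S where S: "S \<in> age L M" "univ S = V {1..n}"
    "\<And>I. I \<subset> {1..n} \<Longrightarrow> induced S (V I) = B I"
    unfolding V_def by metis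
  from S(1) obtain f where f: "inj_on f (V {1..n})" "f ` V {1..n} \<subseteq> univ M"
    "S = pullback M f (V {1..n})"
    unfolding age_iff[OF struct] S(2) by metis
  show ?thesis
  proof (rule that[OF f(1,2)])
    fix I assume I: "I \<subset> {1..n}"
    have sub: "V I \<subseteq> V {1..n}" using I mono by blast
    then have "V {1..n} \<inter> V I = V I" by blast
    then have "pullback M (e I) (V I) = pullback M f (V I)"
      using S(3)[OF I] unfolding f(3) induced_pullback B_def by simp
    moreover have "inj_on f (V I)" using f(1) sub inj_on_subset by blast
    moreover have "f ` V I \<subseteq> univ M" using f(2) sub by blast
    moreover have "finite (V I)" using I by (intro fin) auto
    ultimately obtain g where "automorphism M g" "\<And>v. v \<in> V I \<Longrightarrow> g (e I v) = f v"
      using extend_partial_isomorphism[of "V I" "e I" f] e[OF I] by blast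
    then show "\<exists>g. automorphism M g \<and> (\<forall>v \<in> V I. g (e I v) = f v)" by blast
  qed
qed

end

section \<open>Realisations over finite sets from disjoint 2- and 3-amalgamation\<close>

text \<open>The base of an amalgamation problem is an initial segment \<open>{1..m}\<close>, so the
  common part \<open>R\<close> has to receive the first labels.\<close>

lemma enumerate_with_initial:
  assumes W: "finite W" and R: "R \<subseteq> W"
  obtains \<rho> :: "nat \<Rightarrow> 'a" where "bij_betw \<rho> {1..card W} W" "bij_betw \<rho> {1..card R} R"
proof -
  have fin: "finite R" "finite (W - R)" using assms finite_subset by auto
  obtain f where f: "bij_betw f {1..card R} R" using ex_bij_betw_nat_finite_1[OF fin(1)] by blast
  obtain g where g: "bij_betw g {1..card (W - R)} (W - R)"
    using ex_bij_betw_nat_finite_1[OF fin(2)] by blast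
  define \<rho> where "\<rho> i = (if i \<le> card R then f i else g (i - card R))" for i
  have c: "card W = card R + card (W - R)"
    using fin R W by (metis add_diff_inverse_nat card_Diff_subset card_mono leD)
  have 1: "bij_betw \<rho> {1..card R} R"
    using f by (rule iffD1[OF bij_betw_cong, rotated]) (simp add: \<rho>_def)
  have "bij_betw (\<lambda>i. i - card R) {card R + 1..card W} {1..card (W - R)}"
    unfolding c by (rule bij_betw_byWitness[where f' = "\<lambda>i. i + card R"]) auto
  then have "bij_betw (g \<circ> (\<lambda>i. i - card R)) {card R + 1..card W} (W - R)"
    using g by (rule bij_betw_trans)
  then have 2: "bij_betw \<rho> {card R + 1..card W} (W - R)"
    by (rule iffD1[OF bij_betw_cong, rotated]) (simp add: \<rho>_def)
  have "bij_betw \<rho> ({1..card R} \<union> {card R + 1..card W}) (R \<union> (W - R))"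
    using 1 2 by (rule bij_betw_combine) auto
  moreover have "{1..card R} \<union> {card R + 1..card W} = {1..card W}" using c by auto
  moreover have "R \<union> (W - R) = W" using R by auto
  ultimately show ?thesis using that 1 by simp
qed

context homogeneous_structure
begin

text \<open>Disjoint 2-amalgamation over \<open>R\<close> of the set \<open>T\<close> with one new
  point carrying the type of \<open>c\<close> over \<open>R\<close>. Disjointness of the blocks
  keeps the new point out of \<open>T\<close>.\<close>

lemma free_realisation:
  assumes amalg: "disjoint_amalgamation 2 (age L M)"
    and T: "finite T" "T \<subseteq> univ M" and R: "R \<subseteq> T" and c: "c \<in> univ M" "c \<notin> R"
  obtains g where "automorphism M g" "\<And>a. a \<in> R \<Longrightarrow> g a = a" "g c \<notin> T"
proof (cases "R = T")
  \<comment> \<open>Here the first block would be empty, which an amalgamation problem excludes; the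
    identity works.\<close>
  case True
  then show ?thesis using that[OF automorphism_id] c by auto
next
  case False
  obtain \<rho> where \<rho>: "bij_betw \<rho> {1..card T} T" "bij_betw \<rho> {1..card R} R"
    using enumerate_with_initial[OF T(1) R] by blast
  define m x where "m = card R" and "x = card T + 1"
  have mx: "m < x" using card_mono[OF T(1) R] by (simp add: m_def x_def)
  define K where "K i = (if i = 1 then {m + 1..card T} else {x})" for i :: nat
  \<comment> \<open>The point \<open>c\<close> may lie in \<open>T\<close>, and then
    \<open>e\<close> is not injective as a whole. It is injective on each of the two proper faces,
    which is all that is asked.\<close>
  define e where "e v = (if v = x then c else \<rho> v)" for v
  have eT: "e ` {1..card T} = T" "inj_on e {1..card T}"
  proof -
    have "e v = \<rho> v" if "v \<in> {1..card T}" for v using that by (simp add: e_def x_def)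
    then show "e ` {1..card T} = T" "inj_on e {1..card T}"
      using \<rho>(1) inj_on_cong[of "{1..card T}" e \<rho>] unfolding bij_betw_def by auto
  qed
  have eR: "e ` {1..m} = R" "inj_on e {1..m}"
  proof -
    have "e v = \<rho> v" if "v \<in> {1..m}" for v using that mx by (simp add: e_def)
    then show "e ` {1..m} = R" "inj_on e {1..m}"
      using \<rho>(2) inj_on_cong[of "{1..m}" e \<rho>] unfolding bij_betw_def m_def by auto
  qed
  have ex: "e x = c" by (simp add: e_def)
  have mT: "m < card T" using psubset_card_mono[OF T(1), of R] R False by (auto simp: m_def)
  have V1: "{1..m} \<union> (\<Union>i \<in> {1}. K i) = {1..card T}" using mT by (auto simp: K_def)
  have V2: "{1..m} \<union> (\<Union>i \<in> {2}. K i) = insert x {1..m}" by (auto simp: K_def)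
  have V: "{1..m} \<union> (\<Union>i \<in> {1..2}. K i) = {1..x}"
  proof -
    have "{1..2::nat} = {1, 2}" by auto
    then have "{1..m} \<union> (\<Union>i \<in> {1..2}. K i) =
        ({1..m} \<union> (\<Union>i \<in> {1}. K i)) \<union> ({1..m} \<union> (\<Union>i \<in> {2}. K i))" by auto
    also have "\<dots> = {1..x}" unfolding V1 V2 using mT by (auto simp: x_def)
    finally show ?thesis .
  qed
  have proper: "I = {} \<or> I = {1} \<or> I = {2}" if "I \<subset> {1..2::nat}" for I
  proof -
    have *: "{1..2::nat} = {1, 2}" by auto
    then have "I \<in> Pow {1, 2}" "I \<noteq> {1, 2}" using that by auto
    then show ?thesis by (auto simp: Pow_insert)
  qed
  have p12: "{1} \<subset> {1..2::nat}" "{2} \<subset> {1..2::nat}"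
  proof -
    have *: "A \<subset> {1..2}" if "A \<subseteq> {1..2}" "v \<in> {1..2}" "v \<notin> A" for A and v :: nat
      using that by blast
    show "{1} \<subset> {1..2::nat}" by (rule *[of _ 2]) auto
    show "{2} \<subset> {1..2::nat}" by (rule *[of _ 1]) auto
  qed
  show ?thesis
  proof (rule amalgamate_maps[OF amalg, where e = "\<lambda>_. e" and K = K and m = m])
    show "finite (K i) \<and> K i \<noteq> {} \<and> K i \<inter> {1..m} = {}" if "i \<in> {1..2}" for i
      using mT mx by (auto simp: K_def)
    show "disjoint_family_on K {1..2}" by (auto simp: disjoint_family_on_def K_def x_def)
    show "inj_on e ({1..m} \<union> \<Union> (K ` I)) \<and> e ` ({1..m} \<union> \<Union> (K ` I)) \<subseteq> univ M"
      if "I \<subset> {1..2}" for I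
      using proper[OF that]
    proof (elim disjE)
      assume "I = {}" then show ?thesis using eR T R by auto
    next
      assume "I = {1}" then show ?thesis using eT T by (simp only: V1)
    next
      assume I: "I = {2}"
      have "inj_on e (insert x {1..m})" unfolding inj_on_insert using eR ex c by auto
      then show ?thesis using eR ex c T R unfolding I V2 by auto
    qed
    show "\<exists>g. automorphism M g \<and> (\<forall>v\<in>{1..m} \<union> \<Union> (K ` (I \<inter> J)). g (e v) = e v)" for I J
      using automorphism_id by blast
    fix f assume f: "inj_on f ({1..m} \<union> \<Union> (K ` {1..2}))" "f ` ({1..m} \<union> \<Union> (K ` {1..2})) \<subseteq> univ M"
      and gs: "\<And>I. I \<subset> {1..2} \<Longrightarrow>
        \<exists>g. automorphism M g \<and> (\<forall>v\<in>{1..m} \<union> \<Union> (K ` I). g (e v) = f v)"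
    obtain g where g: "automorphism M g" "\<And>v. v \<in> {1..card T} \<Longrightarrow> g (e v) = f v"
      using gs[OF p12(1)] unfolding V1 by blast
    obtain h where h: "automorphism M h" "\<And>v. v \<in> insert x {1..m} \<Longrightarrow> h (e v) = f v"
      using gs[OF p12(2)] unfolding V2 by blast
    obtain g' where g': "automorphism M g'" "\<And>a. a \<in> univ M \<Longrightarrow> g' (g a) = a"
      "\<And>a. a \<in> univ M \<Longrightarrow> g (g' a) = a"
      using automorphism_inverse[OF g(1)] by metis
    show ?thesis
    \<comment> \<open>Inside the solution, \<open>g\<close> places \<open>T\<close> while
      \<open>h\<close> places \<open>R\<close> and \<open>c\<close>. Applying \<open>h\<close> and
      then undoing \<open>g\<close> fixes \<open>R\<close>, and it keeps the image of
      \<open>c\<close> outside \<open>T\<close> because the labelling \<open>f\<close> is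
      injective.\<close>
    proof (rule that[OF automorphism_comp[OF g'(1) h(1)]])
      fix a assume a: "a \<in> R"
      then obtain v where "v \<in> {1..m}" "a = e v" using eR by auto
      then show "g' (h a) = a" using h(2)[of v] g(2)[of v] g'(2)[of a] mT a R T by auto
    next
      show "g' (h c) \<notin> T"
      proof
        assume "g' (h c) \<in> T"
        then obtain v where v: "v \<in> {1..card T}" "g' (h c) = e v" using eT by (metis imageE)
        have "h c = f x" using h(2)[of x] ex by simp
        then have "f x = f v"
          using v g(2)[of v] g'(3)[of "h c"] automorphism_in[OF h(1) c(1)] by simp
        moreover have "x \<in> {1..x}" "v \<in> {1..x}" using v by (auto simp: x_def)
        ultimately have "x = v" using f(1) unfolding V inj_on_def by blast
        then show False using v by (simp add: x_def)
      qed
    qed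
  qed simp
qed

text \<open>With \<open>T = univ M\<close> and \<open>R = {}\<close> in
  \<open>free_realisation\<close>, the copy of \<open>c\<close> would have nowhere to go.\<close>

lemma infinite_univ:
  assumes "disjoint_amalgamation 2 (age L M)" shows "infinite (univ M)"
proof
  assume "finite (univ M)"
  then obtain c where "c \<in> univ M" "finite (univ M)" using nonempty by auto
  then show False
    using free_realisation[OF assms, of "univ M" "{}" c] automorphism_in by (metis empty_iff empty_subsetI order_refl)
qed

text \<open>An independence theorem, obtained from disjoint 3-amalgamation over \<open>R\<close>
  with blocks \<open>Z - R\<close>, \<open>T - R\<close> and a single new point \<open>x\<close>.
  The automorphism \<open>s\<close> certifies that the type of \<open>d\<close> over
  \<open>Z\<close> and that of \<open>c\<close> over \<open>T\<close> agree on
  \<open>R\<close>.\<close>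

lemma joint_realisation:
  assumes amalg: "disjoint_amalgamation 3 (age L M)"
    and Z: "finite Z" "Z \<subseteq> univ M" and T: "finite T" "T \<subseteq> univ M" and R: "Z \<inter> T = R"
    and d: "d \<in> univ M" "d \<notin> Z" and c: "c \<in> univ M" "c \<notin> T"
    and s: "automorphism M s" "\<And>a. a \<in> R \<Longrightarrow> s a = a" "s d = c"
  obtains e u v where "e \<in> univ M" "e \<notin> Z \<union> T"
    "automorphism M u" "\<And>a. a \<in> Z \<Longrightarrow> u a = a" "u d = e"
    "automorphism M v" "\<And>a. a \<in> T \<Longrightarrow> v a = a" "v c = e"
proof -
  consider (Z) "Z = R" | (T) "T = R" | (both) "Z \<noteq> R" "T \<noteq> R" by blast
  then show ?thesis
  proof cases
    \<comment> \<open>Here \<open>Z\<close> is contained in \<open>T\<close> and its block would be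
      empty; \<open>c\<close> itself is the common realisation, reached from \<open>d\<close> by
      \<open>s\<close>.\<close>
    case Z
    then show ?thesis using that[of c s "\<lambda>a. a"] R c s automorphism_id by auto
  next
    case T
    obtain s' where s': "automorphism M s'" "\<And>a. a \<in> univ M \<Longrightarrow> s' (s a) = a"
      "\<And>a. a \<in> univ M \<Longrightarrow> s (s' a) = a"
      using automorphism_inverse[OF s(1)] by metis
    have s'T: "s' a = a" if "a \<in> T" for a using that s'(2)[of a] s(2)[of a] T assms(5) by auto
    have "s' c = d" using s'(2)[OF d(1)] s(3) by simp
    moreover have "d \<notin> Z \<union> T" using d T R by blast
    ultimately show ?thesis using that[OF d(1) _ automorphism_id _ _ s'(1) s'T] by blast
  next
    case both
    let ?W = "Z \<union> T"
    have W: "finite ?W" "R \<subseteq> ?W" using Z T R by auto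
    obtain \<rho> where \<rho>: "bij_betw \<rho> {1..card ?W} ?W" "bij_betw \<rho> {1..card R} R"
      using enumerate_with_initial[OF W] by blast
    define m x where "m = card R" and "x = card ?W + 1"
    have mx: "m < x" using card_mono[OF W] by (simp add: m_def x_def)
    have \<rho>W: "\<rho> ` {1..card ?W} = ?W" "inj_on \<rho> {1..card ?W}" using \<rho>(1) by (auto simp: bij_betw_def)
    have \<rho>R: "\<rho> ` {1..m} = R" using \<rho>(2) by (auto simp: bij_betw_def m_def)
    have lew: "v \<in> {1..card ?W}" if "v \<in> {1..m}" for v using that mx by (auto simp: x_def)
    define K where "K i = (if i = 1 then {v \<in> {1..card ?W}. \<rho> v \<in> Z - R}
       else if i = 2 then {v \<in> {1..card ?W}. \<rho> v \<in> T - R} else {x})" for i :: nat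
    \<comment> \<open>Only the label \<open>x\<close> depends on the face: faces with block
      \<open>2\<close> see the point \<open>c\<close>, all others see \<open>d\<close>.\<close>
    define e where "e I = (\<lambda>v. if v = x then (if 2 \<in> I then c else d) else \<rho> v)" for I :: "nat set"
    define V where "V I = {1..m} \<union> (\<Union>i \<in> I. K i)" for I
    have proper: "I \<in> {{}, {1}, {2}, {3}, {1, 2}, {1, 3}, {2, 3}}" if "I \<subset> {1..3::nat}" for I
    proof -
      have *: "{1..3::nat} = {1, 2, 3}" by auto
      then have "I \<in> Pow {1, 2, 3}" "I \<noteq> {1, 2, 3}" using that by auto
      then show ?thesis by (auto simp: Pow_insert)
    qed
    have p: "{1, 2} \<subset> {1..3::nat}" "{1, 3} \<subset> {1..3::nat}" "{2, 3} \<subset> {1..3::nat}"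
    proof -
      have *: "A \<subset> {1..3}" if "A \<subseteq> {1..3}" "v \<in> {1..3}" "v \<notin> A" for A and v :: nat
        using that by blast
      show "{1, 2} \<subset> {1..3::nat}" by (rule *[of _ 3]) auto
      show "{1, 3} \<subset> {1..3::nat}" by (rule *[of _ 2]) auto
      show "{2, 3} \<subset> {1..3::nat}" by (rule *[of _ 1]) auto
    qed
    have inR: "v \<in> {1..m}" if vR: "v \<in> {1..card ?W}" "\<rho> v \<in> R" for v
    proof -
      obtain w where w: "w \<in> {1..m}" "\<rho> v = \<rho> w" using vR(2) \<rho>R by (metis imageE)
      then have "v = w" using \<rho>W(2) vR(1) lew unfolding inj_on_def by blast
      then show ?thesis using w by simp
    qed
    have VZ: "v \<in> V {1, 3} \<longleftrightarrow> v = x \<or> v \<in> {1..card ?W} \<and> \<rho> v \<in> Z" for v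
      unfolding V_def K_def using inR[of v] lew[of v] \<rho>R R by auto
    have VT: "v \<in> V {2, 3} \<longleftrightarrow> v = x \<or> v \<in> {1..card ?W} \<and> \<rho> v \<in> T" for v
      unfolding V_def K_def using inR[of v] lew[of v] \<rho>R R by auto
    have VW: "v \<in> V {1, 2} \<longleftrightarrow> v \<in> {1..card ?W}" for v
      unfolding V_def K_def using inR[of v] lew[of v] \<rho>R \<rho>W R by auto
    have VA: "v \<in> V {1..3} \<longleftrightarrow> v = x \<or> v \<in> {1..card ?W}" for v
    proof -
      have "{1..3} = {1, 2} \<union> {1, 3::nat}" by auto
      then have "V {1..3} = V {1, 2} \<union> V {1, 3}" by (auto simp: V_def)
      then show ?thesis using VW VZ by auto
    qed
    have Vmono: "V I \<subseteq> V J" if "I \<subseteq> J" for I J using that by (auto simp: V_def)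
    have xW: "x \<notin> {1..card ?W}" by (simp add: x_def)
    have x3: "x \<in> V I \<longleftrightarrow> 3 \<in> I" if "I \<subseteq> {1..3}" for I
    proof -
      have "i = 1 \<or> i = 2 \<or> i = 3" if "i \<in> I" for i using that \<open>I \<subseteq> {1..3}\<close> by force
      then show ?thesis using mx xW by (auto simp: V_def K_def)
    qed
    have inj: "inj_on (\<lambda>v. if v = x then b else \<rho> v) (insert x A)"
      if A: "A \<subseteq> {1..card ?W}" and b: "b \<notin> \<rho> ` A" for A and b
    proof -
      have xA: "x \<notin> A" using A xW by blast
      then have "inj_on (\<lambda>v. if v = x then b else \<rho> v) A \<longleftrightarrow> inj_on \<rho> A"
        by (intro inj_on_cong) auto
      moreover have "inj_on \<rho> A" using \<rho>W(2) A inj_on_subset by blast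
      moreover have "(\<lambda>v. if v = x then b else \<rho> v) ` A = \<rho> ` A"
        using xA by (intro image_cong) auto
      ultimately show ?thesis using b xA by (simp add: inj_on_insert)
    qed
    have e13: "inj_on (e {1, 3}) (V {1, 3}) \<and> e {1, 3} ` V {1, 3} \<subseteq> univ M"
    proof
      have "V {1, 3} = insert x {v \<in> {1..card ?W}. \<rho> v \<in> Z}" using VZ by blast
      moreover have "inj_on (\<lambda>v. if v = x then d else \<rho> v) (insert x {v \<in> {1..card ?W}. \<rho> v \<in> Z})"
        by (rule inj) (use d in auto)
      moreover have "e {1, 3} = (\<lambda>v. if v = x then d else \<rho> v)" by (simp add: e_def fun_eq_iff)
      ultimately show "inj_on (e {1, 3}) (V {1, 3})" by metis
    qed (use VZ d Z in \<open>auto simp: e_def\<close>)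
    have e23: "inj_on (e {2, 3}) (V {2, 3}) \<and> e {2, 3} ` V {2, 3} \<subseteq> univ M"
    proof
      have "V {2, 3} = insert x {v \<in> {1..card ?W}. \<rho> v \<in> T}" using VT by blast
      moreover have "inj_on (\<lambda>v. if v = x then c else \<rho> v) (insert x {v \<in> {1..card ?W}. \<rho> v \<in> T})"
        by (rule inj) (use c in auto)
      moreover have "e {2, 3} = (\<lambda>v. if v = x then c else \<rho> v)" by (simp add: e_def fun_eq_iff)
      ultimately show "inj_on (e {2, 3}) (V {2, 3})" by metis
    qed (use VT c T in \<open>auto simp: e_def\<close>)
    have e12: "inj_on (e {1, 2}) (V {1, 2}) \<and> e {1, 2} ` V {1, 2} \<subseteq> univ M"
    proof
      have V12: "V {1, 2} = {1..card ?W}" using VW by blast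
      have e: "e {1, 2} v = \<rho> v" if "v \<in> {1..card ?W}" for v using that xW by (auto simp: e_def)
      then show "inj_on (e {1, 2}) (V {1, 2})"
        unfolding V12 using \<rho>W(2) inj_on_cong[of "{1..card ?W}" "e {1, 2}" \<rho>] by blast
      have "e {1, 2} ` V {1, 2} = ?W" unfolding V12 using e \<rho>W(1) by (metis (no_types, lifting) image_cong)
      then show "e {1, 2} ` V {1, 2} \<subseteq> univ M" using Z T by blast
    qed
    have down: "inj_on (e I) (V I) \<and> e I ` V I \<subseteq> univ M"
      if IJ: "inj_on (e J) (V J) \<and> e J ` V J \<subseteq> univ M" "I \<subseteq> J" "2 \<in> I \<longleftrightarrow> 2 \<in> J \<or> 3 \<notin> J" "I \<subseteq> {1..3}" for I J
    proof -
      have "e I v = e J v" if "v \<in> V I" for v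
        using IJ(2-4) x3[of I] that by (auto simp: e_def)
      then have "inj_on (e I) (V I) \<longleftrightarrow> inj_on (e J) (V I)" "e I ` V I = e J ` V I"
        using inj_on_cong[of "V I" "e I" "e J"] by (blast, force)
      moreover have "V I \<subseteq> V J" using IJ(2) by (rule Vmono)
      ultimately show ?thesis using IJ(1) inj_on_subset by blast
    qed
    show ?thesis
    proof (rule amalgamate_maps[OF amalg, where e = e and K = K and m = m, folded V_def])
      show "finite (K i) \<and> K i \<noteq> {} \<and> K i \<inter> {1..m} = {}" if i: "i \<in> {1..3}" for i
      proof (intro conjI)
        show "finite (K i)" by (simp add: K_def)
        obtain z t where z: "z \<in> Z - R" and t: "t \<in> T - R" using both R by blast
        then obtain a b where ab: "a \<in> {1..card ?W}" "\<rho> a = z" "b \<in> {1..card ?W}" "\<rho> b = t"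
        proof -
          have "z \<in> \<rho> ` {1..card ?W}" "t \<in> \<rho> ` {1..card ?W}" using z t \<rho>W(1) by blast+
          then show ?thesis using that by (elim imageE) simp
        qed
        then have "a \<in> K 1" "b \<in> K 2" "x \<in> K 3" using z t by (auto simp: K_def)
        moreover have "i = 1 \<or> i = 2 \<or> i = 3" using i by force
        ultimately show "K i \<noteq> {}" by blast
        show "K i \<inter> {1..m} = {}" using \<rho>R mx by (auto simp: K_def)
      qed
      show "disjoint_family_on K {1..3}"
        using xW R by (auto simp: disjoint_family_on_def K_def)
      show "inj_on (e I) (V I) \<and> e I ` V I \<subseteq> univ M" if I: "I \<subset> {1..3}" for I
      proof -
        consider "I \<subseteq> {1, 3}" | "2 \<in> I" "I \<subseteq> {1, 2}" | "I = {2, 3}" using proper[OF I] by auto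
        then show ?thesis
        proof cases
          case 1
          then have "2 \<notin> I" by auto
          then show ?thesis using down[OF e13 1] I by auto
        next
          case 2 then show ?thesis using down[OF e12 2(2)] I by auto
        next
          case 3 then show ?thesis using e23 by simp
        qed
      qed
      show "\<exists>g. automorphism M g \<and> (\<forall>v\<in>V (I \<inter> J). g (e I v) = e J v)"
        if IJ: "I \<subset> {1..3}" "J \<subset> {1..3}" for I J
      \<comment> \<open>Two faces can disagree only at \<open>x\<close>, and only when exactly one
        of them contains block \<open>2\<close>. Their common part is then \<open>R\<close> with the
        new point, where \<open>s\<close> or its inverse takes one labelling to the other.\<close>
      proof (cases "3 \<in> I \<inter> J \<and> (2 \<in> I \<longleftrightarrow> 2 \<notin> J)")
        case False
        have "x \<in> V (I \<inter> J) \<longleftrightarrow> 3 \<in> I \<inter> J" using IJ by (intro x3) auto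
        then have "e I v = e J v" if "v \<in> V (I \<inter> J)" for v using that False by (auto simp: e_def)
        then show ?thesis using automorphism_id by blast
      next
        case True
        have "I \<in> {{2, 3}, {3}, {1, 3}}" "J \<in> {{2, 3}, {3}, {1, 3}}"
          using True proper[OF IJ(1)] proper[OF IJ(2)] by fastforce+
        with True have I3: "I \<inter> J = {3}" by fastforce
        have V3: "V {3} = insert x {1..m}" by (auto simp: V_def K_def)
        have \<rho>_R: "\<rho> v \<in> R" "v \<noteq> x" if "v \<in> {1..m}" for v using \<rho>R that mx by auto
        obtain s' where s': "automorphism M s'" "\<And>a. a \<in> univ M \<Longrightarrow> s' (s a) = a"
          "\<And>a. a \<in> univ M \<Longrightarrow> s (s' a) = a"
          using automorphism_inverse[OF s(1)] by metis
        have s'R: "s' a = a" if "a \<in> R" for a using that s'(2)[of a] s(2)[of a] R T by auto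
        have s'c: "s' c = d" using s'(2)[OF d(1)] s(3) by simp
        show ?thesis
        proof (cases "2 \<in> I")
          case True
          then have "2 \<notin> J" using \<open>3 \<in> I \<inter> J \<and> _\<close> by blast
          then show ?thesis using True s'(1) s'R s'c \<rho>_R unfolding I3 V3 by (intro exI[of _ s']) (auto simp: e_def)
        next
          case False
          then have "2 \<in> J" using \<open>3 \<in> I \<inter> J \<and> _\<close> by blast
          then show ?thesis using False s \<rho>_R unfolding I3 V3 by (intro exI[of _ s]) (auto simp: e_def)
        qed
      qed
      fix f assume f: "inj_on f (V {1..3})" "f ` V {1..3} \<subseteq> univ M"
        and gs: "\<And>I. I \<subset> {1..3} \<Longrightarrow> \<exists>g. automorphism M g \<and> (\<forall>v\<in>V I. g (e I v) = f v)"
      obtain g where g: "automorphism M g" "\<And>v. v \<in> V {1, 2} \<Longrightarrow> g (e {1, 2} v) = f v"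
        using gs[OF p(1)] by blast
      obtain h where h: "automorphism M h" "\<And>v. v \<in> V {1, 3} \<Longrightarrow> h (e {1, 3} v) = f v"
        using gs[OF p(2)] by blast
      obtain h2 where h2: "automorphism M h2" "\<And>v. v \<in> V {2, 3} \<Longrightarrow> h2 (e {2, 3} v) = f v"
        using gs[OF p(3)] by blast
      obtain g' where g': "automorphism M g'" "\<And>a. a \<in> univ M \<Longrightarrow> g' (g a) = a"
        "\<And>a. a \<in> univ M \<Longrightarrow> g (g' a) = a"
        using automorphism_inverse[OF g(1)] by metis
      have fg: "g' (f v) = \<rho> v" if "v \<in> {1..card ?W}" for v
      proof -
        have "\<rho> v \<in> univ M" using \<rho>W(1) that Z T by blast
        moreover have "v \<in> V {1, 2}" using VW that by blast
        moreover have "e {1, 2} v = \<rho> v" using that xW by (auto simp: e_def)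
        ultimately show ?thesis using g(2) g'(2) by metis
      qed
      have fx: "f x \<in> univ M" using f(2) VA by blast
      show ?thesis
      proof (rule that[where e = "g' (f x)", OF _ _ automorphism_comp[OF g'(1) h(1)] _ _ automorphism_comp[OF g'(1) h2(1)]])
        show "g' (f x) \<in> univ M" using fx automorphism_in[OF g'(1)] by blast
        show "g' (f x) \<notin> Z \<union> T"
        proof
          assume "g' (f x) \<in> Z \<union> T"
          then have "g' (f x) \<in> \<rho> ` {1..card ?W}" using \<rho>W(1) by simp
          then obtain v where v: "v \<in> {1..card ?W}" "g' (f x) = \<rho> v" by blast
          then have "g' (f x) = g' (f v)" using fg by simp
          moreover have "f v \<in> univ M" using f(2) VA v by blast
          ultimately have "f x = f v" using g'(3) fx by metis
          then have "x = v" using f(1) VA v unfolding inj_on_def by blast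
          then show False using v xW by simp
        qed
        show "g' (h d) = g' (f x)" using h(2)[of x] VZ[of x] by (simp add: e_def)
        show "g' (h2 c) = g' (f x)" using h2(2)[of x] VT[of x] by (simp add: e_def)
        show "g' (h a) = a" if "a \<in> Z" for a
        proof -
          have "a \<in> \<rho> ` {1..card ?W}" using \<rho>W(1) that by simp
          then obtain v where v: "v \<in> {1..card ?W}" "a = \<rho> v" by blast
          moreover have "v \<in> V {1, 3}" using VZ v that by blast
          moreover have "e {1, 3} v = \<rho> v" using v xW by (auto simp: e_def)
          ultimately show ?thesis using h(2) fg by metis
        qed
        show "g' (h2 a) = a" if "a \<in> T" for a
        proof -
          have "a \<in> \<rho> ` {1..card ?W}" using \<rho>W(1) that by simp
          then obtain v where v: "v \<in> {1..card ?W}" "a = \<rho> v" by blast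
          moreover have "v \<in> V {2, 3}" using VT v that by blast
          moreover have "e {2, 3} v = \<rho> v" using v xW by (auto simp: e_def)
          ultimately show ?thesis using h2(2) fg by metis
        qed
      qed
    qed simp
  qed
qed

end

section \<open>Formulas and types\<close>

lemma tm_val_cong: "(\<And>i. i \<in> tm_vars t \<Longrightarrow> \<sigma> i = \<tau> i) \<Longrightarrow> tm_val \<sigma> t = tm_val \<tau> t"
  by (cases t) auto

lemma sat_cong: "(\<And>i. i \<in> free_vars \<phi> \<Longrightarrow> \<sigma> i = \<tau> i) \<Longrightarrow> sat M \<sigma> \<phi> \<longleftrightarrow> sat M \<tau> \<phi>"
proof (induction \<phi> arbitrary: \<sigma> \<tau>)
  case (Rel R ts)
  have "map (tm_val \<sigma>) ts = map (tm_val \<tau>) ts"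
    using Rel by (auto intro!: tm_val_cong)
  then show ?case by (metis sat.simps(1))
next
  case (Eq s t)
  then show ?case using tm_val_cong[of s \<sigma> \<tau>] tm_val_cong[of t \<sigma> \<tau>] by auto
next
  case (Neg \<phi>)
  have "sat M \<sigma> \<phi> \<longleftrightarrow> sat M \<tau> \<phi>" by (rule Neg.IH) (simp add: Neg.prems)
  then show ?case by simp
next
  case (Conj \<phi> \<psi>)
  have "sat M \<sigma> \<phi> \<longleftrightarrow> sat M \<tau> \<phi>" by (rule Conj.IH) (simp add: Conj.prems)
  moreover have "sat M \<sigma> \<psi> \<longleftrightarrow> sat M \<tau> \<psi>" by (rule Conj.IH) (simp add: Conj.prems)
  ultimately show ?case by simp
next
  case (Ex i \<phi>)
  have "sat M (\<sigma>(i := a)) \<phi> \<longleftrightarrow> sat M (\<tau>(i := a)) \<phi>" for a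
    by (rule Ex.IH) (use Ex.prems in auto)
  then show ?case by simp
qed

lemma tm_vars_map [simp]: "tm_vars (map_tm g t) = tm_vars t"
  by (cases t) auto

lemma free_vars_map [simp]: "free_vars (map_fm id g \<phi>) = free_vars \<phi>"
  by (induction \<phi>) auto

lemma well_formed_map [simp]: "well_formed L (map_fm id g \<phi>) = well_formed L \<phi>"
  by (induction \<phi>) auto

lemma map_fm_in_formulas:
  "\<phi> \<in> formulas L X C \<Longrightarrow> g ` C \<subseteq> D \<Longrightarrow> map_fm id g \<phi> \<in> formulas L X D"
  unfolding formulas_def by (auto simp: fm.set_map)

lemma inst_in_formulas:
  "\<theta> \<in> formulas L X {..<n} \<Longrightarrow> length b = n \<Longrightarrow> set b \<subseteq> C \<Longrightarrow> inst \<theta> b \<in> formulas L X C"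
  unfolding inst_def by (rule map_fm_in_formulas) auto

lemma finite_params: "finite (params \<phi>)"
proof (induction \<phi>)
  case (Rel R ts)
  have "finite (set_tm t)" for t :: "'c tm" by (cases t) auto
  then show ?case by simp
next
  case (Eq s t)
  have "finite (set_tm t)" for t :: "'c tm" by (cases t) auto
  then show ?case by simp
qed auto

lemma map_fm_cong_params: "(\<And>c. c \<in> params \<phi> \<Longrightarrow> g c = h c) \<Longrightarrow> map_fm id g \<phi> = map_fm id h \<phi>"
  by (rule fm.map_cong) auto

lemma map_fm_ident: "(\<And>c. c \<in> params \<phi> \<Longrightarrow> g c = c) \<Longrightarrow> map_fm id g \<phi> = \<phi>"
  using map_fm_cong_params[of \<phi> g id] by (simp add: fm.map_id)

lemma map_fm_compose: "map_fm id g (map_fm id h \<phi>) = map_fm id (\<lambda>a. g (h a)) \<phi>"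
  by (simp add: fm.map_comp comp_def id_def)

lemma map_fm_inst:
  assumes "params \<theta> \<subseteq> {..<length b}"
  shows "map_fm id g (inst \<theta> b) = inst \<theta> (map g b)"
  unfolding inst_def map_fm_compose using assms by (intro map_fm_cong_params) auto

lemma satisfies_sat:
  assumes "free_vars \<phi> \<subseteq> {0}" "\<sigma> 0 = a"
  shows "sat M \<sigma> \<phi> \<longleftrightarrow> satisfies M a \<phi>"
  unfolding satisfies_def using assms by (intro sat_cong) auto

lemma satisfies_simps [simp]:
  "satisfies M a (Neg \<phi>) \<longleftrightarrow> \<not> satisfies M a \<phi>"
  "satisfies M a (Conj \<phi> \<psi>) \<longleftrightarrow> satisfies M a \<phi> \<and> satisfies M a \<psi>"
  "satisfies M a (Eq s t) \<longleftrightarrow> tm_val (\<lambda>_. a) s = tm_val (\<lambda>_. a) t"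
  "satisfies M a (Rel R ts) \<longleftrightarrow> map (tm_val (\<lambda>_. a)) ts \<in> interp M R"
  by (auto simp: satisfies_def)

lemma formulas_simps [simp]:
  "Neg \<phi> \<in> formulas L X C \<longleftrightarrow> \<phi> \<in> formulas L X C"
  "Conj \<phi> \<psi> \<in> formulas L X C \<longleftrightarrow> \<phi> \<in> formulas L X C \<and> \<psi> \<in> formulas L X C"
  by (auto simp: formulas_def)

lemma tm_val_map:
  assumes "tm_vars t \<subseteq> X" "\<And>i. i \<in> X \<Longrightarrow> \<tau> i = g (\<sigma> i)"
  shows "tm_val \<tau> (map_tm g t) = g (tm_val \<sigma> t)"
  using assms by (cases t) auto

lemma tm_val_in:
  assumes "set_tm t \<subseteq> A" "\<And>i. i \<in> tm_vars t \<Longrightarrow> \<sigma> i \<in> A"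
  shows "tm_val \<sigma> t \<in> A"
  using assms by (cases t) auto

lemma sat_automorphism:
  assumes g: "automorphism M g"
  shows "params \<phi> \<subseteq> univ M \<Longrightarrow> (\<And>i. i \<in> free_vars \<phi> \<Longrightarrow> \<sigma> i \<in> univ M) \<Longrightarrow>
    sat M (\<lambda>i. g (\<sigma> i)) (map_fm id g \<phi>) \<longleftrightarrow> sat M \<sigma> \<phi>"
proof (induction \<phi> arbitrary: \<sigma>)
  case (Rel R ts)
  have "set (map (tm_val \<sigma>) ts) \<subseteq> univ M"
    using Rel by (auto intro!: tm_val_in)
  then have "map (tm_val \<sigma>) ts \<in> interp M R \<longleftrightarrow> map g (map (tm_val \<sigma>) ts) \<in> interp M R"
    by (rule automorphismD(3)[OF g])
  moreover have "map g (map (tm_val \<sigma>) ts) = map (tm_val (\<lambda>i. g (\<sigma> i))) (map (map_tm g) ts)"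
    by (auto simp: tm_val_map[of _ UNIV])
  ultimately show ?case by (metis fm.map(1) id_apply sat.simps(1))
next
  case (Eq s t)
  have "tm_val \<sigma> s \<in> univ M" "tm_val \<sigma> t \<in> univ M" using Eq by (auto intro!: tm_val_in)
  then have "g (tm_val \<sigma> s) = g (tm_val \<sigma> t) \<longleftrightarrow> tm_val \<sigma> s = tm_val \<sigma> t"
    using automorphismD(1)[OF g] by (metis inj_on_def)
  then show ?case by (simp add: tm_val_map[of _ UNIV _ g \<sigma>])
next
  case (Neg \<phi>)
  then show ?case by simp
next
  case (Conj \<phi> \<psi>)
  then show ?case by simp
next
  case (Ex i \<phi>)
  have upd: "sat M ((\<lambda>j. g (\<sigma> j))(i := g a)) (map_fm id g \<phi>) \<longleftrightarrow> sat M (\<sigma>(i := a)) \<phi>"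
    if "a \<in> univ M" for a
  proof -
    have "sat M (\<lambda>j. g ((\<sigma>(i := a)) j)) (map_fm id g \<phi>) \<longleftrightarrow> sat M (\<sigma>(i := a)) \<phi>"
      by (rule Ex.IH) (use Ex.prems that in auto)
    moreover have "(\<lambda>j. g ((\<sigma>(i := a)) j)) = (\<lambda>j. g (\<sigma> j))(i := g a)" by auto
    ultimately show ?thesis by simp
  qed
  have "(\<exists>b \<in> univ M. sat M ((\<lambda>j. g (\<sigma> j))(i := b)) (map_fm id g \<phi>)) \<longleftrightarrow>
      (\<exists>b \<in> g ` univ M. sat M ((\<lambda>j. g (\<sigma> j))(i := b)) (map_fm id g \<phi>))"
    using automorphismD(2)[OF g] by simp
  then show ?case using upd by (simp add: id_def)
qed

lemma satisfies_automorphism: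
  assumes "automorphism M g" "\<phi> \<in> x_formulas L (univ M)" "a \<in> univ M"
  shows "satisfies M (g a) (map_fm id g \<phi>) \<longleftrightarrow> satisfies M a \<phi>"
  using sat_automorphism[OF assms(1), of \<phi> "\<lambda>_. a"] assms
  by (auto simp: satisfies_def formulas_def)

section \<open>Types, basic clopen sets and the action of automorphisms\<close>

lemma type_spaceD:
  assumes "p \<in> type_space L M"
  shows "\<phi> \<in> p \<Longrightarrow> \<phi> \<in> x_formulas L (univ M)"
    "finite q \<Longrightarrow> q \<subseteq> p \<Longrightarrow> \<exists>a \<in> univ M. \<forall>\<phi> \<in> q. satisfies M a \<phi>"
    "\<phi> \<in> x_formulas L (univ M) \<Longrightarrow> \<phi> \<in> p \<or> Neg \<phi> \<in> p"
  using assms unfolding type_space_def finitely_satisfiable_def by auto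

text \<open>Types are finitely satisfiable in \<open>M\<close> itself, so an implication that holds
  at all elements of \<open>M\<close> suffices: a type that omits \<open>\<phi>\<close> contains
  \<open>Neg \<phi>\<close>, and some element would satisfy this together with
  \<open>q\<close>.\<close>

lemma type_consequence:
  assumes p: "p \<in> type_space L M" and q: "finite q" "q \<subseteq> p"
    and \<phi>: "\<phi> \<in> x_formulas L (univ M)"
    and imp: "\<And>a. a \<in> univ M \<Longrightarrow> (\<And>\<psi>. \<psi> \<in> q \<Longrightarrow> satisfies M a \<psi>) \<Longrightarrow> satisfies M a \<phi>"
  shows "\<phi> \<in> p"
proof (rule ccontr)
  assume "\<phi> \<notin> p"
  then have "Neg \<phi> \<in> p" using type_spaceD(3)[OF p \<phi>] by blast
  then obtain a where a: "a \<in> univ M" "\<And>\<psi>. \<psi> \<in> insert (Neg \<phi>) q \<Longrightarrow> satisfies M a \<psi>"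
    using type_spaceD(2)[OF p, of "insert (Neg \<phi>) q"] q by blast
  then show False using imp[of a] by fastforce
qed

lemma type_Neg:
  assumes "p \<in> type_space L M" "\<phi> \<in> x_formulas L (univ M)"
  shows "Neg \<phi> \<in> p \<longleftrightarrow> \<phi> \<notin> p"
proof
  assume "Neg \<phi> \<in> p"
  then show "\<phi> \<notin> p" using type_spaceD(2)[OF assms(1), of "{\<phi>, Neg \<phi>}"] by auto
qed (use type_spaceD(3)[OF assms] in blast)

lemma type_Conj:
  assumes "p \<in> type_space L M" "\<phi> \<in> x_formulas L (univ M)" "\<psi> \<in> x_formulas L (univ M)"
  shows "Conj \<phi> \<psi> \<in> p \<longleftrightarrow> \<phi> \<in> p \<and> \<psi> \<in> p"
proof
  assume "Conj \<phi> \<psi> \<in> p"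
  then show "\<phi> \<in> p \<and> \<psi> \<in> p"
    using type_consequence[OF assms(1), of "{Conj \<phi> \<psi>}"] assms by auto
next
  assume "\<phi> \<in> p \<and> \<psi> \<in> p"
  then show "Conj \<phi> \<psi> \<in> p"
    using assms by (intro type_consequence[OF assms(1), of "{\<phi>, \<psi>}"]) auto
qed

definition truth :: "('r, 'c) fm" where "truth = Eq (Var 0) (Var 0)"

lemma truth_simps [simp]: "satisfies M a truth" "truth \<in> formulas L {0} C"
  "map_fm id g truth = truth" "params truth = {}"
  by (auto simp: truth_def formulas_def)

lemma types_containing_Neg:
  assumes "\<phi> \<in> x_formulas L (univ M)"
  shows "types_containing L M (Neg \<phi>) = type_space L M - types_containing L M \<phi>"
  using assms unfolding types_containing_def by (auto simp: type_Neg)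

lemma types_containing_Conj:
  assumes "\<phi> \<in> x_formulas L (univ M)" "\<psi> \<in> x_formulas L (univ M)"
  shows "types_containing L M (Conj \<phi> \<psi>) = types_containing L M \<phi> \<inter> types_containing L M \<psi>"
  using assms unfolding types_containing_def by (auto simp: type_Conj)

lemma types_containing_truth: "types_containing L M truth = type_space L M"
  unfolding types_containing_def using type_consequence[of _ L M "{}" truth] by auto

lemma type_of_element:
  assumes "a \<in> univ M"
  shows "{\<phi> \<in> x_formulas L (univ M). satisfies M a \<phi>} \<in> type_space L M"
  unfolding type_space_def finitely_satisfiable_def using assms by auto

text \<open>The types of the elements of \<open>M\<close> already separate basic clopen sets, so
  these sets are ordered exactly like the definable subsets of \<open>M\<close>.\<close>

lemma types_containing_mono_iff:
  assumes "\<phi> \<in> x_formulas L (univ M)" "\<psi> \<in> x_formulas L (univ M)"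
  shows "types_containing L M \<phi> \<subseteq> types_containing L M \<psi> \<longleftrightarrow>
    (\<forall>a \<in> univ M. satisfies M a \<phi> \<longrightarrow> satisfies M a \<psi>)"
proof
  assume sub: "types_containing L M \<phi> \<subseteq> types_containing L M \<psi>"
  show "\<forall>a \<in> univ M. satisfies M a \<phi> \<longrightarrow> satisfies M a \<psi>"
  proof (intro ballI impI)
    fix a assume "a \<in> univ M" "satisfies M a \<phi>"
    then have "{\<phi> \<in> x_formulas L (univ M). satisfies M a \<phi>} \<in> types_containing L M \<phi>"
      unfolding types_containing_def using type_of_element assms by auto
    then show "satisfies M a \<psi>" using sub unfolding types_containing_def by auto
  qed
next
  assume "\<forall>a \<in> univ M. satisfies M a \<phi> \<longrightarrow> satisfies M a \<psi>"
  then show "types_containing L M \<phi> \<subseteq> types_containing L M \<psi>"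
    unfolding types_containing_def using type_consequence[of _ L M "{\<phi>}" \<psi>] assms by auto
qed

lemma type_action_in:
  assumes g: "automorphism M g" and p: "p \<in> type_space L M"
  shows "type_action g p \<in> type_space L M"
proof -
  obtain h where h: "automorphism M h" "\<And>a. a \<in> univ M \<Longrightarrow> h (g a) = a"
    "\<And>a. a \<in> univ M \<Longrightarrow> g (h a) = a"
    using automorphism_inverse[OF g] by metis
  have gf: "map_fm id g \<phi> \<in> x_formulas L (univ M)" if "\<phi> \<in> x_formulas L (univ M)" for \<phi>
    using that automorphismD(2)[OF g] by (intro map_fm_in_formulas) auto
  have hf: "map_fm id h \<phi> \<in> x_formulas L (univ M)" if "\<phi> \<in> x_formulas L (univ M)" for \<phi>
    using that automorphismD(2)[OF h(1)] by (intro map_fm_in_formulas) auto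
  have gh: "map_fm id g (map_fm id h \<phi>) = \<phi>" if "\<phi> \<in> x_formulas L (univ M)" for \<phi>
    unfolding map_fm_compose using that h(3) by (intro map_fm_ident) (auto simp: formulas_def)
  show ?thesis
    unfolding type_space_def finitely_satisfiable_def
  proof (intro CollectI conjI ballI allI impI)
    show "type_action g p \<subseteq> x_formulas L (univ M)"
      unfolding type_action_def using type_spaceD(1)[OF p] gf by auto
    fix q assume q: "finite q" "q \<subseteq> type_action g p"
    then obtain r where r: "finite r" "r \<subseteq> p" "q = map_fm id g ` r"
      unfolding type_action_def by (meson finite_subset_image)
    then obtain a where a: "a \<in> univ M" "\<forall>\<phi> \<in> r. satisfies M a \<phi>"
      using type_spaceD(2)[OF p] by blast
    then have "\<forall>\<phi> \<in> q. satisfies M (g a) \<phi>"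
      using r type_spaceD(1)[OF p] satisfies_automorphism[OF g] by fast
    then show "\<exists>a\<in>univ M. \<forall>\<phi>\<in>q. satisfies M a \<phi>" using a automorphism_in[OF g] by blast
  next
    fix \<phi> assume \<phi>: "\<phi> \<in> x_formulas L (univ M)"
    then have "map_fm id h \<phi> \<in> p \<or> map_fm id h (Neg \<phi>) \<in> p"
      using type_spaceD(3)[OF p hf] by simp
    moreover have "map_fm id g (map_fm id h (Neg \<phi>)) = Neg \<phi>" using gh[of "Neg \<phi>"] \<phi> by simp
    ultimately show "\<phi> \<in> type_action g p \<or> Neg \<phi> \<in> type_action g p"
      unfolding type_action_def using gh[OF \<phi>] by (metis imageI)
  qed
qed

lemma type_action_inverse:
  assumes p: "p \<in> type_space L M" and "\<And>a. a \<in> univ M \<Longrightarrow> g (h a) = a"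
  shows "type_action g (type_action h p) = p"
proof -
  have "map_fm id g (map_fm id h \<phi>) = \<phi>" if "\<phi> \<in> p" for \<phi>
    unfolding map_fm_compose using type_spaceD(1)[OF p that] assms(2)
    by (intro map_fm_ident) (auto simp: formulas_def)
  then show ?thesis unfolding type_action_def image_image by simp
qed

lemma type_action_types_containing:
  assumes g: "automorphism M g" and \<phi>: "\<phi> \<in> x_formulas L (univ M)"
  shows "type_action g ` types_containing L M \<phi> = types_containing L M (map_fm id g \<phi>)"
proof -
  have sub: "type_action f ` types_containing L M \<psi> \<subseteq> types_containing L M (map_fm id f \<psi>)"
    if "automorphism M f" for f \<psi>
    unfolding types_containing_def using type_action_in[OF that] by (auto simp: type_action_def)
  obtain h where h: "automorphism M h" "\<And>a. a \<in> univ M \<Longrightarrow> h (g a) = a"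
    "\<And>a. a \<in> univ M \<Longrightarrow> g (h a) = a"
    using automorphism_inverse[OF g] by metis
  have "map_fm id h (map_fm id g \<phi>) = \<phi>"
    unfolding map_fm_compose using \<phi> h(2) by (intro map_fm_ident) (auto simp: formulas_def)
  then have hsub: "type_action h ` types_containing L M (map_fm id g \<phi>) \<subseteq> types_containing L M \<phi>"
    using sub[OF h(1), of "map_fm id g \<phi>"] by simp
  have "p \<in> type_action g ` types_containing L M \<phi>"
    if p: "p \<in> types_containing L M (map_fm id g \<phi>)" for p
  proof -
    have "p = type_action g (type_action h p)"
      using p type_action_inverse[of p L M g h] h(3) unfolding types_containing_def by simp
    moreover have "type_action h p \<in> types_containing L M \<phi>" using p hsub by blast
    ultimately show ?thesis by blast
  qed
  then show ?thesis using sub[OF g, of \<phi>] by blast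
qed

lemma topspace_type_topology: "topspace (type_topology L M) = type_space L M"
proof -
  have "types_containing L M \<phi> \<subseteq> type_space L M" for \<phi> by (auto simp: types_containing_def)
  moreover have "type_space L M \<in> types_containing L M ` x_formulas L (univ M)"
    using types_containing_truth[of L M] by (metis image_eqI truth_simps(2))
  ultimately show ?thesis
    unfolding type_topology_def topology_generated_by_topspace by blast
qed

lemma openin_types_containing:
  assumes "\<phi> \<in> x_formulas L (univ M)"
  shows "openin (type_topology L M) (types_containing L M \<phi>)"
  unfolding type_topology_def using assms by (intro topology_generated_by_Basis) auto

lemma keisler_measureD:
  assumes "keisler_measure L M \<mu>"
  shows "prob_space \<mu>" "space \<mu> = type_space L M"
    "\<phi> \<in> x_formulas L (univ M) \<Longrightarrow> types_containing L M \<phi> \<in> sets \<mu>"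
proof -
  show "prob_space \<mu>" "space \<mu> = type_space L M"
    using assms by (auto simp: keisler_measure_def)
  assume "\<phi> \<in> x_formulas L (univ M)"
  then have "types_containing L M \<phi> \<in> sigma_sets (type_space L M) {U. openin (type_topology L M) U}"
    using openin_types_containing by (intro sigma_sets.Basic) auto
  then show "types_containing L M \<phi> \<in> sets \<mu>" using assms by (auto simp: keisler_measure_def)
qed

lemma measure_automorphism:
  assumes \<mu>: "invariant_keisler_measure L M \<mu>" and g: "automorphism M g"
    and \<phi>: "\<phi> \<in> x_formulas L (univ M)"
  shows "measure \<mu> (types_containing L M (map_fm id g \<phi>)) = measure \<mu> (types_containing L M \<phi>)"
proof -
  have K: "keisler_measure L M \<mu>" using \<mu> by (simp add: invariant_keisler_measure_def)
  have "emeasure \<mu> (type_action g ` types_containing L M \<phi>) = emeasure \<mu> (types_containing L M \<phi>)"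
    using \<mu> g keisler_measureD(3)[OF K \<phi>]
    unfolding invariant_keisler_measure_def invariant_measure_def by blast
  then show ?thesis unfolding type_action_types_containing[OF g \<phi>] measure_def by simp
qed

section \<open>Exchangeability\<close>

text \<open>Exponential moments are summed over all choices \<open>T\<close>. For fixed
  \<open>Q\<close> the sum factors over the elements of \<open>E\<close>: one where
  \<open>Y Q\<close> holds contributes \<open>exp l + exp (- l)\<close>, any other contributes
  \<open>2\<close>, which is no more. The left-hand side is the same product for the mean values,
  dominated choice by choice by some \<open>Q\<close>.\<close>

lemma random_colouring_bound:
  fixes Y :: "'q \<Rightarrow> 'e \<Rightarrow> bool" and p\<^sub>1 p\<^sub>2 l :: real
  assumes E: "finite E" and Q: "finite \<Q>" and l: "l \<ge> 0"
    and choice: "\<And>T. T \<subseteq> E \<Longrightarrow> \<exists>Q \<in> \<Q>. real (card T) * p\<^sub>1 - real (card (E - T)) * p\<^sub>2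
      \<le> real (card {e \<in> T. Y Q e}) - real (card {e \<in> E - T. Y Q e})"
  shows "(exp (l * p\<^sub>1) + exp (- (l * p\<^sub>2))) ^ card E \<le> real (card \<Q>) * (exp l + exp (- l)) ^ card E"
proof -
  define x y where "x Q e = (if Y Q e then exp l else 1)"
    and "y Q e = (if Y Q e then exp (- l) else 1)" for Q e
  \<comment> \<open>\<open>W Q T\<close> is the exponential of \<open>l\<close> times the
    correlation between \<open>Y Q\<close> and the choice \<open>T\<close>; the product form serves
    for summing over \<open>T\<close>, the exponential form for using \<open>choice\<close>.\<close>
  define W where "W Q T = (\<Prod>e\<in>T. x Q e) * (\<Prod>e\<in>E - T. y Q e)" for Q T
  have W: "W Q T = exp (l * (real (card {e \<in> T. Y Q e}) - real (card {e \<in> E - T. Y Q e})))"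
    if "T \<subseteq> E" for Q T
  proof -
    have fin: "finite T" "finite (E - T)" using that E finite_subset by auto
    have "(\<Prod>e\<in>T. x Q e) = exp l ^ card {e \<in> T. Y Q e}"
      using fin by (simp add: x_def prod.If_cases Int_def)
    moreover have "(\<Prod>e\<in>E - T. y Q e) = exp (- l) ^ card {e \<in> E - T. Y Q e}"
      using fin by (simp add: y_def prod.If_cases Int_def)
    ultimately show ?thesis
      by (simp add: W_def right_diff_distrib exp_diff exp_of_nat_mult[symmetric] exp_minus
          divide_inverse mult.commute power_inverse)
  qed
  have Wpos: "W Q T \<ge> 0" for Q T
    unfolding W_def x_def y_def by (intro mult_nonneg_nonneg prod_nonneg) auto
  have "(exp (l * p\<^sub>1) + exp (- (l * p\<^sub>2))) ^ card E = (\<Prod>e\<in>E. exp (l * p\<^sub>1) + exp (- (l * p\<^sub>2)))"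
    by simp
  also have "\<dots> = (\<Sum>T\<in>Pow E. (\<Prod>e\<in>T. exp (l * p\<^sub>1)) * (\<Prod>e\<in>E - T. exp (- (l * p\<^sub>2))))"
    by (rule prod_add[OF E])
  also have "\<dots> \<le> (\<Sum>T\<in>Pow E. \<Sum>Q\<in>\<Q>. W Q T)"
  proof (rule sum_mono)
    fix T assume "T \<in> Pow E"
    then have T: "T \<subseteq> E" by simp
    from choice[OF T] obtain Q where Q': "Q \<in> \<Q>"
      and le: "real (card T) * p\<^sub>1 - real (card (E - T)) * p\<^sub>2
      \<le> real (card {e \<in> T. Y Q e}) - real (card {e \<in> E - T. Y Q e})" by blast
    have "(\<Prod>e\<in>T. exp (l * p\<^sub>1)) * (\<Prod>e\<in>E - T. exp (- (l * p\<^sub>2))) =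
        exp (real (card T) * (l * p\<^sub>1)) * exp (real (card (E - T)) * (- (l * p\<^sub>2)))"
      by (simp only: prod_constant exp_of_nat_mult)
    also have "\<dots> = exp (l * (real (card T) * p\<^sub>1 - real (card (E - T)) * p\<^sub>2))"
      by (simp add: exp_add[symmetric] algebra_simps)
    also have "\<dots> \<le> W Q T" unfolding W[OF T] using le l by (simp add: mult_left_mono)
    also have "\<dots> \<le> (\<Sum>Q\<in>\<Q>. W Q T)" using Q Q' Wpos by (intro member_le_sum) auto
    finally show "(\<Prod>e\<in>T. exp (l * p\<^sub>1)) * (\<Prod>e\<in>E - T. exp (- (l * p\<^sub>2))) \<le> (\<Sum>Q\<in>\<Q>. W Q T)" .
  qed
  also have "\<dots> = (\<Sum>Q\<in>\<Q>. \<Sum>T\<in>Pow E. W Q T)" by (rule sum.swap)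
  also have "\<dots> = (\<Sum>Q\<in>\<Q>. \<Prod>e\<in>E. x Q e + y Q e)"
    unfolding W_def by (intro sum.cong refl prod_add[OF E, symmetric])
  also have "\<dots> \<le> (\<Sum>Q\<in>\<Q>. (exp l + exp (- l)) ^ card E)"
  proof (rule sum_mono)
    fix Q
    have "(1 + l) + (1 + (- l)) \<le> exp l + exp (- l)"
      by (intro add_mono exp_ge_add_one_self)
    then have two: "2 \<le> exp l + exp (- l)" by simp
    have "(\<Prod>e\<in>E. x Q e + y Q e) \<le> (\<Prod>e\<in>E. exp l + exp (- l))"
    proof (intro prod_mono conjI)
      show "0 \<le> x Q i + y Q i" for i unfolding x_def y_def by (intro add_nonneg_nonneg) auto
      show "x Q i + y Q i \<le> exp l + exp (- l)" for i unfolding x_def y_def using two by auto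
    qed
    then show "(\<Prod>e\<in>E. x Q e + y Q e) \<le> (exp l + exp (- l)) ^ card E" by simp
  qed
  finally show ?thesis by simp
qed

text \<open>To second order the left side is at most \<open>2 + 2 * l\<^sup>2\<close> and the right
  side at least \<open>2 + l * (p\<^sub>1 - p\<^sub>2)\<close>. The value
  \<open>l = (p\<^sub>1 - p\<^sub>2) / 4\<close> makes the latter
  \<open>2 + 4 * l\<^sup>2\<close>.\<close>

lemma exponential_gap:
  fixes p\<^sub>1 p\<^sub>2 :: real
  assumes "p\<^sub>2 < p\<^sub>1" "0 \<le> p\<^sub>2" "p\<^sub>1 \<le> 1"
  obtains l where "l \<ge> 0" "exp l + exp (- l) < exp (l * p\<^sub>1) + exp (- (l * p\<^sub>2))"
proof
  define l where "l = (p\<^sub>1 - p\<^sub>2) / 4"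
  have l: "0 < l" "l \<le> 1" using assms by (auto simp: l_def)
  show "(p\<^sub>1 - p\<^sub>2) / 4 \<ge> 0" using assms by simp
  have "exp l \<le> 1 + l + l\<^sup>2" using exp_bound l by simp
  moreover have "exp (- l) \<le> 1 - l + l\<^sup>2"
  proof -
    have "1 \<le> (1 + l) * (1 - l + l\<^sup>2)" using l by (simp add: algebra_simps power2_eq_square)
    also have "\<dots> \<le> exp l * (1 - l + l\<^sup>2)"
      using l by (intro mult_right_mono exp_ge_add_one_self) auto
    finally show ?thesis by (simp add: exp_minus inverse_eq_divide divide_le_eq mult.commute)
  qed
  moreover have "1 + l * p\<^sub>1 \<le> exp (l * p\<^sub>1)" "1 + (- (l * p\<^sub>2)) \<le> exp (- (l * p\<^sub>2))"
    by (rule exp_ge_add_one_self)+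
  moreover have "2 * l\<^sup>2 < l * p\<^sub>1 - l * p\<^sub>2"
  proof -
    have "l * p\<^sub>1 - l * p\<^sub>2 = l * (4 * l)" by (simp add: l_def algebra_simps)
    then show ?thesis using l by (simp add: power2_eq_square)
  qed
  ultimately have "exp l + exp (- l) < exp (l * p\<^sub>1) + exp (- (l * p\<^sub>2))" by linarith
  then show "exp ((p\<^sub>1 - p\<^sub>2) / 4) + exp (- ((p\<^sub>1 - p\<^sub>2) / 4)) <
    exp ((p\<^sub>1 - p\<^sub>2) / 4 * p\<^sub>1) + exp (- ((p\<^sub>1 - p\<^sub>2) / 4 * p\<^sub>2))" by (simp add: l_def)
qed

text \<open>In logarithms, \<open>m\<close> exceeds \<open>n ^ k\<close> by the factor
  \<open>c * n powr \<alpha>\<close>, which tends to infinity; the threshold \<open>q\<close> is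
  where this factor absorbs \<open>D * ln 2 / ln \<rho>\<close>.\<close>

lemma superpolynomial_growth:
  fixes \<rho> c \<alpha> :: real
  assumes "\<rho> > 1" "c > 0" "\<alpha> > 0"
  obtains n\<^sub>0 where "\<And>n m. n \<ge> n\<^sub>0 \<Longrightarrow> real m \<ge> c * real n powr (real k + \<alpha>) \<Longrightarrow>
    \<rho> ^ m > 2 ^ (D * n ^ k)"
proof
  define q where "q = (D * ln 2 / (c * ln \<rho>) + 1) powr (1 / \<alpha>)"
  have ln\<rho>: "ln \<rho> > 0" using assms by simp
  have base: "D * ln 2 / (c * ln \<rho>) + 1 > 0"
    using assms ln\<rho> by (intro add_nonneg_pos divide_nonneg_nonneg mult_nonneg_nonneg) auto
  fix n m assume n: "n \<ge> nat \<lceil>q\<rceil> + 1" and m: "real m \<ge> c * real n powr (real k + \<alpha>)"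
  have npos: "real n > 0" using n by simp
  have nq: "real n \<ge> q" using n by linarith
  have "q powr \<alpha> = D * ln 2 / (c * ln \<rho>) + 1"
    unfolding q_def powr_powr using assms base by simp
  moreover have "q powr \<alpha> \<le> real n powr \<alpha>" using nq assms by (intro powr_mono2) (auto simp: q_def)
  ultimately have "D * ln 2 / (c * ln \<rho>) < real n powr \<alpha>" by linarith
  then have *: "D * ln 2 < c * real n powr \<alpha> * ln \<rho>"
    using assms ln\<rho> by (simp add: divide_less_eq mult_ac)
  have "ln (2 ^ (D * n ^ k)) = real n ^ k * (D * ln 2)" by (simp add: ln_realpow)
  also have "\<dots> < real n ^ k * (c * real n powr \<alpha> * ln \<rho>)"
    using * npos by (intro mult_strict_left_mono) auto
  also have "\<dots> = c * real n powr (real k + \<alpha>) * ln \<rho>"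
    using npos by (simp add: powr_add powr_realpow)
  also have "\<dots> \<le> real m * ln \<rho>" using m ln\<rho> by (intro mult_right_mono) auto
  also have "\<dots> = ln (\<rho> ^ m)" using assms by (simp add: ln_realpow)
  finally have less: "ln (2 ^ (D * n ^ k)) < ln (\<rho> ^ m)" .
  have "(0 :: real) < 2 ^ (D * n ^ k)" "0 < \<rho> ^ m" using assms by auto
  from iffD1[OF ln_less_cancel_iff[OF this] less] show "\<rho> ^ m > 2 ^ (D * n ^ k)" .
qed

text \<open>A random variable that stays below its mean almost everywhere would have a smaller mean.
  A null set does not affect this, so the point can be chosen outside \<open>N\<close>.\<close>

lemma exists_ge_expected_difference:
  assumes P: "prob_space \<mu>" and E: "finite E" "T \<subseteq> E" and U: "\<And>e. e \<in> E \<Longrightarrow> U e \<in> sets \<mu>"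
    and N: "N \<in> null_sets \<mu>"
  shows "\<exists>p \<in> space \<mu> - N. (\<Sum>e\<in>T. measure \<mu> (U e)) - (\<Sum>e\<in>E - T. measure \<mu> (U e))
      \<le> real (card {e \<in> T. p \<in> U e}) - real (card {e \<in> E - T. p \<in> U e})"
proof (rule ccontr)
  interpret prob_space \<mu> by fact
  define X where "X p = (\<Sum>e\<in>T. indicat_real (U e) p) - (\<Sum>e\<in>E - T. indicat_real (U e) p)" for p
  have fin: "finite T" "finite (E - T)" using E finite_subset by auto
  have X: "X p = real (card {e \<in> T. p \<in> U e}) - real (card {e \<in> E - T. p \<in> U e})" for p
    unfolding X_def using fin by (simp add: indicator_def sum.If_cases Int_def)
  have int: "integrable \<mu> (indicat_real (U e))" if "e \<in> E" for e
    using U[OF that] by (simp add: integrable_indicator_iff emeasure_eq_measure)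
  have intT: "integrable \<mu> (\<lambda>p. \<Sum>e\<in>T. indicat_real (U e) p)"
    "integrable \<mu> (\<lambda>p. \<Sum>e\<in>E - T. indicat_real (U e) p)"
    using int E by (auto intro!: Bochner_Integration.integrable_sum)
  then have "integrable \<mu> X" unfolding X_def by (rule Bochner_Integration.integrable_diff)
  moreover assume neg: "\<not> ?thesis"
  have lt: "X p < (\<Sum>e\<in>T. measure \<mu> (U e)) - (\<Sum>e\<in>E - T. measure \<mu> (U e))" if "p \<in> space \<mu> - N" for p
    unfolding X using neg that by (meson not_le)
  have "AE p in \<mu>. X p < (\<Sum>e\<in>T. measure \<mu> (U e)) - (\<Sum>e\<in>E - T. measure \<mu> (U e))"
    using AE_not_in[OF N] AE_space by eventually_elim (use lt in auto)
  ultimately have "expectation X < (\<Sum>e\<in>T. measure \<mu> (U e)) - (\<Sum>e\<in>E - T. measure \<mu> (U e))"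
    by (rule expectation_less)
  moreover have "expectation X = (\<Sum>e\<in>T. expectation (indicat_real (U e))) - (\<Sum>e\<in>E - T. expectation (indicat_real (U e)))"
    unfolding X_def Bochner_Integration.integral_diff[OF intT] using int E
    by (subst (1 2) Bochner_Integration.integral_sum) auto
  moreover have "expectation (indicat_real (U e)) = measure \<mu> (U e)" if "e \<in> E" for e
    using U[OF that] by simp
  ultimately show False using E by (simp add: subset_eq)
qed

text \<open>A pattern over \<open>V\<close> records the relations between \<open>x\<close> and tuples from \<open>V\<close>.
  In \<open>pattern_holds\<close> the equality clause is only right for elements \<open>x\<close> outside the
  parameters.\<close>

definition atom_lists :: "nat \<Rightarrow> 'b set \<Rightarrow> 'b tm list set" where
  "atom_lists k V = {ts. length ts = k + 1 \<and> distinct ts \<and> Var 0 \<in> set ts \<and>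
     set ts \<subseteq> insert (Var 0) (Par ` V)}"

fun pattern_holds :: "('r \<times> 'b tm list) set \<Rightarrow> ('c \<Rightarrow> 'b) \<Rightarrow> ('r, 'c) fm \<Rightarrow> bool" where
  "pattern_holds Q h (Rel R ts) \<longleftrightarrow> (R, map (map_tm h) ts) \<in> Q"
| "pattern_holds Q h (Eq s t) \<longleftrightarrow> map_tm h s = map_tm h t"
| "pattern_holds Q h (Neg \<phi>) \<longleftrightarrow> \<not> pattern_holds Q h \<phi>"
| "pattern_holds Q h (Conj \<phi> \<psi>) \<longleftrightarrow> pattern_holds Q h \<phi> \<and> pattern_holds Q h \<psi>"
| "pattern_holds Q h (Ex i \<phi>) \<longleftrightarrow> False"

lemma finite_atom_lists: "finite V \<Longrightarrow> finite (atom_lists k V)"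
  by (rule finite_subset[OF _ finite_lists_length_eq[of "insert (Var 0) (Par ` V)" "k + 1"]])
    (auto simp: atom_lists_def)

text \<open>A list is determined by the position of \<open>x\<close> and its \<open>k\<close> other
  entries.\<close>

lemma card_atom_lists:
  assumes "finite V"
  shows "card (atom_lists k V) \<le> (k + 1) * card V ^ k"
proof -
  let ?A = "{..k} \<times> {us. set us \<subseteq> Par ` V \<and> length us = k}"
  let ?f = "\<lambda>(i, us). take i us @ Var 0 # drop i us"
  have fin: "finite {us. set us \<subseteq> Par ` V \<and> length us = k}"
    using assms by (intro finite_lists_length_eq) auto
  have "atom_lists k V \<subseteq> ?f ` ?A"
  proof
    fix ts assume ts: "ts \<in> atom_lists k V"
    then obtain as bs where *: "ts = as @ Var 0 # bs" unfolding atom_lists_def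
      by (auto dest: split_list)
    with ts have "(length as, as @ bs) \<in> ?A" unfolding atom_lists_def by auto
    moreover have "?f (length as, as @ bs) = ts" using * by simp
    ultimately show "ts \<in> ?f ` ?A" by (metis (no_types, lifting) imageI)
  qed
  then have "card (atom_lists k V) \<le> card ?A"
    using fin by (intro surj_card_le) auto
  also have "\<dots> = (k + 1) * card {us. set us \<subseteq> (Par ` V :: 'a tm set) \<and> length us = k}"
    by (simp add: card_cartesian_product)
  also have "card {us. set us \<subseteq> (Par ` V :: 'a tm set) \<and> length us = k} = card (Par ` V :: 'a tm set) ^ k"
    using assms by (intro card_lists_length_eq) auto
  also have "card (Par ` V :: 'a tm set) = card V" by (intro card_image inj_onI) auto
  finally show ?thesis .
qed

section \<open>Patterns of a point over a labelled set\<close>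

context homogeneous_structure
begin

definition atoms :: "'b set \<Rightarrow> ('r \<times> 'b tm list) set" where
  "atoms V = dom L \<times> atom_lists k V"

text \<open>Patterns are written with labels from \<open>V\<close> and not with elements of
  \<open>M\<close>, so that patterns over different copies of the same labelled set can be
  compared.\<close>

definition type_pattern :: "('b \<Rightarrow> 'a) \<Rightarrow> 'b set \<Rightarrow> ('r, 'a) fm set \<Rightarrow> ('r \<times> 'b tm list) set" where
  "type_pattern f V p = {(R, ts) \<in> atoms V. Rel R (map (map_tm f) ts) \<in> p}"

definition pattern :: "('b \<Rightarrow> 'a) \<Rightarrow> 'b set \<Rightarrow> 'a \<Rightarrow> ('r \<times> 'b tm list) set" where
  "pattern f V c = {(R, ts) \<in> atoms V. satisfies M c (Rel R (map (map_tm f) ts))}"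

lemma finite_atoms: "finite V \<Longrightarrow> finite (atoms V)"
  unfolding atoms_def using finite_language finite_atom_lists by auto

text \<open>The exponent is \<open>k\<close> although relations have arity \<open>k + 1\<close>; it
  is this exponent that the number of hyperedges has to beat.\<close>

lemma card_atoms: "finite V \<Longrightarrow> card (atoms V) \<le> card (dom L) * (k + 1) * card V ^ k"
  unfolding atoms_def card_cartesian_product mult.assoc
  by (intro mult_le_mono2) (use card_atom_lists[of V k] in simp)

text \<open>The terms \<open>Var 0\<close> and \<open>Par v\<close> serve as labels of a set with
  one more point. Tuples of labels without \<open>Var 0\<close> are controlled by the pullbacks,
  those with it by the patterns, so homogeneity applies to the enlarged labelling.\<close>

lemma pattern_automorphism:
  assumes V: "finite V" and e: "inj_on e V" "e ` V \<subseteq> univ M" and f: "inj_on f V" "f ` V \<subseteq> univ M"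
    and c: "c \<in> univ M" "c \<notin> e ` V" and d: "d \<in> univ M" "d \<notin> f ` V"
    and eq: "pullback M e V = pullback M f V" and pat: "pattern e V c = pattern f V d"
  obtains g where "automorphism M g" "\<And>v. v \<in> V \<Longrightarrow> g (e v) = f v" "g c = d"
proof -
  define e' f' where "e' t = tm_val (\<lambda>_. c) (map_tm e t)" and "f' t = tm_val (\<lambda>_. d) (map_tm f t)" for t
  let ?W = "insert (Var 0) (Par ` V)"
  have simps: "e' (Var i) = c" "e' (Par v) = e v" "f' (Var i) = d" "f' (Par v) = f v" for i v
    by (auto simp: e'_def f'_def)
  have e'_eq: "e' = (\<lambda>t. tm_val (\<lambda>_. c) (map_tm e t))" "f' = (\<lambda>t. tm_val (\<lambda>_. d) (map_tm f t))"
    by (auto simp: e'_def f'_def)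
  have inj: "inj_on e' ?W" "inj_on f' ?W"
    using e(1) f(1) c d by (auto simp: inj_on_def simps image_iff)
  have eqW: "pullback M e' ?W = pullback M f' ?W"
    unfolding pullback_eq_iff
  proof (intro allI impI)
    fix R ts assume ts: "set ts \<subseteq> ?W"
    show "map e' ts \<in> interp M R \<longleftrightarrow> map f' ts \<in> interp M R"
    proof (cases "Var 0 \<in> set ts")
      case False
      then have "set ts \<subseteq> Par ` V" using ts by blast
      then have "ts \<in> lists (Par ` V)" by auto
      then obtain us where us: "set us \<subseteq> V" "ts = map Par us"
        unfolding lists_image by (auto simp: lists_eq_set)
      then have us': "map e' ts = map e us" "map f' ts = map f us" by (simp_all add: simps)
      show ?thesis using eq[unfolded pullback_eq_iff, rule_format, OF us(1)] unfolding us' .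
    next
      case True
      have atom: "(R, ts) \<in> atoms V" if "map h ts \<in> interp M R" for h
        using interpD[OF that] True ts by (auto simp: atoms_def atom_lists_def distinct_map)
      have "map e' ts \<in> interp M R \<longleftrightarrow> (R, ts) \<in> pattern e V c"
        using atom[of e'] by (auto simp: pattern_def e'_eq comp_def)
      moreover have "map f' ts \<in> interp M R \<longleftrightarrow> (R, ts) \<in> pattern f V d"
        using atom[of f'] by (auto simp: pattern_def e'_eq comp_def)
      ultimately show ?thesis using pat by simp
    qed
  qed
  have W: "finite ?W" "e' ` ?W \<subseteq> univ M" "f' ` ?W \<subseteq> univ M"
    using V c d e f by (auto simp: simps)
  obtain g where g: "automorphism M g" "\<And>t. t \<in> ?W \<Longrightarrow> g (e' t) = f' t"
    using extend_partial_isomorphism[OF W(1) inj(1) W(2) inj(2) W(3) eqW] by metis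
  show ?thesis
  proof (rule that[OF g(1)])
    show "v \<in> V \<Longrightarrow> g (e v) = f v" for v using g(2)[of "Par v"] by (simp add: simps)
    show "g c = d" using g(2)[of "Var 0"] by (simp add: simps)
  qed
qed

lemma pattern_image:
  assumes g: "automorphism M g" and e: "e ` V \<subseteq> univ M" and c: "c \<in> univ M"
    and f: "\<And>v. v \<in> V \<Longrightarrow> g (e v) = f v"
  shows "pattern f V (g c) = pattern e V c"
proof -
  have "map (\<lambda>t. tm_val (\<lambda>_. g c) (map_tm f t)) ts \<in> interp M R \<longleftrightarrow>
        map (\<lambda>t. tm_val (\<lambda>_. c) (map_tm e t)) ts \<in> interp M R" (is "?l \<longleftrightarrow> ?r")
    if "ts \<in> atom_lists k V" for R ts
  proof -
    have ts: "set ts \<subseteq> insert (Var 0) (Par ` V)" using that by (auto simp: atom_lists_def)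
    let ?us = "map (\<lambda>t. tm_val (\<lambda>_. c) (map_tm e t)) ts"
    have "tm_val (\<lambda>_. c) (map_tm e t) \<in> univ M" if "t \<in> set ts" for t
      using ts e c that by (cases t) auto
    then have "set ?us \<subseteq> univ M" by auto
    then have r: "?r \<longleftrightarrow> map g ?us \<in> interp M R" by (rule automorphismD(3)[OF g])
    have us: "map g ?us = map (\<lambda>t. tm_val (\<lambda>_. g c) (map_tm f t)) ts"
      using ts f by (auto simp: subset_iff)
    show ?thesis unfolding r us ..
  qed
  then show ?thesis unfolding pattern_def by (auto simp: atoms_def comp_def)
qed

text \<open>Every atom mentions \<open>x\<close>, and \<open>x\<close> is none of the parameters, so
  equality atoms are decided by their shape; relational atoms are recorded in the pattern.\<close>

lemma type_pattern_holds:
  fixes f :: "'b \<Rightarrow> 'a" and h :: "'c \<Rightarrow> 'b"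
  assumes p: "p \<in> type_space L M" and f: "f ` V \<subseteq> univ M"
    and x: "\<And>v. v \<in> V \<Longrightarrow> Eq (Var 0) (Par (f v)) \<notin> p"
  shows "\<phi> \<in> formulas L {0} C \<Longrightarrow> atoms_mention_x \<phi> \<Longrightarrow> h ` C \<subseteq> V \<Longrightarrow>
    pattern_holds (type_pattern f V p) h \<phi> \<longleftrightarrow> map_fm id (\<lambda>c. f (h c)) \<phi> \<in> p"
proof (induction \<phi>)
  case (Rel R ts)
  let ?us = "map (map_tm h) ts"
  have us: "map (map_tm f) ?us = map (map_tm (\<lambda>c. f (h c))) ts" by (simp add: tm.map_comp comp_def)
  have "tm_vars t \<subseteq> {0}" "set_tm t \<subseteq> C" if "t \<in> set ts" for t
    using Rel.prems(1) that by (auto simp: formulas_def)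
  then have "map_tm h t \<in> insert (Var 0) (Par ` V)" if "t \<in> set ts" for t
    using that Rel.prems(3) by (cases t) (force, fastforce)
  then have set_us: "set ?us \<subseteq> insert (Var 0) (Par ` V)" by auto
  have R: "L R = Some (length ts)" using Rel.prems(1) by (simp add: formulas_def)
  have x0: "Var 0 \<in> set ?us" using Rel.prems(2) by force
  \<comment> \<open>Patterns omit atoms with repeated entries. Nothing is lost: relations are
    injective, so such an atom lies in no type.\<close>
  have dist: "distinct ?us" if mem: "Rel R (map (map_tm f) ?us) \<in> p"
  proof -
    obtain a where "satisfies M a (Rel R (map (map_tm f) ?us))"
      using type_spaceD(2)[OF p, of "{Rel R (map (map_tm f) ?us)}"] mem by blast
    then have "distinct (map (tm_val (\<lambda>_. a)) (map (map_tm f) ?us))"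
      using interpD(4) unfolding satisfies_simps by blast
    then show ?thesis by (metis distinct_map)
  qed
  have "length ?us = k + 1" using arity[OF R] by simp
  then have "(R, ?us) \<in> atoms V \<longleftrightarrow> distinct ?us"
    using R x0 set_us by (auto simp: atoms_def atom_lists_def)
  then have "pattern_holds (type_pattern f V p) h (Rel R ts) \<longleftrightarrow> Rel R (map (map_tm f) ?us) \<in> p"
    using dist by (auto simp: type_pattern_def)
  then show ?case unfolding us by simp
next
  case (Eq s t)
  have st: "tm_vars s \<subseteq> {0}" "set_tm s \<subseteq> C" "tm_vars t \<subseteq> {0}" "set_tm t \<subseteq> C"
    using Eq.prems(1) by (auto simp: formulas_def)
  have refl: "Eq (Var 0) (Var 0) \<in> p"
    by (rule type_consequence[OF p, of "{}"]) (auto simp: formulas_def)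
  have sym: "Eq (Par a) (Var 0) \<notin> p" if "Eq (Var 0) (Par a) \<notin> p" "a \<in> univ M" for a
  proof
    assume "Eq (Par a) (Var 0) \<in> p"
    then have "Eq (Var 0) (Par a) \<in> p"
      using that(2) by (intro type_consequence[OF p, of "{Eq (Par a) (Var 0)}"]) (auto simp: formulas_def)
    then show False using that(1) by contradiction
  qed
  show ?case using st Eq.prems(2,3) x sym refl f by (cases s; cases t) (auto simp: image_subset_iff)
next
  case (Neg \<phi>)
  have "map_fm id (\<lambda>c. f (h c)) \<phi> \<in> x_formulas L (univ M)"
    using Neg.prems f by (intro map_fm_in_formulas[of _ _ _ C]) auto
  then show ?case using Neg type_Neg[OF p] by (simp add: id_def)
next
  case (Conj \<phi> \<psi>)
  have "map_fm id (\<lambda>c. f (h c)) \<phi> \<in> x_formulas L (univ M)" "map_fm id (\<lambda>c. f (h c)) \<psi> \<in> x_formulas L (univ M)"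
    using Conj.prems f by (auto intro!: map_fm_in_formulas[of _ _ _ C])
  then show ?case using Conj type_Conj[OF p] by (simp add: id_def)
qed auto

end

lemma atoms_mention_x_map: "atoms_mention_x (map_fm id h \<phi>) = atoms_mention_x \<phi>"
proof (induction \<phi>)
  case (Rel R ts)
  have "Var 0 = map_tm h t \<longleftrightarrow> t = Var 0" for t by (cases t) auto
  then show ?case by (simp add: image_iff)
next
  case (Eq s t)
  have "map_tm h t = Var 0 \<longleftrightarrow> t = Var 0" for t by (cases t) auto
  then show ?case by simp
qed auto

section \<open>Invariant measures and the hypergraph argument\<close>

context homogeneous_structure
begin

text \<open>By homogeneity, parameters with the same labelled isomorphism type lie in one orbit, and
  the measure is constant on orbits.\<close>

lemma measure_pullback_cong:
  assumes \<mu>: "invariant_keisler_measure L M \<mu>"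
    and V: "finite V" and e: "inj_on e V" "e ` V \<subseteq> univ M" and f: "inj_on f V" "f ` V \<subseteq> univ M"
    and eq: "pullback M e V = pullback M f V" and \<phi>: "\<phi> \<in> x_formulas L V"
  shows "measure \<mu> (types_containing L M (map_fm id e \<phi>)) = measure \<mu> (types_containing L M (map_fm id f \<phi>))"
proof -
  obtain g where g: "automorphism M g" "\<And>v. v \<in> V \<Longrightarrow> g (e v) = f v"
    using extend_partial_isomorphism[OF V e f eq] by metis
  have "map_fm id g (map_fm id e \<phi>) = map_fm id f \<phi>"
    unfolding map_fm_compose using \<phi> g(2) by (intro map_fm_cong_params) (auto simp: formulas_def)
  moreover have "map_fm id e \<phi> \<in> x_formulas L (univ M)" using \<phi> e(2) by (rule map_fm_in_formulas)
  ultimately show ?thesis using measure_automorphism[OF \<mu> g(1), of "map_fm id e \<phi>"] by simp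
qed

text \<open>A relation needs \<open>k + 1\<close> distinct entries, so at most \<open>k\<close>
  labels carry no relation under any labelling.\<close>

lemma pullback_small:
  assumes "finite V" "card V \<le> k"
  shows "pullback M e V = pullback M f V"
proof -
  have no: "map h t \<notin> interp M R" if t: "set t \<subseteq> V" for h t R
  proof
    assume *: "map h t \<in> interp M R"
    have "card (set t) \<le> k" using card_mono[OF assms(1) t] assms(2) by simp
    moreover have "length t = card (set t)"
      using interpD(4)[OF *] distinct_card[of t] by (simp add: distinct_map)
    ultimately show False using interpD(2)[OF *] by simp
  qed
  show ?thesis
    unfolding pullback_eq_iff
  proof (intro allI impI)
    fix R t assume "set t \<subseteq> V"
    from no[OF this] show "map e t \<in> interp M R \<longleftrightarrow> map f t \<in> interp M R" by metis
  qed
qed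

text \<open>A single label carries no relation, since \<open>k \<ge> 1\<close>.\<close>

lemma point_transitive:
  assumes "a \<in> univ M" "b \<in> univ M"
  obtains g where "automorphism M g" "g a = b"
  using extend_partial_isomorphism[of "{0 :: nat}" "\<lambda>_. a" "\<lambda>_. b"] assms k_pos
  by (auto simp: pullback_small)

text \<open>The sets for different parameters are disjoint and, by transitivity on points, of equal
  measure; infinitely many of them fit into total mass one only if this measure vanishes.\<close>

lemma measure_equals_parameter:
  assumes inf: "infinite (univ M)" and \<mu>: "invariant_keisler_measure L M \<mu>" and a: "a \<in> univ M"
  shows "types_containing L M (Eq (Var 0) (Par a)) \<in> null_sets \<mu>"
proof -
  have K: "keisler_measure L M \<mu>" using \<mu> by (simp add: invariant_keisler_measure_def)
  interpret prob_space \<mu> by (rule keisler_measureD(1)[OF K])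
  let ?U = "\<lambda>b. types_containing L M (Eq (Var 0) (Par b))"
  have form: "Eq (Var 0) (Par b) \<in> x_formulas L (univ M)" if "b \<in> univ M" for b
    using that by (auto simp: formulas_def)
  have U: "?U b \<in> sets \<mu>" if "b \<in> univ M" for b
    using keisler_measureD(3)[OF K form[OF that]] .
  have same: "measure \<mu> (?U b) = measure \<mu> (?U a)" if b: "b \<in> univ M" for b
  proof -
    obtain g where "automorphism M g" "g a = b" using point_transitive[OF a b] by metis
    then show ?thesis using measure_automorphism[OF \<mu> _ form[OF a], of g] by simp
  qed
  have "measure \<mu> (?U a) = 0"
  proof (rule ccontr)
    assume "measure \<mu> (?U a) \<noteq> 0"
    then have pos: "measure \<mu> (?U a) > 0" by (simp add: zero_less_measure_iff)
    then obtain m :: nat where m: "1 < real m * measure \<mu> (?U a)"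
      using reals_Archimedean3 by blast
    obtain F where F: "finite F" "card F = m" "F \<subseteq> univ M"
      using infinite_arbitrarily_large[OF inf] by blast
    have "disjoint_family_on ?U F"
      unfolding disjoint_family_on_def
    proof (intro ballI impI)
      fix b c assume bc: "b \<in> F" "c \<in> F" "b \<noteq> c"
      have "p \<notin> ?U b \<inter> ?U c" for p
      proof
        assume "p \<in> ?U b \<inter> ?U c"
        then have p: "p \<in> type_space L M" "{Eq (Var 0) (Par b), Eq (Var 0) (Par c)} \<subseteq> p"
          by (auto simp: types_containing_def)
        from type_spaceD(2)[OF p(1) _ p(2)] show False using bc by auto
      qed
      then show "?U b \<inter> ?U c = {}" by blast
    qed
    then have "measure \<mu> (\<Union>b\<in>F. ?U b) = (\<Sum>b\<in>F. measure \<mu> (?U b))"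
      using F U by (intro finite_measure_finite_Union) auto
    also have "\<dots> = (\<Sum>b\<in>F. measure \<mu> (?U a))" using F same by (intro sum.cong) auto
    also have "\<dots> = real m * measure \<mu> (?U a)" using F by simp
    finally show False using m prob_le_1[of "\<Union>b\<in>F. ?U b"] by simp
  qed
  then show ?thesis using U[OF a] by (auto simp: null_sets_def emeasure_eq_measure)
qed

text \<open>The tuples enter asymmetrically, \<open>a\<close> on the chosen hyperedges and
  \<open>b\<close> on the others, which yields one inequality; equality comes from exchanging
  them.\<close>

lemma measure_le_of_overlap_closed:
  assumes inf: "infinite (univ M)" and oc: "overlap_closed k L (age L M)"
    and \<mu>: "invariant_keisler_measure L M \<mu>" and r: "r > k"
    and a: "inj_on a {1..r}" "a ` {1..r} \<subseteq> univ M" and b: "inj_on b {1..r}" "b ` {1..r} \<subseteq> univ M"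
    and \<phi>: "\<phi> \<in> x_formulas L {1..r}" "atoms_mention_x \<phi>"
  shows "measure \<mu> (types_containing L M (map_fm id a \<phi>)) \<le> measure \<mu> (types_containing L M (map_fm id b \<phi>))"
proof (rule ccontr)
  have K: "keisler_measure L M \<mu>" using \<mu> by (simp add: invariant_keisler_measure_def)
  interpret prob_space \<mu> by (rule keisler_measureD(1)[OF K])
  define p\<^sub>1 p\<^sub>2 where "p\<^sub>1 = measure \<mu> (types_containing L M (map_fm id a \<phi>))"
    and "p\<^sub>2 = measure \<mu> (types_containing L M (map_fm id b \<phi>))"
  assume "\<not> measure \<mu> (types_containing L M (map_fm id a \<phi>)) \<le> measure \<mu> (types_containing L M (map_fm id b \<phi>))"
  then have "p\<^sub>2 < p\<^sub>1" "0 \<le> p\<^sub>2" "p\<^sub>1 \<le> 1" by (auto simp: p\<^sub>1_def p\<^sub>2_def)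
  then obtain l where l: "l \<ge> 0" "exp l + exp (- l) < exp (l * p\<^sub>1) + exp (- (l * p\<^sub>2))"
    by (rule exponential_gap)
  \<comment> \<open>The gain per hyperedge. With it, the bound from
    \<open>random_colouring_bound\<close> reads: \<open>\<rho>\<close> to the number of hyperedges
    is at most the number of patterns.\<close>
  define \<rho> where "\<rho> = (exp (l * p\<^sub>1) + exp (- (l * p\<^sub>2))) / (exp l + exp (- l))"
  have pos: "exp l + exp (- l) > 0" by (intro add_pos_pos) auto
  have \<rho>: "\<rho> > 1" using l(2) pos by (simp add: \<rho>_def)
  define H where "H c = pullback M c {1..r}" for c
  have H: "H c \<in> members_on (age L M) r" if "inj_on c {1..r}" "c ` {1..r} \<subseteq> univ M" for c
    using pullback_in_age[OF struct _ that] by (simp add: H_def members_on_def)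
  from oc[unfolded overlap_closed_def, THEN conjunct2, rule_format, OF r]
  obtain C \<alpha> where C: "C > 0" "\<alpha> > 0" and large: "\<forall>n\<^sub>0. \<exists>n \<ge> n\<^sub>0. \<exists>(V :: nat set) (E :: nat set set).
        finite V \<and> card V = n \<and>
        (\<forall>e \<in> E. e \<subseteq> V \<and> card e = r) \<and>
        real (card E) \<ge> C * real n powr (real k + \<alpha>) \<and>
        (\<forall>e \<in> E. \<forall>e' \<in> E. e \<noteq> e' \<longrightarrow> card (e \<inter> e') \<le> k) \<and>
        (\<forall>H\<^sub>1 \<in> members_on (age L M) r. \<forall>H\<^sub>2 \<in> members_on (age L M) r. \<forall>G\<^sub>0. pasted L V E H\<^sub>1 H\<^sub>2 G\<^sub>0 \<longrightarrow>
           (\<exists>G \<in> age L M. card (univ G) = n \<and>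
              (\<exists>f. injective_hom f G\<^sub>0 G \<and> (\<forall>e \<in> E. embedding f (induced G\<^sub>0 e) G))))"
    by (elim exE conjE) (rule that)
  define D where "D = card (dom L) * (k + 1)"
  obtain n\<^sub>0 where n\<^sub>0: "\<And>n m. n \<ge> n\<^sub>0 \<Longrightarrow> real m \<ge> C * real n powr (real k + \<alpha>) \<Longrightarrow> \<rho> ^ m > 2 ^ (D * n ^ k)"
    using superpolynomial_growth[OF \<rho> C] by metis
  from large[rule_format, of n\<^sub>0] obtain n and V :: "nat set" and E :: "nat set set"
    where n: "n \<ge> n\<^sub>0" and V: "finite V" "card V = n"
      and E': "\<forall>e \<in> E. e \<subseteq> V \<and> card e = r"
      and card_E: "real (card E) \<ge> C * real n powr (real k + \<alpha>)"
      and overlap': "\<forall>e \<in> E. \<forall>e' \<in> E. e \<noteq> e' \<longrightarrow> card (e \<inter> e') \<le> k"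
      and extend': "\<forall>H\<^sub>1 \<in> members_on (age L M) r. \<forall>H\<^sub>2 \<in> members_on (age L M) r. \<forall>G\<^sub>0.
           pasted L V E H\<^sub>1 H\<^sub>2 G\<^sub>0 \<longrightarrow> (\<exists>G \<in> age L M. card (univ G) = n \<and>
              (\<exists>f. injective_hom f G\<^sub>0 G \<and> (\<forall>e \<in> E. embedding f (induced G\<^sub>0 e) G)))"
    by (elim exE conjE) (rule that)
  note E = E'[rule_format] and overlap = overlap'[rule_format]
    and extend = extend'[rule_format, OF H[OF a] H[OF b]]
  have fin_E: "finite E" using E V(1) by (intro finite_subset[of E "Pow V"]) auto
  have fin_e: "finite e" if "e \<in> E" for e using E[OF that] V(1) finite_subset by blast
  \<comment> \<open>Each hyperedge gets a labelling by \<open>{1..r}\<close>, fixed before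
    \<open>T\<close> is chosen, so that the event \<open>Y Q e\<close> does not depend on
    \<open>T\<close>.\<close>
  have "\<exists>h. bij_betw h {1..r} e" if "e \<in> E" for e
    using ex_bij_betw_nat_finite_1[OF fin_e[OF that]] E[OF that] by auto
  then obtain \<Lambda> where \<Lambda>: "\<And>e. e \<in> E \<Longrightarrow> bij_betw (\<Lambda> e) {1..r} e" by metis
  then have \<Lambda>_inj: "inj_on (\<Lambda> e) {1..r}" and \<Lambda>_img: "\<Lambda> e ` {1..r} = e" if "e \<in> E" for e
    using that by (auto simp: bij_betw_def)
  define Y where "Y Q e = pattern_holds Q (\<Lambda> e) \<phi>" for Q :: "('r \<times> nat tm list) set" and e
  have "\<exists>Q \<in> Pow (atoms V). real (card T) * p\<^sub>1 - real (card (E - T)) * p\<^sub>2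
      \<le> real (card {e \<in> T. Y Q e}) - real (card {e \<in> E - T. Y Q e})" if T: "T \<subseteq> E" for T
  proof -
    define c where "c e = (if e \<in> T then a else b)" for e
    have c: "inj_on (c e) {1..r}" "c e ` {1..r} \<subseteq> univ M" for e using a b by (auto simp: c_def)
    define G\<^sub>0 :: "('r, nat) rstruct" where
      "G\<^sub>0 = \<lparr>univ = V, interp = (\<lambda>R. \<Union>e\<in>E. map (\<Lambda> e) ` interp (H (c e)) R)\<rparr>"
    have HD: "set t \<subseteq> {1..r}" "map (c e) t \<in> interp M R" "length t = k + 1" "distinct t" "L R = Some (k + 1)"
      if "t \<in> interp (H (c e)) R" for t e R
    proof -
      show "set t \<subseteq> {1..r}" and 1: "map (c e) t \<in> interp M R" using that by (auto simp: H_def)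
      show "length t = k + 1" "distinct t" "L R = Some (k + 1)"
        using interpD[OF 1] by (auto simp: distinct_map)
    qed
    \<comment> \<open>A related tuple has \<open>k + 1\<close> distinct entries while two hyperedges
      share at most \<open>k\<close> vertices, so each tuple belongs to a single hyperedge and the
      copies do not interfere.\<close>
    have on_edge: "map (\<Lambda> e) t \<in> interp G\<^sub>0 R \<longleftrightarrow> t \<in> interp (H (c e)) R"
      if e: "e \<in> E" and t: "set t \<subseteq> {1..r}" for e t R
    proof
      assume "t \<in> interp (H (c e)) R"
      then show "map (\<Lambda> e) t \<in> interp G\<^sub>0 R" using e by (auto simp: G\<^sub>0_def)
    next
      assume "map (\<Lambda> e) t \<in> interp G\<^sub>0 R"
      then obtain e' t' where e': "e' \<in> E" "t' \<in> interp (H (c e')) R" "map (\<Lambda> e) t = map (\<Lambda> e') t'"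
        by (auto simp: G\<^sub>0_def)
      note t' = HD[OF e'(2)]
      have dist: "distinct (map (\<Lambda> e') t')"
        using t'(1,4) \<Lambda>_inj[OF e'(1)] by (auto simp: distinct_map intro: inj_on_subset)
      have "set (map (\<Lambda> e') t') \<subseteq> e'" using t'(1) \<Lambda>_img[OF e'(1)] by auto
      moreover have "set (map (\<Lambda> e) t) \<subseteq> e" using t \<Lambda>_img[OF e] by auto
      ultimately have "set (map (\<Lambda> e') t') \<subseteq> e \<inter> e'" unfolding e'(3) by blast
      then have "card (set (map (\<Lambda> e') t')) \<le> card (e \<inter> e')"
        using fin_e[OF e] by (intro card_mono) auto
      then have "k + 1 \<le> card (e \<inter> e')" using distinct_card[OF dist] t'(3) by simp
      then have "e = e'" using overlap[OF e e'(1)] by force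
      then have "t = t'" using e'(3) t t'(1) \<Lambda>_inj[OF e] map_inj_on[of "\<Lambda> e" t t']
        by (metis Un_subset_iff inj_on_subset)
      then show "t \<in> interp (H (c e)) R" using e'(2) \<open>e = e'\<close> by simp
    qed
    have "pasted L V E (H a) (H b) G\<^sub>0"
      unfolding pasted_def
    proof (intro conjI ballI allI)
      show "is_structure L G\<^sub>0"
        unfolding is_structure_def
      proof (intro allI ballI)
        fix R u assume "u \<in> interp G\<^sub>0 R"
        then obtain e t where e: "e \<in> E" "t \<in> interp (H (c e)) R" "u = map (\<Lambda> e) t" by (auto simp: G\<^sub>0_def)
        note t = HD[OF e(2)]
        have "set u \<subseteq> e" using t(1) \<Lambda>_img[OF e(1)] e(3) by auto
        moreover have "distinct u"
          unfolding e(3) using t(1,4) \<Lambda>_inj[OF e(1)] by (auto simp: distinct_map intro: inj_on_subset)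
        ultimately show "L R = Some (length u) \<and> set u \<subseteq> univ G\<^sub>0 \<and> distinct u"
          using E[OF e(1)] t(3,5) e(3) by (auto simp: G\<^sub>0_def)
      qed
      show "univ G\<^sub>0 = V" by (simp add: G\<^sub>0_def)
      show "\<exists>e\<in>E. set u \<subseteq> e" if "u \<in> interp G\<^sub>0 R" for R u
      proof -
        from that obtain e t where e: "e \<in> E" "t \<in> interp (H (c e)) R" "u = map (\<Lambda> e) t" by (auto simp: G\<^sub>0_def)
        then have "set u \<subseteq> e" using HD(1)[OF e(2)] \<Lambda>_img[OF e(1)] by auto
        then show ?thesis using e(1) by blast
      qed
      fix e assume e: "e \<in> E"
      let ?i = "inv_into {1..r} (\<Lambda> e)"
      have i: "?i v \<in> {1..r}" "\<Lambda> e (?i v) = v" if "v \<in> e" for v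
        using that \<Lambda>_img[OF e] by (metis inv_into_into, metis f_inv_into_f)
      have "isomorphism ?i (induced G\<^sub>0 e) (H (c e))"
        unfolding isomorphism_def embedding_def
      proof (intro conjI allI impI)
        have univ: "univ (induced G\<^sub>0 e) = e" using E[OF e] by (auto simp: G\<^sub>0_def)
        show "inj_on ?i (univ (induced G\<^sub>0 e))" unfolding univ by (rule inj_onI) (metis i(2))
        have "?i ` e = {1..r}"
          using bij_betw_inv_into[OF \<Lambda>[OF e]] by (simp add: bij_betw_def)
        then show "?i ` univ (induced G\<^sub>0 e) = univ (H (c e))" unfolding univ by (simp add: H_def)
        then show "?i ` univ (induced G\<^sub>0 e) \<subseteq> univ (H (c e))" by simp
        fix R t assume "set t \<subseteq> univ (induced G\<^sub>0 e)"
        then have t: "set t \<subseteq> e" unfolding univ .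
        have "map (\<Lambda> e) (map ?i t) = t" unfolding map_map by (rule map_idI) (use t i in auto)
        moreover have "set (map ?i t) \<subseteq> {1..r}" using t i by auto
        ultimately have "t \<in> interp G\<^sub>0 R \<longleftrightarrow> map ?i t \<in> interp (H (c e)) R"
          using on_edge[OF e] by metis
        then show "t \<in> interp (induced G\<^sub>0 e) R \<longleftrightarrow> map ?i t \<in> interp (H (c e)) R" using t by simp
      qed
      then show "isomorphic (induced G\<^sub>0 e) (H a) \<or> isomorphic (induced G\<^sub>0 e) (H b)"
        unfolding isomorphic_def c_def by (cases "e \<in> T") auto
    qed
    from extend[OF this] obtain G f where G: "G \<in> age L M"
      and f: "injective_hom f G\<^sub>0 G" "\<And>e. e \<in> E \<Longrightarrow> embedding f (induced G\<^sub>0 e) G" by blast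
    obtain g where g: "inj_on g (univ G)" "g ` univ G \<subseteq> univ M" "G = pullback M g (univ G)"
      using G unfolding age_iff[OF struct] by blast
    have fV: "inj_on f V" "f ` V \<subseteq> univ G"
      using f(1) by (auto simp: injective_hom_def G\<^sub>0_def)
    \<comment> \<open>\<open>F\<close> places the vertices in \<open>M\<close> so that every
      hyperedge becomes a copy of the structure chosen for it; outside the hyperedges nothing is
      known and nothing is used.\<close>
    define F where "F v = g (f v)" for v
    have F: "inj_on F V" "F ` V \<subseteq> univ M"
    proof -
      show "inj_on F V"
        using comp_inj_on[OF fV(1) inj_on_subset[OF g(1) fV(2)]] by (simp add: F_def[abs_def] comp_def)
      show "F ` V \<subseteq> univ M" using fV g by (auto simp: F_def)
    qed
    define U where "U e = types_containing L M (map_fm id (\<lambda>i. F (\<Lambda> e i)) \<phi>)" for e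
    have \<Lambda>V: "\<Lambda> e ` {1..r} \<subseteq> V" if "e \<in> E" for e using \<Lambda>_img[OF that] E[OF that] by simp
    have FE: "(\<lambda>i. F (\<Lambda> e i)) ` {1..r} \<subseteq> univ M" if "e \<in> E" for e using \<Lambda>V[OF that] F(2) by blast
    have U: "measure \<mu> (U e) = (if e \<in> T then p\<^sub>1 else p\<^sub>2)" if e: "e \<in> E" for e
    proof -
      have "pullback M (\<lambda>i. F (\<Lambda> e i)) {1..r} = pullback M (c e) {1..r}"
        unfolding pullback_eq_iff
      proof (intro allI impI)
        fix R t assume t: "set t \<subseteq> {1..r}"
        let ?u = "map (\<Lambda> e) t"
        have ue: "set ?u \<subseteq> e" using t \<Lambda>_img[OF e] by auto
        have fu: "set (map f ?u) \<subseteq> univ G" using ue E[OF e] fV(2) by auto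
        have "map (\<lambda>i. F (\<Lambda> e i)) t = map g (map f ?u)" by (simp add: F_def)
        also have "map g (map f ?u) \<in> interp M R \<longleftrightarrow> map f ?u \<in> interp (pullback M g (univ G)) R"
          using fu by simp
        also have "\<dots> \<longleftrightarrow> map f ?u \<in> interp G R" using g(3) by simp
        also have "\<dots> \<longleftrightarrow> ?u \<in> interp (induced G\<^sub>0 e) R"
        proof -
          have "set ?u \<subseteq> univ (induced G\<^sub>0 e)" using ue E[OF e] by (auto simp: G\<^sub>0_def)
          then show ?thesis using f(2)[OF e] unfolding embedding_def by blast
        qed
        also have "\<dots> \<longleftrightarrow> ?u \<in> interp G\<^sub>0 R" using ue by simp
        also have "\<dots> \<longleftrightarrow> t \<in> interp (H (c e)) R" by (rule on_edge[OF e t])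
        also have "\<dots> \<longleftrightarrow> map (c e) t \<in> interp M R" using t by (simp add: H_def)
        finally show "map (\<lambda>i. F (\<Lambda> e i)) t \<in> interp M R \<longleftrightarrow> map (c e) t \<in> interp M R" .
      qed
      moreover have "inj_on (\<lambda>i. F (\<Lambda> e i)) {1..r}"
        using comp_inj_on[OF \<Lambda>_inj[OF e] inj_on_subset[OF F(1) \<Lambda>V[OF e]]] by (simp add: comp_def)
      ultimately have "measure \<mu> (U e) = measure \<mu> (types_containing L M (map_fm id (c e) \<phi>))"
        unfolding U_def using FE[OF e] c \<phi>(1) by (intro measure_pullback_cong[OF \<mu>, of "{1..r}"]) auto
      then show ?thesis by (simp add: c_def p\<^sub>1_def p\<^sub>2_def)
    qed
    \<comment> \<open>Types of the vertices themselves form a null set. They are avoided because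
      \<open>pattern_holds\<close> evaluates equality correctly only away from the
      parameters.\<close>
    let ?N = "\<Union>v\<in>V. types_containing L M (Eq (Var 0) (Par (F v)))"
    have N: "?N \<in> null_sets \<mu>"
      using V(1) F(2) by (intro null_sets_UN' measure_equals_parameter[OF inf \<mu>]) (auto intro: countable_finite)
    have Usets: "U e \<in> sets \<mu>" if "e \<in> E" for e
      unfolding U_def using FE[OF that] \<phi>(1) by (intro keisler_measureD(3)[OF K] map_fm_in_formulas)
    from exists_ge_expected_difference[where U = U, OF prob_space_axioms fin_E T Usets N]
    obtain p where p: "p \<in> space \<mu> - ?N"
      and ge: "(\<Sum>e\<in>T. measure \<mu> (U e)) - (\<Sum>e\<in>E - T. measure \<mu> (U e))
      \<le> real (card {e \<in> T. p \<in> U e}) - real (card {e \<in> E - T. p \<in> U e})" by blast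
    have pS: "p \<in> type_space L M" using p keisler_measureD(2)[OF K] by simp
    have x: "Eq (Var 0) (Par (F v)) \<notin> p" if "v \<in> V" for v
      using p that pS by (auto simp: types_containing_def)
    define Q where "Q = type_pattern F V p"
    have Y: "Y Q e \<longleftrightarrow> p \<in> U e" if "e \<in> E" for e
      using type_pattern_holds[OF pS F(2) x \<phi> \<Lambda>V[OF that]] pS
      by (simp add: Y_def Q_def U_def types_containing_def)
    have "(\<Sum>e\<in>T. measure \<mu> (U e)) = (\<Sum>e\<in>T. p\<^sub>1)" using U T by (intro sum.cong) auto
    moreover have "(\<Sum>e\<in>E - T. measure \<mu> (U e)) = (\<Sum>e\<in>E - T. p\<^sub>2)" using U by (intro sum.cong) auto
    moreover have "{e \<in> T. p \<in> U e} = {e \<in> T. Y Q e}" "{e \<in> E - T. p \<in> U e} = {e \<in> E - T. Y Q e}"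
      using Y T by auto
    moreover have "Q \<in> Pow (atoms V)" by (auto simp: Q_def type_pattern_def)
    ultimately show ?thesis using ge by (intro bexI[of _ Q]) simp_all
  qed
  then have "(exp (l * p\<^sub>1) + exp (- (l * p\<^sub>2))) ^ card E \<le>
      real (card (Pow (atoms V))) * (exp l + exp (- l)) ^ card E"
    using finite_atoms[OF V(1)] by (intro random_colouring_bound[OF fin_E _ l(1), where Y = Y]) auto
  then have "\<rho> ^ card E \<le> real (card (Pow (atoms V)))"
    unfolding \<rho>_def power_divide using pos by (simp add: divide_le_eq)
  also have "\<dots> = 2 ^ card (atoms V)" using finite_atoms[OF V(1)] by (simp add: card_Pow)
  also have "\<dots> \<le> 2 ^ (D * n ^ k)"
    using card_atoms[OF V(1)] V(2) by (intro power_increasing) (auto simp: D_def)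
  finally show False using n\<^sub>0[OF n card_E] by simp
qed

lemma exchangeable_of_overlap_closed:
  assumes inf: "infinite (univ M)" and oc: "overlap_closed k L (age L M)"
    and \<mu>: "invariant_keisler_measure L M \<mu>"
  shows "exchangeable L M \<mu>"
  unfolding exchangeable_def
proof (intro allI impI ballI)
  fix n a b \<phi>
  assume len: "length a = n" "length b = n" and dist: "distinct a" "distinct b"
    and sub: "set a \<subseteq> univ M" "set b \<subseteq> univ M"
    and \<phi>: "\<phi> \<in> x_formulas L {..<n}" "atoms_mention_x \<phi>"
  \<comment> \<open>Tuples are indexed from \<open>0\<close>, while the structures in
    \<open>members_on\<close> live on \<open>{1..r}\<close>.\<close>
  define shift where "shift c i = c ! (i - 1)" for c :: "'a list" and i
  have inj: "inj_on (shift c) {1..n}" "shift c ` {1..n} \<subseteq> univ M"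
    if c: "length c = n" "distinct c" "set c \<subseteq> univ M" for c
  proof -
    show "inj_on (shift c) {1..n}"
    proof (rule inj_onI)
      fix i j assume "i \<in> {1..n}" "j \<in> {1..n}" "shift c i = shift c j"
      then have "i - 1 = j - 1" "i \<ge> 1" "j \<ge> 1"
        using nth_eq_iff_index_eq[OF c(2), of "i - 1" "j - 1"] c(1) by (auto simp: shift_def)
      then show "i = j" by linarith
    qed
    show "shift c ` {1..n} \<subseteq> univ M" using c by (auto simp: shift_def intro!: subsetD[OF c(3)] nth_mem)
  qed
  have inst: "inst \<phi> c = map_fm id (shift c) (map_fm id Suc \<phi>)" for c
    unfolding inst_def map_fm_compose by (simp add: shift_def)
  have Suc_\<phi>: "map_fm id Suc \<phi> \<in> x_formulas L {1..n}"
    using \<phi>(1) by (rule map_fm_in_formulas) auto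
  have mention: "atoms_mention_x (map_fm id Suc \<phi>)" using \<phi>(2) by (simp add: atoms_mention_x_map)
  note injs = inj[OF len(1) dist(1) sub(1)] inj[OF len(2) dist(2) sub(2)]
  show "measure \<mu> (types_containing L M (inst \<phi> a)) = measure \<mu> (types_containing L M (inst \<phi> b))"
  proof (cases "n > k")
    case True
    show ?thesis unfolding inst
      using measure_le_of_overlap_closed[OF inf oc \<mu> True injs Suc_\<phi> mention]
        measure_le_of_overlap_closed[OF inf oc \<mu> True injs(3,4) injs(1,2) Suc_\<phi> mention] by (rule antisym)
  next
    \<comment> \<open>Overlap closure speaks of \<open>r > k\<close> only. With at most
      \<open>k\<close> parameters there are no relations among them, and homogeneity gives the
      equality directly.\<close>
    case False
    then have "pullback M (shift a) {1..n} = pullback M (shift b) {1..n}" by (simp add: pullback_small)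
    then show ?thesis unfolding inst using injs Suc_\<phi> by (intro measure_pullback_cong[OF \<mu>]) auto
  qed
qed

end

section \<open>The type space and Keisler measures\<close>

instance tm :: (countable) countable
  by countable_datatype

instance fm :: (countable, countable) countable
  by countable_datatype

lemma fm_symbols_well_formed: "well_formed L \<phi> \<Longrightarrow> fm_symbols \<phi> \<subseteq> dom L"
  by (induction \<phi>) auto

text \<open>The types \<open>'r\<close> and \<open>'a\<close> may be uncountable. Well-formed
  formulas use only symbols from \<open>dom L\<close>, so renaming symbols and parameters by numbers
  is injective on them.\<close>

lemma countable_formulas:
  assumes L: "finite (dom L)" and C: "countable C"
  shows "countable (formulas L X C)"
proof -
  have f: "inj_on (to_nat_on (dom L)) (dom L)" and g: "inj_on (to_nat_on C) C"
    using countable_finite[OF L] C by auto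
  have "inj_on (map_fm (to_nat_on (dom L)) (to_nat_on C)) (formulas L X C)"
  proof (rule inj_onI)
    fix \<phi> \<psi> assume mem: "\<phi> \<in> formulas L X C" "\<psi> \<in> formulas L X C"
      and eq: "map_fm (to_nat_on (dom L)) (to_nat_on C) \<phi> = map_fm (to_nat_on (dom L)) (to_nat_on C) \<psi>"
    have sub: "fm_symbols \<phi> \<subseteq> dom L" "fm_symbols \<psi> \<subseteq> dom L" "params \<phi> \<subseteq> C" "params \<psi> \<subseteq> C"
      using mem fm_symbols_well_formed by (auto simp: formulas_def)
    show "\<phi> = \<psi>"
    proof (rule fm.inj_map_strong[OF _ _ eq])
      show "z = z'" if "z \<in> fm_symbols \<phi>" "z' \<in> fm_symbols \<psi>"
        "to_nat_on (dom L) z = to_nat_on (dom L) z'" for z z'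
        using that sub f unfolding inj_on_def by blast
      show "z = z'" if "z \<in> params \<phi>" "z' \<in> params \<psi>" "to_nat_on C z = to_nat_on C z'" for z z'
        using that sub g unfolding inj_on_def by blast
    qed
  qed
  then show ?thesis by (rule countableI')
qed

text \<open>A maximal finitely satisfiable set, supplied by Zorn's lemma, is complete: if it omitted
  both \<open>\<phi>\<close> and \<open>Neg \<phi>\<close>, finite parts excluding the one and the
  other would have a common solution.\<close>

lemma extend_to_type:
  assumes p: "p \<subseteq> x_formulas L (univ M)" "finitely_satisfiable M p"
  obtains q where "q \<in> type_space L M" "p \<subseteq> q"
proof -
  define \<A> where "\<A> = {q. p \<subseteq> q \<and> q \<subseteq> x_formulas L (univ M) \<and> finitely_satisfiable M q}"
  have "\<exists>q\<in>\<A>. \<forall>X\<in>\<A>. q \<subseteq> X \<longrightarrow> X = q"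
  proof (rule subset_Zorn_nonempty)
    show "\<A> \<noteq> {}" using p by (auto simp: \<A>_def)
    fix \<C> assume C: "\<C> \<noteq> {}" "subset.chain \<A> \<C>"
    then have CA: "\<C> \<subseteq> \<A>" by (auto simp: subset.chain_def)
    have "finitely_satisfiable M (\<Union>\<C>)"
      unfolding finitely_satisfiable_def
    proof (intro allI impI)
      fix r assume r: "finite r" "r \<subseteq> \<Union>\<C>"
      obtain B where B: "B \<in> \<C>" "r \<subseteq> B" by (rule finite_subset_Union_chain[OF r C])
      then show "\<exists>a\<in>univ M. \<forall>\<phi>\<in>r. satisfies M a \<phi>"
        using CA r(1) unfolding \<A>_def finitely_satisfiable_def by blast
    qed
    then show "\<Union>\<C> \<in> \<A>" using C(1) CA unfolding \<A>_def by blast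
  qed
  then obtain q where q: "q \<in> \<A>" and max: "\<And>X. X \<in> \<A> \<Longrightarrow> q \<subseteq> X \<Longrightarrow> X = q" by blast
  have qD: "p \<subseteq> q" "q \<subseteq> x_formulas L (univ M)" "finitely_satisfiable M q"
    using q by (auto simp: \<A>_def)
  have unsat: "\<exists>r. finite r \<and> r \<subseteq> q \<and> (\<forall>a\<in>univ M. (\<forall>\<psi>\<in>r. satisfies M a \<psi>) \<longrightarrow> \<not> satisfies M a \<phi>)"
    if \<phi>: "\<phi> \<in> x_formulas L (univ M)" "\<phi> \<notin> q" for \<phi>
  proof -
    have "insert \<phi> q \<notin> \<A>" using max[of "insert \<phi> q"] \<phi>(2) by blast
    then have "\<not> finitely_satisfiable M (insert \<phi> q)" using qD \<phi>(1) by (auto simp: \<A>_def)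
    then obtain s where s: "finite s" "s \<subseteq> insert \<phi> q" "\<not> (\<exists>a\<in>univ M. \<forall>\<psi>\<in>s. satisfies M a \<psi>)"
      unfolding finitely_satisfiable_def by blast
    have "finite (s - {\<phi>})" "s - {\<phi>} \<subseteq> q" using s by auto
    moreover have "\<not> satisfies M a \<phi>" if "a \<in> univ M" "\<forall>\<psi>\<in>s - {\<phi>}. satisfies M a \<psi>" for a
      using s(3) that by blast
    ultimately show ?thesis by blast
  qed
  have "\<phi> \<in> q \<or> Neg \<phi> \<in> q" if \<phi>: "\<phi> \<in> x_formulas L (univ M)" for \<phi>
  proof (rule ccontr)
    assume "\<not> (\<phi> \<in> q \<or> Neg \<phi> \<in> q)"
    then obtain r s where r: "finite r" "r \<subseteq> q"
        "\<forall>a\<in>univ M. (\<forall>\<psi>\<in>r. satisfies M a \<psi>) \<longrightarrow> \<not> satisfies M a \<phi>"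
      and s: "finite s" "s \<subseteq> q" "\<forall>a\<in>univ M. (\<forall>\<psi>\<in>s. satisfies M a \<psi>) \<longrightarrow> \<not> satisfies M a (Neg \<phi>)"
      using unsat[OF \<phi>] unsat[of "Neg \<phi>"] \<phi> by auto
    have "finite (r \<union> s)" "r \<union> s \<subseteq> q" using r s by auto
    then obtain a where "a \<in> univ M" "\<forall>\<psi>\<in>r \<union> s. satisfies M a \<psi>"
      using qD(3) unfolding finitely_satisfiable_def by blast
    then show False using r(3) s(3) by auto
  qed
  then have "q \<in> type_space L M" using qD unfolding type_space_def by blast
  then show ?thesis using that qD(1) by blast
qed

text \<open>The generating sets are closed under intersection by \<open>Conj\<close>, so they form a
  base and not just a subbase.\<close>

lemma openin_type_topologyD:
  assumes "openin (type_topology L M) U" "p \<in> U"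
  shows "\<exists>\<phi> \<in> x_formulas L (univ M). p \<in> types_containing L M \<phi> \<and> types_containing L M \<phi> \<subseteq> U"
  using assms unfolding type_topology_def openin_topology_generated_by_iff
proof (induction arbitrary: p)
  case (Int a b)
  then obtain \<phi> \<psi> where "\<phi> \<in> x_formulas L (univ M)" "p \<in> types_containing L M \<phi>" "types_containing L M \<phi> \<subseteq> a"
    "\<psi> \<in> x_formulas L (univ M)" "p \<in> types_containing L M \<psi>" "types_containing L M \<psi> \<subseteq> b"
    by (metis IntD1 IntD2)
  then show ?case
    by (intro bexI[of _ "Conj \<phi> \<psi>"]) (auto simp: types_containing_Neg types_containing_Conj)
next
  case (UN K)
  then show ?case by (meson Sup_upper UnionE order_trans)
qed auto

text \<open>If no finite part of a cover sufficed, the negations of the basic sets below its members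
  would be finitely satisfiable and extend to a type that the cover misses.\<close>

lemma compact_type_space: "compact_space (type_topology L M)"
  unfolding compact_space_def compactin_def topspace_type_topology
proof (intro conjI allI impI, simp)
  fix \<U> assume "Ball \<U> (openin (type_topology L M)) \<and> type_space L M \<subseteq> \<Union> \<U>"
  then have op: "\<And>U. U \<in> \<U> \<Longrightarrow> openin (type_topology L M) U" and cover: "type_space L M \<subseteq> \<Union>\<U>" by auto
  define S where "S = {\<phi> \<in> x_formulas L (univ M). \<exists>U\<in>\<U>. types_containing L M \<phi> \<subseteq> U}"
  have "\<not> finitely_satisfiable M (Neg ` S)"
  proof
    assume "finitely_satisfiable M (Neg ` S)"
    moreover have "Neg ` S \<subseteq> x_formulas L (univ M)" by (auto simp: S_def)
    ultimately obtain q where q: "q \<in> type_space L M" "Neg ` S \<subseteq> q" by (metis extend_to_type)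
    then obtain U where U: "U \<in> \<U>" "q \<in> U" using cover by blast
    then obtain \<phi> where \<phi>: "\<phi> \<in> x_formulas L (univ M)" "q \<in> types_containing L M \<phi>" "types_containing L M \<phi> \<subseteq> U"
      using openin_type_topologyD[OF op] by blast
    then have "Neg \<phi> \<in> q" using U(1) q(2) by (auto simp: S_def)
    then show False using type_Neg[OF q(1) \<phi>(1)] \<phi>(2) by (auto simp: types_containing_def)
  qed
  then obtain r where r: "finite r" "r \<subseteq> Neg ` S" "\<not> (\<exists>a\<in>univ M. \<forall>\<phi>\<in>r. satisfies M a \<phi>)"
    unfolding finitely_satisfiable_def by blast
  then obtain s where s: "finite s" "s \<subseteq> S" "r = Neg ` s" by (meson finite_subset_image)
  have "\<exists>U. U \<in> \<U> \<and> types_containing L M \<phi> \<subseteq> U" if "\<phi> \<in> s" for \<phi> using s(2) that by (auto simp: S_def)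
  then obtain F where F: "\<And>\<phi>. \<phi> \<in> s \<Longrightarrow> F \<phi> \<in> \<U> \<and> types_containing L M \<phi> \<subseteq> F \<phi>" by metis
  have "type_space L M \<subseteq> \<Union>(F ` s)"
  proof
    fix q assume q: "q \<in> type_space L M"
    show "q \<in> \<Union>(F ` s)"
    proof (rule ccontr)
      assume n: "q \<notin> \<Union>(F ` s)"
      have "Neg \<phi> \<in> q" if "\<phi> \<in> s" for \<phi>
      proof -
        have "\<phi> \<notin> q" using n F[OF that] that q by (auto simp: types_containing_def)
        then show ?thesis using type_Neg[OF q] s(2) that by (auto simp: S_def)
      qed
      then have "r \<subseteq> q" using s(3) by auto
      then show False using type_spaceD(2)[OF q r(1)] r(3) by blast
    qed
  qed
  then show "\<exists>\<F>. finite \<F> \<and> \<F> \<subseteq> \<U> \<and> type_space L M \<subseteq> \<Union> \<F>"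
    using s(1) F by (intro exI[of _ "F ` s"]) auto
qed

section \<open>Regular Borel measures from the algebra of basic clopen sets\<close>

lemma types_containing_algebra:
  "algebra (type_space L M) (types_containing L M ` x_formulas L (univ M))"
  unfolding algebra_iff_Int
proof (intro conjI ballI)
  show "types_containing L M ` x_formulas L (univ M) \<subseteq> Pow (type_space L M)"
    by (auto simp: types_containing_def)
  have "types_containing L M (Neg truth) = {}"
    by (simp add: types_containing_Neg types_containing_Conj types_containing_truth)
  then show "{} \<in> types_containing L M ` x_formulas L (univ M)"
    by (metis formulas_simps(1) image_eqI truth_simps(2))
  fix a assume "a \<in> types_containing L M ` x_formulas L (univ M)"
  then obtain \<phi> where \<phi>: "\<phi> \<in> x_formulas L (univ M)" "a = types_containing L M \<phi>" by blast
  show "type_space L M - a \<in> types_containing L M ` x_formulas L (univ M)"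
    using \<phi> by (intro image_eqI[of _ _ "Neg \<phi>"]) (auto simp: types_containing_Neg types_containing_Conj)
  fix b assume "b \<in> types_containing L M ` x_formulas L (univ M)"
  then obtain \<psi> where \<psi>: "\<psi> \<in> x_formulas L (univ M)" "b = types_containing L M \<psi>" by blast
  show "a \<inter> b \<in> types_containing L M ` x_formulas L (univ M)"
    using \<phi> \<psi> by (intro image_eqI[of _ _ "Conj \<phi> \<psi>"]) (auto simp: types_containing_Neg types_containing_Conj)
qed

lemma closedin_types_containing:
  assumes "\<phi> \<in> x_formulas L (univ M)"
  shows "closedin (type_topology L M) (types_containing L M \<phi>)"
proof -
  have "types_containing L M \<phi> = type_space L M - types_containing L M (Neg \<phi>)"
    using assms by (auto simp: types_containing_def type_Neg)
  then show ?thesis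
    using openin_types_containing[of "Neg \<phi>" L M] assms
    by (metis closedin_diff closedin_topspace formulas_simps(1) topspace_type_topology)
qed

text \<open>With countably many formulas every open set is a countable union of basic sets, so the
  Borel sets are generated by an algebra on which measures can be prescribed.\<close>

lemma sigma_sets_open_types:
  assumes "countable (x_formulas L (univ M))"
  shows "sigma_sets (type_space L M) {U. openin (type_topology L M) U} =
    sigma_sets (type_space L M) (types_containing L M ` x_formulas L (univ M))"
proof (intro equalityI sigma_sets_mono subsetI)
  fix U assume "U \<in> {U. openin (type_topology L M) U}"
  then have U: "openin (type_topology L M) U" by simp
  let ?F = "{\<phi> \<in> x_formulas L (univ M). types_containing L M \<phi> \<subseteq> U}"
  have eq: "U = \<Union>(types_containing L M ` ?F)" using openin_type_topologyD[OF U] by blast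
  have "countable (types_containing L M ` ?F)"
    using countable_subset[OF _ assms, of ?F] by auto
  moreover have "V \<in> sigma_sets (type_space L M) (types_containing L M ` x_formulas L (univ M))"
    if "V \<in> types_containing L M ` ?F" for V using that by (intro sigma_sets.Basic) auto
  ultimately have "\<Union>(types_containing L M ` ?F) \<in> sigma_sets (type_space L M) (types_containing L M ` x_formulas L (univ M))"
    by (rule sigma_sets_UNION)
  then show "U \<in> sigma_sets (type_space L M) (types_containing L M ` x_formulas L (univ M))"
    using eq by simp
next
  fix U assume "U \<in> types_containing L M ` x_formulas L (univ M)"
  then show "U \<in> sigma_sets (type_space L M) {U. openin (type_topology L M) U}"
    using openin_types_containing by (intro sigma_sets.Basic) auto
qed

text \<open>The sets that can be squeezed between a closed and an open set of nearly equal measure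
  form a sigma-algebra containing the clopen generators.\<close>

lemma regular_approximation:
  assumes fin: "finite_measure \<mu>" and sets: "sets \<mu> = sigma_sets \<Omega> \<A>" and sp: "space \<mu> = \<Omega>"
    and T: "topspace T = \<Omega>" and op: "\<And>U. openin T U \<Longrightarrow> U \<in> sets \<mu>"
    and clopen: "\<And>A. A \<in> \<A> \<Longrightarrow> openin T A \<and> closedin T A"
    and A: "A \<in> sets \<mu>"
  shows "\<forall>\<epsilon> > 0. \<exists>C U. closedin T C \<and> openin T U \<and> C \<subseteq> A \<and> A \<subseteq> U \<and> measure \<mu> (U - C) < \<epsilon>"
proof -
  interpret finite_measure \<mu> by fact
  have cl: "C \<in> sets \<mu>" if "closedin T C" for C
  proof -
    have "openin T (\<Omega> - C)" using that T by (auto simp: closedin_def)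
    then have "space \<mu> - (\<Omega> - C) \<in> sets \<mu>" using op by blast
    moreover have "C \<subseteq> \<Omega>" using closedin_subset[OF that] T by simp
    ultimately show ?thesis using sp by (simp add: double_diff)
  qed
  from A[unfolded sets] show ?thesis
  proof induction
    case (Basic a)
    then show ?case using clopen[OF Basic] by (intro allI impI exI[of _ a]) auto
  next
    case Empty
    then show ?case by (intro allI impI exI[of _ "{}"]) auto
  next
    case (Compl a)
    show ?case
    proof (intro allI impI)
      fix \<epsilon> :: real assume "\<epsilon> > 0"
      from Compl.IH[rule_format, OF this]
      obtain C U where CU: "closedin T C" "openin T U" "C \<subseteq> a" "a \<subseteq> U" "measure \<mu> (U - C) < \<epsilon>"
        by (elim exE conjE) (rule that)
      have "(\<Omega> - C) - (\<Omega> - U) = U - C" using openin_subset[OF CU(2)] T by blast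
      moreover have "closedin T (\<Omega> - U)" "openin T (\<Omega> - C)"
        using closedin_diff[OF closedin_topspace CU(2)] openin_diff[OF openin_topspace CU(1)] T by simp_all
      ultimately show "\<exists>C U. closedin T C \<and> openin T U \<and> C \<subseteq> \<Omega> - a \<and> \<Omega> - a \<subseteq> U \<and> measure \<mu> (U - C) < \<epsilon>"
        using CU by (intro exI[of _ "\<Omega> - U"] exI[of _ "\<Omega> - C"]) auto
    qed
  next
    case (Union a)
    show ?case
    proof (intro allI impI)
      fix \<epsilon> :: real assume \<epsilon>: "\<epsilon> > 0"
      \<comment> \<open>Half of \<open>\<epsilon>\<close> is spread geometrically over the sequence;
        the slack that remains pays for truncating the union of the closed sets.\<close>
      have "\<forall>i. \<exists>C U. closedin T C \<and> openin T U \<and> C \<subseteq> a i \<and> a i \<subseteq> U \<and> measure \<mu> (U - C) < \<epsilon> / 2 * (1 / 2) ^ Suc i"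
        by (intro allI Union.IH[rule_format]) (use \<epsilon> in simp)
      then obtain C where "\<forall>i. \<exists>U. closedin T (C i) \<and> openin T U \<and> C i \<subseteq> a i \<and> a i \<subseteq> U \<and>
          measure \<mu> (U - C i) < \<epsilon> / 2 * (1 / 2) ^ Suc i"
        by (rule choice[THEN exE])
      then obtain U where "\<forall>i. closedin T (C i) \<and> openin T (U i) \<and> C i \<subseteq> a i \<and> a i \<subseteq> U i \<and>
          measure \<mu> (U i - C i) < \<epsilon> / 2 * (1 / 2) ^ Suc i"
        by (rule choice[THEN exE])
      then have CU: "\<And>i. closedin T (C i)" "\<And>i. openin T (U i)" "\<And>i. C i \<subseteq> a i" "\<And>i. a i \<subseteq> U i"
        "\<And>i. measure \<mu> (U i - C i) < \<epsilon> / 2 * (1 / 2) ^ Suc i" by blast+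
      have Us: "U i \<in> sets \<mu>" and Cs: "C i \<in> sets \<mu>" for i using CU op cl by auto
      have sums: "(\<lambda>i. \<epsilon> / 2 * (1 / 2) ^ Suc i) sums (\<epsilon> / 2)"
        using sums_mult[OF power_half_series, of "\<epsilon> / 2"] by simp
      have summ: "summable (\<lambda>i. measure \<mu> (U i - C i))"
        by (rule summable_comparison_test'[OF sums_summable[OF sums], of 0])
          (use CU(5) less_imp_le in \<open>auto simp: less_imp_le\<close>)
      have "measure \<mu> (\<Union>i. U i - C i) \<le> (\<Sum>i. measure \<mu> (U i - C i))"
        using Us Cs by (intro finite_measure_subadditive_countably[OF _ summ]) auto
      also have "\<dots> \<le> (\<Sum>i. \<epsilon> / 2 * (1 / 2) ^ Suc i)"
        by (intro suminf_le summ sums_summable[OF sums] less_imp_le CU(5))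
      also have "\<dots> = \<epsilon> / 2" using sums sums_unique by metis
      finally have le: "measure \<mu> (\<Union>i. U i - C i) \<le> \<epsilon> / 2" .
      \<comment> \<open>An infinite union of closed sets need not be closed, so it is cut off at a
        finite stage, where continuity from above keeps the error below
        \<open>\<epsilon>\<close>.\<close>
      define D where "D n = (\<Union>i. U i) - (\<Union>i<n. C i)" for n
      have Ds: "D n \<in> sets \<mu>" for n using Us Cs by (auto simp: D_def)
      have "(\<lambda>n. measure \<mu> (D n)) \<longlonglongrightarrow> measure \<mu> (\<Inter>n. D n)"
      proof (rule finite_Lim_measure_decseq)
        show "decseq D" unfolding decseq_def D_def by force
      qed (use Ds in auto)
      moreover have "measure \<mu> (\<Inter>n. D n) \<le> measure \<mu> (\<Union>i. U i - C i)"
        using Us Cs by (intro finite_measure_mono) (auto simp: D_def, blast)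
      then have "measure \<mu> (\<Inter>n. D n) < \<epsilon>" using le \<epsilon> by linarith
      ultimately have "eventually (\<lambda>n. measure \<mu> (D n) < \<epsilon>) sequentially" by (rule order_tendstoD)
      then obtain n where n: "measure \<mu> (D n) < \<epsilon>" by (auto simp: eventually_sequentially)
      show "\<exists>C' U'. closedin T C' \<and> openin T U' \<and> C' \<subseteq> \<Union>(range a) \<and> \<Union>(range a) \<subseteq> U' \<and> measure \<mu> (U' - C') < \<epsilon>"
      proof (rule exI[of _ "\<Union>i<n. C i"], rule exI[of _ "\<Union>i. U i"], intro conjI)
        show "closedin T (\<Union>i<n. C i)" using CU(1) by (intro closedin_Union) auto
        show "openin T (\<Union>i. U i)" using CU(2) by (intro openin_Union) auto
        show "(\<Union>i<n. C i) \<subseteq> \<Union>(range a)" "\<Union>(range a) \<subseteq> (\<Union>i. U i)" using CU(3,4) by blast+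
        show "measure \<mu> ((\<Union>i. U i) - (\<Union>i<n. C i)) < \<epsilon>" using n by (simp add: D_def)
      qed
    qed
  qed
qed

text \<open>Closed sets of types are compact, so the approximation by closed and open sets is
  already inner and outer regularity.\<close>

lemma keisler_measureI:
  assumes cnt: "countable (x_formulas L (univ M))" and P: "prob_space \<mu>"
    and sets: "sets \<mu> = sigma_sets (type_space L M) (types_containing L M ` x_formulas L (univ M))"
  shows "keisler_measure L M \<mu>"
proof -
  interpret prob_space \<mu> by fact
  interpret \<A>: algebra "type_space L M" "types_containing L M ` x_formulas L (univ M)"
    by (rule types_containing_algebra)
  have sets': "sets \<mu> = sigma_sets (type_space L M) {U. openin (type_topology L M) U}"
    using sets sigma_sets_open_types[OF cnt] by simp
  have sp: "space \<mu> = type_space L M"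
  proof -
    have sub: "sets \<mu> \<subseteq> Pow (type_space L M)"
      unfolding sets by (rule sigma_sets_into_sp[THEN PowI, THEN subsetI]) (use \<A>.space_closed in auto)
    moreover have "type_space L M \<in> sets \<mu>" unfolding sets by (rule sigma_sets_top)
    moreover have "space \<mu> \<in> sets \<mu>" by simp
    ultimately show ?thesis using sets.sets_into_space by blast
  qed
  have op: "U \<in> sets \<mu>" if "openin (type_topology L M) U" for U
    unfolding sets' using that by (intro sigma_sets.Basic) simp
  have approx: "\<exists>C U. closedin (type_topology L M) C \<and> openin (type_topology L M) U \<and> C \<subseteq> A \<and> A \<subseteq> U \<and>
      measure \<mu> (U - C) < \<epsilon>" if "A \<in> sets \<mu>" "\<epsilon> > 0" for A \<epsilon>
  proof -
    have "openin (type_topology L M) B \<and> closedin (type_topology L M) B"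
      if "B \<in> types_containing L M ` x_formulas L (univ M)" for B
      using that openin_types_containing closedin_types_containing by blast
    from regular_approximation[OF finite_measure_axioms sets sp topspace_type_topology op this that(1)]
    show ?thesis using that(2) by simp
  qed
  have comp: "compactin (type_topology L M) C" if "closedin (type_topology L M) C" for C
    using closedin_compact_space[OF compact_type_space that] .
  have cl: "C \<in> sets \<mu>" if "closedin (type_topology L M) C" for C
  proof -
    have "openin (type_topology L M) (space \<mu> - C)"
      using that unfolding closedin_def topspace_type_topology sp by blast
    then have "space \<mu> - (space \<mu> - C) \<in> sets \<mu>" using op by blast
    moreover have "C \<subseteq> space \<mu>" using closedin_subset[OF that] topspace_type_topology sp by metis
    ultimately show ?thesis by (simp add: double_diff)
  qed
  have split: "emeasure \<mu> Y \<le> emeasure \<mu> X + ennreal \<epsilon>"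
    if "measure \<mu> D < \<epsilon>" "Y \<subseteq> X \<union> D" "X \<in> sets \<mu>" "D \<in> sets \<mu>" for X Y D \<epsilon>
  proof -
    have "emeasure \<mu> Y \<le> emeasure \<mu> (X \<union> D)" using that by (intro emeasure_mono) auto
    also have "\<dots> \<le> emeasure \<mu> X + emeasure \<mu> D" using that by (intro emeasure_subadditive) auto
    also have "\<dots> \<le> emeasure \<mu> X + ennreal \<epsilon>"
      using that by (intro add_left_mono) (simp add: emeasure_eq_measure ennreal_leI)
    finally show ?thesis .
  qed
  show ?thesis
    unfolding keisler_measure_def
  proof (intro conjI ballI)
    show "prob_space \<mu>" "space \<mu> = type_space L M"
      "sets \<mu> = sigma_sets (type_space L M) {U. openin (type_topology L M) U}" by fact+
    fix A assume A: "A \<in> sets \<mu>"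
    let ?O = "{U. openin (type_topology L M) U \<and> A \<subseteq> U}" and ?C = "{K. compactin (type_topology L M) K \<and> K \<subseteq> A}"
    have subs: "A \<subseteq> C \<union> (U - C)" "U \<subseteq> A \<union> (U - C)" if "C \<subseteq> A" "A \<subseteq> U" for C U :: "('a, 'b) fm set set"
      using that by auto
    show "emeasure \<mu> A = (INF U\<in>?O. emeasure \<mu> U)"
    proof (rule antisym)
      show "emeasure \<mu> A \<le> (INF U\<in>?O. emeasure \<mu> U)"
        using op by (intro INF_greatest emeasure_mono) auto
      show "(INF U\<in>?O. emeasure \<mu> U) \<le> emeasure \<mu> A"
      proof (rule ennreal_le_epsilon)
        fix \<epsilon> :: real assume "0 < \<epsilon>"
        from approx[OF A this] obtain C U where CU: "closedin (type_topology L M) C" "openin (type_topology L M) U" "C \<subseteq> A" "A \<subseteq> U"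
          "measure \<mu> (U - C) < \<epsilon>" by blast
        have "(INF U\<in>?O. emeasure \<mu> U) \<le> emeasure \<mu> U" using CU by (intro INF_lower) auto
        also have "\<dots> \<le> emeasure \<mu> A + ennreal \<epsilon>"
          by (rule split[OF CU(5) subs(2)[OF CU(3,4)] A]) (use op[OF CU(2)] cl[OF CU(1)] in auto)
        finally show "(INF U\<in>?O. emeasure \<mu> U) \<le> emeasure \<mu> A + ennreal \<epsilon>" .
      qed
    qed
    show "emeasure \<mu> A = (SUP K\<in>?C. emeasure \<mu> K)"
    proof (rule antisym)
      show "(SUP K\<in>?C. emeasure \<mu> K) \<le> emeasure \<mu> A"
        using A by (intro SUP_least emeasure_mono) auto
      show "emeasure \<mu> A \<le> (SUP K\<in>?C. emeasure \<mu> K)"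
      proof (rule ennreal_le_epsilon)
        fix \<epsilon> :: real assume "0 < \<epsilon>"
        from approx[OF A this] obtain C U where CU: "closedin (type_topology L M) C" "openin (type_topology L M) U" "C \<subseteq> A" "A \<subseteq> U"
          "measure \<mu> (U - C) < \<epsilon>" by blast
        have "emeasure \<mu> A \<le> emeasure \<mu> C + ennreal \<epsilon>"
          by (rule split[OF CU(5) subs(1)[OF CU(3,4)] cl[OF CU(1)]]) (use op[OF CU(2)] cl[OF CU(1)] in auto)
        also have "emeasure \<mu> C \<le> (SUP K\<in>?C. emeasure \<mu> K)" using CU comp by (intro SUP_upper) auto
        finally show "emeasure \<mu> A \<le> (SUP K\<in>?C. emeasure \<mu> K) + ennreal \<epsilon>" by (simp add: add_right_mono)
      qed
    qed
  qed
qed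

text \<open>Caratheodory extension. Continuity at the empty set is due to compactness: a decreasing
  sequence of clopen sets with empty intersection is empty from some point on.\<close>

lemma keisler_measure_exists:
  fixes \<nu> :: "('r, 'a) fm \<Rightarrow> real"
  assumes cnt: "countable (x_formulas L (univ M))"
    and nonneg: "\<And>\<phi>. \<phi> \<in> x_formulas L (univ M) \<Longrightarrow> 0 \<le> \<nu> \<phi>" and one: "\<nu> truth = 1"
    and add: "\<And>\<phi> \<psi> \<theta>. \<phi> \<in> x_formulas L (univ M) \<Longrightarrow> \<psi> \<in> x_formulas L (univ M) \<Longrightarrow> \<theta> \<in> x_formulas L (univ M) \<Longrightarrow>
      (\<And>a. a \<in> univ M \<Longrightarrow> \<not> (satisfies M a \<phi> \<and> satisfies M a \<psi>)) \<Longrightarrow>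
      (\<And>a. a \<in> univ M \<Longrightarrow> satisfies M a \<theta> \<longleftrightarrow> satisfies M a \<phi> \<or> satisfies M a \<psi>) \<Longrightarrow> \<nu> \<theta> = \<nu> \<phi> + \<nu> \<psi>"
  obtains \<mu> where "keisler_measure L M \<mu>"
    "\<And>\<phi>. \<phi> \<in> x_formulas L (univ M) \<Longrightarrow> measure \<mu> (types_containing L M \<phi>) = \<nu> \<phi>"
proof -
  let ?F = "x_formulas L (univ M)" and ?\<A> = "types_containing L M ` x_formulas L (univ M)"
  interpret \<A>: algebra "type_space L M" ?\<A> by (rule types_containing_algebra)
  \<comment> \<open>Additivity applied to three false formulas gives \<open>0\<close>. Applied to a
    formula and a false one it then shows that \<open>\<nu>\<close> depends only on the set that a
    formula defines.\<close>
  have false: "\<nu> (Neg truth) = 0" using add[of "Neg truth" "Neg truth" "Neg truth"] by simp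
  have \<nu>_cong: "\<nu> \<phi> = \<nu> \<psi>" if "\<phi> \<in> ?F" "\<psi> \<in> ?F" "types_containing L M \<phi> = types_containing L M \<psi>" for \<phi> \<psi>
  proof -
    have "satisfies M a \<phi> \<longleftrightarrow> satisfies M a \<psi>" if "a \<in> univ M" for a
      using types_containing_mono_iff[of \<phi> L M \<psi>] types_containing_mono_iff[of \<psi> L M \<phi>] \<open>\<phi> \<in> ?F\<close> \<open>\<psi> \<in> ?F\<close>
        \<open>types_containing L M \<phi> = types_containing L M \<psi>\<close> that by blast
    then have "\<nu> \<phi> = \<nu> \<psi> + \<nu> (Neg truth)" using that by (intro add) auto
    then show ?thesis using false by simp
  qed
  define f where "f U = ennreal (\<nu> (SOME \<phi>. \<phi> \<in> ?F \<and> types_containing L M \<phi> = U))" for U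
  have f: "f (types_containing L M \<phi>) = ennreal (\<nu> \<phi>)" if "\<phi> \<in> ?F" for \<phi>
  proof -
    let ?\<psi> = "SOME \<psi>. \<psi> \<in> ?F \<and> types_containing L M \<psi> = types_containing L M \<phi>"
    have "?\<psi> \<in> ?F \<and> types_containing L M ?\<psi> = types_containing L M \<phi>"
      by (rule someI[of _ \<phi>]) (use that in simp)
    then have "\<nu> ?\<psi> = \<nu> \<phi>" using that by (intro \<nu>_cong) auto
    then show ?thesis by (simp add: f_def)
  qed
  have empty: "types_containing L M (Neg truth) = {}"
    by (simp add: types_containing_Neg types_containing_Conj types_containing_truth)
  have f_empty: "f {} = 0" using f[of "Neg truth"] empty false by simp
  have "\<exists>\<mu>. (\<forall>s\<in>?\<A>. \<mu> s = f s) \<and> measure_space (type_space L M) (sigma_sets (type_space L M) ?\<A>) \<mu>"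
  proof (rule \<A>.caratheodory_empty_continuous)
    show "positive ?\<A> f" unfolding positive_def by (rule f_empty)
    show "Measure_Space.additive ?\<A> f"
      unfolding Measure_Space.additive_def
    proof (intro ballI impI)
      fix x y assume "x \<in> ?\<A>" "y \<in> ?\<A>" and disj: "x \<inter> y = {}"
      then obtain \<phi> \<psi> where \<phi>: "\<phi> \<in> ?F" "x = types_containing L M \<phi>" and \<psi>: "\<psi> \<in> ?F" "y = types_containing L M \<psi>" by blast
      define \<theta> where "\<theta> = Neg (Conj (Neg \<phi>) (Neg \<psi>))"
      have \<theta>: "\<theta> \<in> ?F" using \<phi> \<psi> by (simp add: \<theta>_def)
      have un: "types_containing L M \<theta> = x \<union> y"
        using \<phi> \<psi> by (auto simp: \<theta>_def types_containing_Neg types_containing_Conj) (auto simp: types_containing_def)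
      have "\<not> (satisfies M a \<phi> \<and> satisfies M a \<psi>)" if "a \<in> univ M" for a
        using types_containing_mono_iff[of "Conj \<phi> \<psi>" L M "Neg truth"] disj \<phi> \<psi> that
        by (auto simp: types_containing_Neg types_containing_Conj)
      then have "\<nu> \<theta> = \<nu> \<phi> + \<nu> \<psi>" using \<phi> \<psi> \<theta> by (intro add) (auto simp: \<theta>_def)
      then show "f (x \<union> y) = f x + f y"
        using f[OF \<phi>(1)] f[OF \<psi>(1)] f[OF \<theta>] nonneg[OF \<phi>(1)] nonneg[OF \<psi>(1)] \<phi>(2) \<psi>(2) un
        by (simp add: ennreal_plus)
    qed
    show "f A \<noteq> \<infinity>" for A by (simp add: f_def)
    fix A :: "nat \<Rightarrow> ('r, 'a) fm set set"
    assume A: "range A \<subseteq> ?\<A>" "decseq A" "(\<Inter>i. A i) = {}"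
    have "\<exists>n. A n = {}"
    proof -
      have cl: "closedin (type_topology L M) (A i)" for i
      proof -
        have "A i \<in> ?\<A>" using A(1) by (rule subsetD) simp
        then obtain \<phi> where \<phi>: "\<phi> \<in> ?F" "A i = types_containing L M \<phi>" by (elim imageE)
        show ?thesis unfolding \<phi>(2) by (rule closedin_types_containing[OF \<phi>(1)])
      qed
      have op: "\<And>U. U \<in> range (\<lambda>i. type_space L M - A i) \<Longrightarrow> openin (type_topology L M) U"
        using openin_diff[OF openin_topspace cl] unfolding topspace_type_topology by blast
      have cover: "type_space L M \<subseteq> \<Union>(range (\<lambda>i. type_space L M - A i))" using A(3) by blast
      have "compactin (type_topology L M) (type_space L M)"
        using compact_type_space[of L M] by (simp add: compact_space_def topspace_type_topology)
      from compactinD[OF this op cover] obtain \<F> where "finite \<F>" "\<F> \<subseteq> range (\<lambda>i. type_space L M - A i)" "type_space L M \<subseteq> \<Union>\<F>"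
        by blast
      then obtain I where I: "finite I" "type_space L M \<subseteq> (\<Union>i\<in>I. type_space L M - A i)"
        by (metis finite_subset_image)
      define n where "n = Max (insert 0 I)"
      have "A n \<subseteq> A i" if "i \<in> I" for i using A(2) I(1) that by (auto simp: n_def decseq_def)
      moreover have "A n \<subseteq> type_space L M" using closedin_subset[OF cl, of n] topspace_type_topology[of L M] by simp
      ultimately have "A n = {}" using I(2) by blast
      then show ?thesis by blast
    qed
    then obtain n where n: "A n = {}" by blast
    have "f (A i) = 0" if "i \<ge> n" for i
    proof -
      have "A i = {}" using decseqD[OF A(2) that] n by simp
      then show ?thesis using f_empty by simp
    qed
    then show "(\<lambda>i. f (A i)) \<longlonglongrightarrow> 0"
      by (intro tendsto_eventually) (auto simp: eventually_sequentially)
  qed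
  then obtain m where m: "\<And>s. s \<in> ?\<A> \<Longrightarrow> m s = f s"
    and ms: "measure_space (type_space L M) (sigma_sets (type_space L M) ?\<A>) m" by blast
  define \<mu> where "\<mu> = measure_of (type_space L M) (sigma_sets (type_space L M) ?\<A>) m"
  have sa: "sigma_algebra (type_space L M) (sigma_sets (type_space L M) ?\<A>)"
    by (rule sigma_algebra_sigma_sets) (rule \<A>.space_closed)
  have sub: "sigma_sets (type_space L M) ?\<A> \<subseteq> Pow (type_space L M)"
    using sigma_algebra_iff2[THEN iffD1, OF sa] by blast
  have sets: "sets \<mu> = sigma_sets (type_space L M) ?\<A>"
    unfolding \<mu>_def using sub sa by (simp add: sigma_algebra.sigma_sets_eq)
  have em: "emeasure \<mu> (types_containing L M \<phi>) = ennreal (\<nu> \<phi>)" if "\<phi> \<in> ?F" for \<phi>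
  proof -
    have "types_containing L M \<phi> \<in> sigma_sets (type_space L M) ?\<A>" using that by (intro sigma_sets.Basic) auto
    then have "emeasure \<mu> (types_containing L M \<phi>) = m (types_containing L M \<phi>)"
      unfolding \<mu>_def using ms by (intro emeasure_measure_of_sigma) (auto simp: measure_space_def)
    then show ?thesis using m f[OF that] that by simp
  qed
  have "space \<mu> = type_space L M" unfolding \<mu>_def using sub by (rule space_measure_of)
  then have "prob_space \<mu>"
    using em[of truth] one types_containing_truth[of L M] by (intro prob_spaceI) simp
  then have "keisler_measure L M \<mu>" using keisler_measureI[OF cnt _ sets] by blast
  moreover have "measure \<mu> (types_containing L M \<phi>) = \<nu> \<phi>" if "\<phi> \<in> ?F" for \<phi>
    using em[OF that] nonneg[OF that] by (simp add: measure_def)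
  ultimately show ?thesis using that by blast
qed

text \<open>The measure and its pushforward under the inverse automorphism agree on the algebra of
  basic sets, which is stable under intersection, hence on all Borel sets.\<close>

lemma invariant_measureI:
  assumes cnt: "countable (x_formulas L (univ M))" and K: "keisler_measure L M \<mu>"
    and inv: "\<And>g \<phi>. automorphism M g \<Longrightarrow> \<phi> \<in> x_formulas L (univ M) \<Longrightarrow>
      measure \<mu> (types_containing L M (map_fm id g \<phi>)) = measure \<mu> (types_containing L M \<phi>)"
  shows "invariant_keisler_measure L M \<mu>"
proof -
  let ?\<A> = "types_containing L M ` x_formulas L (univ M)" and ?\<Omega> = "type_space L M"
  interpret prob_space \<mu> by (rule keisler_measureD(1)[OF K])
  interpret \<A>: algebra ?\<Omega> ?\<A> by (rule types_containing_algebra)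
  have sp: "space \<mu> = ?\<Omega>" by (rule keisler_measureD(2)[OF K])
  have sets: "sets \<mu> = sigma_sets ?\<Omega> ?\<A>"
    using K sigma_sets_open_types[OF cnt] by (simp add: keisler_measure_def)
  have "emeasure \<mu> (type_action g ` A) = emeasure \<mu> A" if g: "automorphism M g" and A: "A \<in> sets \<mu>" for g A
  proof -
    obtain h where h: "automorphism M h" "\<And>a. a \<in> univ M \<Longrightarrow> h (g a) = a"
      "\<And>a. a \<in> univ M \<Longrightarrow> g (h a) = a" using automorphism_inverse[OF g] by metis
    \<comment> \<open>Since \<open>h\<close> inverts \<open>g\<close>, images under \<open>g\<close>
      are preimages under \<open>h\<close>; this makes the measure of an image the value of a
      pushforward.\<close>
    have pre: "type_action h -` B \<inter> ?\<Omega> = type_action g ` B" if "B \<subseteq> ?\<Omega>" for B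
    proof (intro equalityI subsetI)
      fix p assume "p \<in> type_action h -` B \<inter> ?\<Omega>"
      then have "p = type_action g (type_action h p)" "type_action h p \<in> B"
        using type_action_inverse[of p L M g h] h(3) by auto
      then show "p \<in> type_action g ` B" by blast
    next
      fix p assume "p \<in> type_action g ` B"
      then obtain q where q: "q \<in> B" "p = type_action g q" by blast
      then have "type_action h p = q" using type_action_inverse[of q L M h g] h(2) that by auto
      then show "p \<in> type_action h -` B \<inter> ?\<Omega>" using q that type_action_in[OF g] by auto
    qed
    have tc: "types_containing L M \<phi> \<subseteq> ?\<Omega>" for \<phi> by (auto simp: types_containing_def)
    have g\<phi>: "map_fm id g \<phi> \<in> x_formulas L (univ M)" if "\<phi> \<in> x_formulas L (univ M)" for \<phi>
      using that automorphismD(2)[OF g] by (intro map_fm_in_formulas) auto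
    have preA: "type_action h -` types_containing L M \<phi> \<inter> ?\<Omega> = types_containing L M (map_fm id g \<phi>)"
      if "\<phi> \<in> x_formulas L (univ M)" for \<phi>
      using pre[OF tc] type_action_types_containing[OF g that] by simp
    have meas: "type_action h \<in> measurable \<mu> \<mu>"
      by (rule measurable_sigma_sets[OF sets \<A>.space_closed])
        (use type_action_in[OF h(1)] sp preA keisler_measureD(3)[OF K g\<phi>] in auto)
    have "distr \<mu> \<mu> (type_action h) = \<mu>"
    proof (rule measure_eqI_generator_eq[where E = ?\<A> and \<Omega> = ?\<Omega> and A = "\<lambda>_. ?\<Omega>"])
      show "Int_stable ?\<A>" unfolding Int_stable_def using \<A>.Int by blast
      show "?\<A> \<subseteq> Pow ?\<Omega>" by (rule \<A>.space_closed)
      show "sets (distr \<mu> \<mu> (type_action h)) = sigma_sets ?\<Omega> ?\<A>" "sets \<mu> = sigma_sets ?\<Omega> ?\<A>"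
        using sets by auto
      show "range (\<lambda>_ :: nat. ?\<Omega>) \<subseteq> ?\<A>" using \<A>.top by auto
      show "emeasure (distr \<mu> \<mu> (type_action h)) ?\<Omega> \<noteq> \<infinity>"
        using meas sp by (subst emeasure_distr) (auto simp: sets.top[of \<mu>, unfolded sp])
      fix X assume "X \<in> ?\<A>"
      then obtain \<phi> where \<phi>: "\<phi> \<in> x_formulas L (univ M)" "X = types_containing L M \<phi>" by blast
      then show "emeasure (distr \<mu> \<mu> (type_action h)) X = emeasure \<mu> X"
        using meas keisler_measureD(3)[OF K \<phi>(1)] preA[OF \<phi>(1)] sp inv[OF g \<phi>(1)]
        by (simp add: emeasure_distr emeasure_eq_measure)
    qed simp
    then have "emeasure \<mu> A = emeasure (distr \<mu> \<mu> (type_action h)) A" by simp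
    also have "\<dots> = emeasure \<mu> (type_action h -` A \<inter> ?\<Omega>)" using meas A sp by (simp add: emeasure_distr)
    also have "\<dots> = emeasure \<mu> (type_action g ` A)"
      using pre sets.sets_into_space[OF A] sp by simp
    finally show ?thesis by simp
  qed
  then show ?thesis using K unfolding invariant_keisler_measure_def invariant_measure_def by blast
qed

section \<open>The random one-point extension\<close>

context homogeneous_structure
begin

abbreviation pat :: "'a set \<Rightarrow> 'a \<Rightarrow> ('r \<times> 'a tm list) set" where
  "pat \<equiv> pattern (\<lambda>a. a)"

lemma map_tm_ident [simp]: "map_tm (\<lambda>a. a) = (\<lambda>t. t)"
proof
  show "map_tm (\<lambda>a. a) t = t" for t :: "'c tm" by (cases t) auto
qed

lemma atoms_mono: "A \<subseteq> B \<Longrightarrow> atoms A \<subseteq> atoms B"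
  by (auto simp: atoms_def atom_lists_def)

lemma pattern_subset: "pattern f V c \<subseteq> atoms V"
  by (auto simp: pattern_def)

lemma pattern_restrict: "W \<subseteq> V \<Longrightarrow> pattern f W c = pattern f V c \<inter> atoms W"
  using atoms_mono[of W V] by (auto simp: pattern_def)

text \<open>An atom has \<open>k + 1\<close> distinct entries, one of them \<open>x\<close>, so it
  lives on a unique set of \<open>k\<close> parameters. A pattern is therefore determined by its
  restrictions to \<open>k\<close>-subsets.\<close>

lemma atoms_support:
  assumes "(R, ts) \<in> atoms V"
  obtains s where "s \<subseteq> V" "card s = k" "finite s" "(R, ts) \<in> atoms s" "\<And>W. (R, ts) \<in> atoms W \<Longrightarrow> s \<subseteq> W"
proof
  define s where "s = {a. Par a \<in> set ts}"
  have ts: "length ts = k + 1" "distinct ts" "Var 0 \<in> set ts" "set ts \<subseteq> insert (Var 0) (Par ` V)" "R \<in> dom L"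
    using assms by (auto simp: atoms_def atom_lists_def)
  have set_ts: "set ts = insert (Var 0) (Par ` s)" using ts by (auto simp: s_def)
  have fin: "finite (Par ` s :: 'b tm set)" using set_ts by (metis List.finite_set finite_insert)
  then show "finite s" by (rule finite_imageD) (auto intro: inj_onI)
  have "card (set ts) = Suc (card (Par ` s :: 'b tm set))" unfolding set_ts using fin by (subst card_insert_disjoint) auto
  moreover have "card (Par ` s :: 'b tm set) = card s" by (intro card_image inj_onI) auto
  ultimately show "card s = k" using distinct_card[OF ts(2)] ts(1) by simp
  show "(R, ts) \<in> atoms s" using ts set_ts by (auto simp: atoms_def atom_lists_def)
  show "s \<subseteq> W" if "(R, ts) \<in> atoms W" for W
    using that by (auto simp: atoms_def atom_lists_def s_def)
  then show "s \<subseteq> V" using assms by blast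
qed

lemma pattern_eqI:
  assumes "\<And>s. s \<subseteq> V \<Longrightarrow> card s = k \<Longrightarrow> finite s \<Longrightarrow> pattern f s c = pattern f s d"
  shows "pattern f V c = pattern f V d"
proof -
  have "(R, ts) \<in> pattern f V c \<longleftrightarrow> (R, ts) \<in> pattern f V d" for R ts
  proof (cases "(R, ts) \<in> atoms V")
    case True
    then obtain s where s: "s \<subseteq> V" "card s = k" "finite s" "(R, ts) \<in> atoms s" by (rule atoms_support)
    then show ?thesis using assms[OF s(1-3)] pattern_restrict[OF s(1), of f c] pattern_restrict[OF s(1), of f d] by blast
  qed (auto simp: pattern_def)
  then show ?thesis by auto
qed

lemma pat_automorphism:
  assumes A: "finite A" "A \<subseteq> univ M" and c: "c \<in> univ M" "c \<notin> A" and d: "d \<in> univ M" "d \<notin> A"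
    and eq: "pat A c = pat A d"
  obtains g where "automorphism M g" "\<And>a. a \<in> A \<Longrightarrow> g a = a" "g c = d"
  using pattern_automorphism[of A "\<lambda>a. a" "\<lambda>a. a" c d] assms by auto

text \<open>Induction on \<open>card A\<close>: for each \<open>a\<close> in \<open>A\<close> there
  is a point \<open>y a\<close> with the prescribed patterns over \<open>A - {a}\<close>. Such
  points over the proper subsets of \<open>A\<close> are the faces of an amalgamation problem,
  compatible because the prescription \<open>X\<close> is common to all. As
  \<open>card A > k\<close>, every \<open>k\<close>-subset lies in a proper face and keeps its
  pattern in the solution.\<close>

lemma mixed_realisation:
  assumes amalg: "\<And>n. n \<ge> 2 \<Longrightarrow> disjoint_amalgamation n (age L M)"
    and A: "finite A" "A \<subseteq> univ M"
    and X: "\<And>s. s \<subseteq> A \<Longrightarrow> card s = k \<Longrightarrow> X s \<in> univ M - s"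
  shows "\<exists>c \<in> univ M - A. \<forall>s. s \<subseteq> A \<longrightarrow> card s = k \<longrightarrow> pat s c = pat s (X s)"
  using A X
proof (induction "card A" arbitrary: A rule: less_induct)
  case less
  note A = less.prems(1,2) and X = less.prems(3)
  consider "card A < k" | "card A = k" | "card A > k" by linarith
  then show ?case
  proof cases
    case 1
    obtain c where c: "c \<in> univ M - A"
      using infinite_univ[OF amalg] A(1) by (metis Diff_eq_empty_iff all_not_in_conv finite_subset order_refl)
    have "card s \<noteq> k" if "s \<subseteq> A" for s using card_mono[OF A(1) that] 1 by simp
    then show ?thesis using c by blast
  next
    case 2
    have "s = A" if "s \<subseteq> A" "card s = k" for s using card_subset_eq[OF A(1) that(1)] that 2 by simp
    then show ?thesis using X[of A] 2 by (intro bexI[of _ "X A"]) auto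
  next
    case 3
    define n where "n = card A"
    have n: "n \<ge> 2" using 3 k_pos by (simp add: n_def)
    have "\<exists>c \<in> univ M - (A - {a}). \<forall>s. s \<subseteq> A - {a} \<longrightarrow> card s = k \<longrightarrow> pat s c = pat s (X s)"
      if "a \<in> A" for a
    proof (rule less.hyps)
      show "card (A - {a}) < card A" using that A(1) by (rule card_Diff1_less[rotated])
      show "finite (A - {a})" "A - {a} \<subseteq> univ M" using A by auto
      show "X s \<in> univ M - s" if "s \<subseteq> A - {a}" "card s = k" for s using X[of s] that by blast
    qed
    then obtain y where y: "\<And>a. a \<in> A \<Longrightarrow> y a \<in> univ M - (A - {a})"
      "\<And>a s. a \<in> A \<Longrightarrow> s \<subseteq> A - {a} \<Longrightarrow> card s = k \<Longrightarrow> pat s (y a) = pat s (X s)" by metis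
    obtain \<rho> where \<rho>: "bij_betw \<rho> {1..n} A" using ex_bij_betw_nat_finite_1[OF A(1)] by (auto simp: n_def)
    have \<rho>i: "inj_on \<rho> {1..n}" and \<rho>A: "\<rho> ` {1..n} = A" using \<rho> by (auto simp: bij_betw_def)
    \<comment> \<open>A proper face containing the label \<open>n + 1\<close> of the new point
      misses some label of \<open>A\<close>. The choice \<open>j I\<close> of such a label decides
      which point \<open>y\<close> that face uses.\<close>
    define j where "j I = (SOME j. j \<in> {1..n} - I)" for I :: "nat set"
    have j: "j I \<in> {1..n} - I" if "I \<subset> {1..n + 1}" "n + 1 \<in> I" for I
    proof -
      have "{1..n} - I \<noteq> {}"
      proof
        assume "{1..n} - I = {}"
        then have "{1..n + 1} \<subseteq> I" using that(2) by (auto simp: atLeastAtMostSuc_conv)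
        then show False using that(1) by blast
      qed
      then show ?thesis unfolding j_def by (metis all_not_in_conv someI_ex)
    qed
    have \<rho>j: "\<rho> (j I) \<in> A" "\<rho> ` (I \<inter> {1..n}) \<subseteq> A - {\<rho> (j I)}" if I: "I \<subset> {1..n + 1}" "n + 1 \<in> I" for I
    proof -
      note jI = j[OF I]
      then show "\<rho> (j I) \<in> A" using \<rho>A by blast
      show "\<rho> ` (I \<inter> {1..n}) \<subseteq> A - {\<rho> (j I)}"
      proof
        fix b assume "b \<in> \<rho> ` (I \<inter> {1..n})"
        then obtain v where v: "v \<in> I" "v \<in> {1..n}" "b = \<rho> v" by (elim imageE IntE) (rule that)
        have "v \<noteq> j I" "j I \<in> {1..n}" using v(1) jI by auto
        then have "\<rho> v \<noteq> \<rho> (j I)" using inj_onD[OF \<rho>i _ v(2)] by metis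
        moreover have "\<rho> v \<in> A" using \<rho>A v(2) by (metis imageI)
        ultimately show "b \<in> A - {\<rho> (j I)}" using v(3) by simp
      qed
    qed
    define e where "e I v = (if v = n + 1 then y (\<rho> (j I)) else \<rho> v)" for I v
    define K where "K i = {i}" for i :: nat
    have VI: "{1..0} \<union> \<Union> (K ` I) = I" for I by (auto simp: K_def)
    have split: "v = n + 1 \<or> v \<in> {1..n}" if "v \<in> {1..n + 1}" for v using that by auto
    have n1: "n + 1 \<notin> {1..n}" by simp
    show ?thesis
    \<comment> \<open>The base is empty, \<open>m = 0\<close>; each element of \<open>A\<close> and
      the new point form a block of their own.\<close>
    proof (rule amalgamate_maps[OF amalg, of "n + 1" K 0 e, unfolded VI])
      show "2 \<le> n + 1" "n + 1 \<ge> 1" using n by auto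
      show "finite (K i) \<and> K i \<noteq> {} \<and> K i \<inter> {1..0} = {}" for i by (simp add: K_def)
      show "disjoint_family_on K {1..n + 1}" by (auto simp: disjoint_family_on_def K_def)
      show "inj_on (e I) I \<and> e I ` I \<subseteq> univ M" if I: "I \<subset> {1..n + 1}" for I
      proof -
        have e\<rho>: "e I v = \<rho> v" if "v \<in> I \<inter> {1..n}" for v using that by (auto simp: e_def)
        have 1: "inj_on (e I) (I \<inter> {1..n})"
        proof -
          have "inj_on \<rho> (I \<inter> {1..n})" using \<rho>i by (rule inj_on_subset) simp
          moreover have "inj_on (e I) (I \<inter> {1..n}) \<longleftrightarrow> inj_on \<rho> (I \<inter> {1..n})" using e\<rho> by (rule inj_on_cong)
          ultimately show ?thesis by simp
        qed
        have img: "e I ` (I \<inter> {1..n}) = \<rho> ` (I \<inter> {1..n})" using e\<rho> by (rule image_cong[OF refl])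
        show ?thesis
        proof (cases "n + 1 \<in> I")
          case False
          then have "I \<inter> {1..n} = I" using I split by blast
          then show ?thesis using 1 img \<rho>A A by auto
        next
          case True
          then have I': "I = insert (n + 1) (I \<inter> {1..n})" using I split by blast
          have en: "e I (n + 1) = y (\<rho> (j I))" by (simp add: e_def)
          have "e I (n + 1) \<notin> \<rho> ` (I \<inter> {1..n})"
            unfolding en using y(1)[OF \<rho>j(1)[OF I True]] \<rho>j(2)[OF I True] by blast
          then have "inj_on (e I) (insert (n + 1) (I \<inter> {1..n}))"
            unfolding inj_on_insert using 1 img by auto
          moreover have "e I ` insert (n + 1) (I \<inter> {1..n}) \<subseteq> univ M"
            unfolding image_insert img en using y(1)[OF \<rho>j(1)[OF I True]] \<rho>A A(2) by blast
          ultimately show ?thesis using I' by metis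
        qed
      qed
      show "\<exists>g. automorphism M g \<and> (\<forall>v\<in>I \<inter> J. g (e I v) = e J v)"
        if I: "I \<subset> {1..n + 1}" and J: "J \<subset> {1..n + 1}" for I J
      proof (cases "n + 1 \<in> I \<inter> J")
        case False
        then have "e I v = e J v" if "v \<in> I \<inter> J" for v using that by (auto simp: e_def)
        then show ?thesis using automorphism_id by blast
      next
        case True
        then have nI: "n + 1 \<in> I" and nJ: "n + 1 \<in> J" by auto
        let ?B = "\<rho> ` (I \<inter> J \<inter> {1..n})"
        have BI: "?B \<subseteq> A - {\<rho> (j I)}" using \<rho>j(2)[OF I nI] by blast
        have BJ: "?B \<subseteq> A - {\<rho> (j J)}" using \<rho>j(2)[OF J nJ] by blast
        have yI: "y (\<rho> (j I)) \<in> univ M - (A - {\<rho> (j I)})" by (rule y(1)[OF \<rho>j(1)[OF I nI]])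
        have yJ: "y (\<rho> (j J)) \<in> univ M - (A - {\<rho> (j J)})" by (rule y(1)[OF \<rho>j(1)[OF J nJ]])
        \<comment> \<open>The two faces may use different points, but over the common part both have
          the patterns prescribed by \<open>X\<close>, hence they are conjugate over it.\<close>
        have "pat ?B (y (\<rho> (j I))) = pat ?B (y (\<rho> (j J)))"
        proof (rule pattern_eqI)
          fix s assume s: "s \<subseteq> ?B" "card s = k"
          have "pat s (y (\<rho> (j I))) = pat s (X s)"
            by (rule y(2)[OF \<rho>j(1)[OF I nI] _ s(2)]) (use s BI in blast)
          moreover have "pat s (y (\<rho> (j J))) = pat s (X s)"
            by (rule y(2)[OF \<rho>j(1)[OF J nJ] _ s(2)]) (use s BJ in blast)
          ultimately show "pat s (y (\<rho> (j I))) = pat s (y (\<rho> (j J)))" by simp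
        qed
        note eq = this
        have B: "finite ?B" "?B \<subseteq> univ M" using BI A by auto
        have "y (\<rho> (j I)) \<notin> ?B" "y (\<rho> (j J)) \<notin> ?B" using yI yJ BI BJ by blast+
        with eq obtain g where g: "automorphism M g" "\<And>a. a \<in> ?B \<Longrightarrow> g a = a" "g (y (\<rho> (j I))) = y (\<rho> (j J))"
          using pat_automorphism[OF B DiffD1[OF yI] _ DiffD1[OF yJ]] by metis
        have "g (e I v) = e J v" if "v \<in> I \<inter> J" for v
        proof (cases "v = n + 1")
          case False
          then have "v \<in> {1..n}" using that I split by blast
          then have "\<rho> v \<in> ?B" using that by blast
          then show ?thesis using g(2) False by (simp add: e_def)
        qed (simp add: e_def g(3))
        then show ?thesis using g(1) by blast
      qed
      fix f assume f: "inj_on f {1..n + 1}" "f ` {1..n + 1} \<subseteq> univ M"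
        and ext: "\<And>I. I \<subset> {1..n + 1} \<Longrightarrow> \<exists>g. automorphism M g \<and> (\<forall>v\<in>I. g (e I v) = f v)"
      have "{1..n} \<subset> {1..n + 1}" by auto
      from ext[OF this] obtain g where g: "automorphism M g" "\<And>v. v \<in> {1..n} \<Longrightarrow> g (e {1..n} v) = f v" by blast
      have g\<rho>: "g (\<rho> v) = f v" if "v \<in> {1..n}" for v using g(2)[OF that] that by (simp add: e_def)
      obtain w where w: "automorphism M w" "\<And>a. a \<in> univ M \<Longrightarrow> w (g a) = a"
        "\<And>a. a \<in> univ M \<Longrightarrow> g (w a) = a" using automorphism_inverse[OF g(1)] by metis
      have wf: "w (f v) = \<rho> v" if "v \<in> {1..n}" for v
      proof -
        have "\<rho> v \<in> univ M" using \<rho>A A(2) that by blast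
        then show ?thesis using w(2) g\<rho>[OF that] by metis
      qed
      define c where "c = w (f (n + 1))"
      have fn: "f (n + 1) \<in> univ M" using f(2) by auto
      have c: "c \<in> univ M" unfolding c_def using automorphism_in[OF w(1) fn] .
      have cA: "c \<notin> A"
      proof
        assume "c \<in> A"
        then obtain v where v: "v \<in> {1..n}" "c = \<rho> v" using \<rho>A by blast
        then have "g c = f v" using g\<rho> by simp
        moreover have "g c = f (n + 1)" unfolding c_def using w(3)[OF fn] .
        ultimately have "v = n + 1" using f(1) v(1) unfolding inj_on_def by auto
        then show False using v(1) by simp
      qed
      have "pat s c = pat s (X s)" if s: "s \<subseteq> A" "card s = k" for s
      proof -
        define I where "I = insert (n + 1) {v \<in> {1..n}. \<rho> v \<in> s}"
        have sI: "\<rho> ` (I \<inter> {1..n}) = s" using s(1) \<rho>A by (auto simp: I_def)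
        have "s \<noteq> A" using 3 s(2) by auto
        then obtain a where "a \<in> A" "a \<notin> s" using s(1) by blast
        then obtain v where "v \<in> {1..n}" "\<rho> v \<notin> s" using \<rho>A by blast
        then have "v \<in> {1..n + 1}" "v \<notin> I" by (auto simp: I_def)
        moreover have "I \<subseteq> {1..n + 1}" by (auto simp: I_def)
        ultimately have I: "I \<subset> {1..n + 1}" by blast
        have nI: "n + 1 \<in> I" by (simp add: I_def)
        from ext[OF I] obtain h where h: "automorphism M h" "\<And>v. v \<in> I \<Longrightarrow> h (e I v) = f v" by blast
        have hc: "w (h (y (\<rho> (j I)))) = c" using h(2)[OF nI] by (simp add: e_def c_def)
        have hs: "w (h a) = a" if as: "a \<in> s" for a
        proof -
          obtain v where v: "v \<in> I \<inter> {1..n}" "a = \<rho> v" using sI as by blast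
          then have "e I v = a" "v \<in> I" "v \<in> {1..n}" by (auto simp: e_def)
          then show ?thesis using h(2) wf v(2) by metis
        qed
        have "pat s (w (h (y (\<rho> (j I))))) = pat s (y (\<rho> (j I)))"
        proof (rule pattern_image[OF automorphism_comp[OF w(1) h(1)]])
          show "(\<lambda>a. a) ` s \<subseteq> univ M" using s A by auto
          show "y (\<rho> (j I)) \<in> univ M" using y(1)[OF \<rho>j(1)[OF I nI]] by blast
        qed (rule hs)
        also have "\<dots> = pat s (X s)"
          by (rule y(2)[OF \<rho>j(1)[OF I nI] _ s(2)]) (use \<rho>j(2)[OF I nI] sI in blast)
        finally show ?thesis unfolding hc .
      qed
      then show ?thesis using c cA by blast
    qed
  qed
qed

section \<open>The uniform distribution on realised patterns\<close>

definition realised :: "('r, 'a) fm \<Rightarrow> 'a set \<Rightarrow> ('r \<times> 'a tm list) set set" where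
  "realised \<phi> A = pat A ` {c \<in> univ M - A. satisfies M c \<phi>}"

text \<open>The probability of \<open>\<phi>\<close> when the pattern of \<open>x\<close> over
  \<open>A\<close> is drawn uniformly from the patterns of points outside \<open>A\<close>. It is
  meaningful when \<open>A\<close> contains the parameters of \<open>\<phi>\<close>.\<close>

definition weight :: "('r, 'a) fm \<Rightarrow> 'a set \<Rightarrow> real" where
  "weight \<phi> A = real (card (realised \<phi> A)) / real (card (realised truth A))"

lemma finite_realised: "finite A \<Longrightarrow> finite (realised \<phi> A)"
  unfolding realised_def
  by (rule finite_subset[of _ "Pow (atoms A)"])
    (auto simp: finite_atoms intro: pattern_subset[THEN subsetD])

text \<open>Points outside \<open>A\<close> with the same pattern over \<open>A\<close> are
  conjugate over \<open>A\<close> and cannot be told apart by formulas with parameters in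
  \<open>A\<close>, quantifiers included.\<close>

lemma satisfies_of_pat:
  assumes \<phi>: "\<phi> \<in> x_formulas L (univ M)" "params \<phi> \<subseteq> A" and A: "finite A" "A \<subseteq> univ M"
    and c: "c \<in> univ M - A" and d: "d \<in> univ M - A" and eq: "pat A c = pat A d"
  shows "satisfies M c \<phi> \<longleftrightarrow> satisfies M d \<phi>"
proof -
  obtain g where g: "automorphism M g" "\<And>a. a \<in> A \<Longrightarrow> g a = a" "g c = d"
    using pat_automorphism[OF A _ _ _ _ eq] c d by blast
  have "map_fm id g \<phi> = \<phi>" using g(2) \<phi>(2) by (intro map_fm_ident) auto
  then show ?thesis using satisfies_automorphism[OF g(1) \<phi>(1), of c] c g(3) by simp
qed

lemma realised_nonempty:
  assumes inf: "infinite (univ M)" and "finite A"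
  shows "realised truth A \<noteq> {}"
proof -
  have "univ M - A \<noteq> {}" using assms by (metis Diff_eq_empty_iff finite_subset)
  then show ?thesis by (auto simp: realised_def)
qed

text \<open>By \<open>mixed_realisation\<close>, a realised pattern over \<open>insert b A\<close>
  is an arbitrary pair of a realised pattern over \<open>A\<close> and a realised remainder. The
  number of remainders cancels in the quotient.\<close>

lemma weight_insert:
  assumes amalg: "\<And>n. n \<ge> 2 \<Longrightarrow> disjoint_amalgamation n (age L M)"
    and \<phi>: "\<phi> \<in> x_formulas L (univ M)" "params \<phi> \<subseteq> A" and A: "finite A" "A \<subseteq> univ M"
    and b: "b \<in> univ M" "b \<notin> A"
  shows "weight \<phi> (insert b A) = weight \<phi> A"
proof -
  let ?B = "insert b A"
  have B: "finite ?B" "?B \<subseteq> univ M" using A b by auto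
  have inf: "infinite (univ M)" using infinite_univ amalg by simp
  \<comment> \<open>The possible remainders: restrictions of patterns to the atoms that involve
    \<open>b\<close>.\<close>
  define N where "N = (\<lambda>c. pat ?B c - atoms A) ` (univ M - ?B)"
  have prod: "card (realised \<psi> ?B) = card (realised \<psi> A) * card N"
    if \<psi>: "\<psi> \<in> x_formulas L (univ M)" "params \<psi> \<subseteq> A" for \<psi>
  proof -
    let ?f = "\<lambda>P. (P \<inter> atoms A, P - atoms A)"
    have injf: "inj_on ?f (realised \<psi> ?B)" by (rule inj_onI) (metis Int_Diff_Un Pair_inject)
    have imf: "?f ` realised \<psi> ?B = realised \<psi> A \<times> N"
    proof (intro equalityI subsetI)
      fix z assume "z \<in> ?f ` realised \<psi> ?B"
      then obtain c where c: "c \<in> univ M - ?B" "satisfies M c \<psi>" "z = (pat ?B c \<inter> atoms A, pat ?B c - atoms A)"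
        by (auto simp: realised_def)
      then have "z = (pat A c, pat ?B c - atoms A)" using pattern_restrict[of A ?B] by auto
      then show "z \<in> realised \<psi> A \<times> N" using c by (auto simp: realised_def N_def)
    next
      fix z assume "z \<in> realised \<psi> A \<times> N"
      then obtain c d where c: "c \<in> univ M - A" "satisfies M c \<psi>" and d: "d \<in> univ M - ?B"
        and z: "z = (pat A c, pat ?B d - atoms A)" by (auto simp: realised_def N_def)
      \<comment> \<open>The \<open>k\<close>-sets inside \<open>A\<close> are prescribed by
        \<open>c\<close>, those containing \<open>b\<close> by \<open>d\<close>.\<close>
      define X where "X s = (if s \<subseteq> A then c else d)" for s
      have "X s \<in> univ M - s" if "s \<subseteq> ?B" for s using c d that by (auto simp: X_def)
      then obtain e where e: "e \<in> univ M - ?B" "\<And>s. s \<subseteq> ?B \<Longrightarrow> card s = k \<Longrightarrow> pat s e = pat s (X s)"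
        using mixed_realisation[OF amalg B, of X] by blast
      have eA: "pat A e = pat A c"
      proof (rule pattern_eqI)
        show "pat s e = pat s c" if s: "s \<subseteq> A" "card s = k" for s
          using e(2)[of s] s by (auto simp: X_def)
      qed
      have "pat ?B e - atoms A = pat ?B d - atoms A"
      proof -
        have "(R, ts) \<in> pat ?B e \<longleftrightarrow> (R, ts) \<in> pat ?B d" if nA: "(R, ts) \<notin> atoms A" for R ts
        proof (cases "(R, ts) \<in> atoms ?B")
          case True
          then obtain s where s: "s \<subseteq> ?B" "card s = k" "finite s" "(R, ts) \<in> atoms s" by (rule atoms_support)
          then have "\<not> s \<subseteq> A" using nA atoms_mono by blast
          then have "pat s e = pat s d" using e(2)[OF s(1,2)] by (simp add: X_def)
          then show ?thesis using s pattern_restrict[OF s(1), of "\<lambda>a. a"] by blast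
        qed (auto simp: pattern_def)
        then show ?thesis by auto
      qed
      moreover have "pat ?B e \<inter> atoms A = pat A c" using eA pattern_restrict[of A ?B] by auto
      moreover have "pat ?B e \<in> realised \<psi> ?B"
        using satisfies_of_pat[OF \<psi> A _ c(1) eA] e(1) c(2) by (auto simp: realised_def)
      ultimately show "z \<in> ?f ` realised \<psi> ?B" unfolding z by (intro image_eqI[of _ _ "pat ?B e"]) simp_all
    qed
    show ?thesis using card_image[OF injf] unfolding imf card_cartesian_product by simp
  qed
  have "N \<noteq> {}" using realised_nonempty[OF inf B(1)] by (auto simp: N_def realised_def)
  moreover have "finite N" unfolding N_def
    by (rule finite_subset[of _ "Pow (atoms ?B)"])
      (auto simp: finite_atoms[OF B(1)] intro: pattern_subset[THEN subsetD])
  ultimately have "card N > 0" by (simp add: card_gt_0_iff)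
  then show ?thesis unfolding weight_def using prod[OF \<phi>] prod[of truth] by simp
qed

text \<open>Formulas with different parameters can thus be weighed over one common finite
  set.\<close>

lemma weight_mono:
  assumes amalg: "\<And>n. n \<ge> 2 \<Longrightarrow> disjoint_amalgamation n (age L M)"
    and \<phi>: "\<phi> \<in> x_formulas L (univ M)" and B: "finite B" "params \<phi> \<subseteq> B" "B \<subseteq> univ M"
  shows "weight \<phi> B = weight \<phi> (params \<phi>)"
proof -
  have P: "params \<phi> \<subseteq> univ M" using B by blast
  have "weight \<phi> (params \<phi> \<union> C) = weight \<phi> (params \<phi>)" if "finite C" "C \<subseteq> univ M" for C
    using that
  proof induction
    case (insert b C)
    then show ?case
      using weight_insert[OF amalg \<phi>, of "params \<phi> \<union> C" b] P finite_params[of \<phi>]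
      by (cases "b \<in> params \<phi>") (auto simp: insert_absorb)
  qed simp
  from this[of B] show ?thesis using B by (simp add: Un_absorb1)
qed

lemma pattern_relabel:
  assumes g: "automorphism M g" and A: "A \<subseteq> univ M" and c: "c \<in> univ M"
  shows "pat (g ` A) (g c) = (\<lambda>(R, ts). (R, map (map_tm g) ts)) ` pat A c"
proof -
  have inj: "inj_on g A" using automorphismD(1)[OF g] A inj_on_subset by blast
  have injt: "inj_on (map_tm g) (insert (Var 0) (Par ` A))"
    using inj by (auto simp: inj_on_def)
  have g_pat: "pattern g A (g c) = pat A c"
    using pattern_image[OF g, of "\<lambda>a. a" A c g] A c by simp
  have "(R, us) \<in> pat (g ` A) (g c) \<longleftrightarrow> (\<exists>ts. us = map (map_tm g) ts \<and> (R, ts) \<in> pattern g A (g c))" for R us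
  proof
    assume us: "(R, us) \<in> pat (g ` A) (g c)"
    then have "set us \<subseteq> insert (Var 0) (Par ` g ` A)"
      by (auto simp: pattern_def atoms_def atom_lists_def)
    also have "\<dots> = map_tm g ` insert (Var 0) (Par ` A)" by (simp add: image_image)
    finally have "us \<in> lists (map_tm g ` insert (Var 0) (Par ` A))" by auto
    then obtain ts where ts: "set ts \<subseteq> insert (Var 0) (Par ` A)" "us = map (map_tm g) ts"
      unfolding lists_image by (auto simp: lists_eq_set)
    have "Var 0 \<in> set ts"
    proof -
      have "Var 0 \<in> set us" using us by (auto simp: pattern_def atoms_def atom_lists_def)
      then obtain t where t: "t \<in> set ts" "map_tm g t = Var 0" using ts(2) by (metis imageE list.set_map)
      have "t = Var 0" using t(2) by (cases t) auto
      then show ?thesis using t(1) by simp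
    qed
    then have "(R, ts) \<in> pattern g A (g c)"
      using us ts by (auto simp: pattern_def atoms_def atom_lists_def distinct_map comp_def)
    then show "\<exists>ts. us = map (map_tm g) ts \<and> (R, ts) \<in> pattern g A (g c)" using ts(2) by blast
  next
    assume "\<exists>ts. us = map (map_tm g) ts \<and> (R, ts) \<in> pattern g A (g c)"
    then obtain ts where ts: "us = map (map_tm g) ts" "(R, ts) \<in> pattern g A (g c)" by blast
    then have sub: "set ts \<subseteq> insert (Var 0) (Par ` A)" and dist: "distinct ts"
      by (auto simp: pattern_def atoms_def atom_lists_def)
    have "distinct us" unfolding ts(1) distinct_map using dist sub injt inj_on_subset by blast
    moreover have "Var 0 \<in> set us" using ts by (force simp: pattern_def atoms_def atom_lists_def)
    moreover have "set us \<subseteq> insert (Var 0) (Par ` g ` A)" using sub ts(1) by auto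
    ultimately show "(R, us) \<in> pat (g ` A) (g c)"
      using ts by (auto simp: pattern_def atoms_def atom_lists_def comp_def)
  qed
  then show ?thesis unfolding g_pat by auto
qed

lemma weight_automorphism:
  assumes g: "automorphism M g" and \<phi>: "\<phi> \<in> x_formulas L (univ M)" and A: "A \<subseteq> univ M"
  shows "weight (map_fm id g \<phi>) (g ` A) = weight \<phi> A"
proof -
  let ?T = "\<lambda>(R, ts). (R, map (map_tm g) ts) :: 'r \<times> 'a tm list"
  have inj: "inj_on g A" using automorphismD(1)[OF g] A inj_on_subset by blast
  have injt: "inj_on (map_tm g) (insert (Var 0) (Par ` A))"
    using inj by (auto simp: inj_on_def)
  have T: "inj_on ?T (atoms A)"
  proof (rule inj_onI)
    fix x y assume "x \<in> atoms A" "y \<in> atoms A" "?T x = ?T y"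
    then obtain R ts us where *: "x = (R, ts)" "y = (R, us)" "map (map_tm g) ts = map (map_tm g) us"
      "set ts \<union> set us \<subseteq> insert (Var 0) (Par ` A)"
      by (cases x, cases y) (auto simp: atoms_def atom_lists_def)
    have "ts = us" by (rule map_inj_on[OF *(3) inj_on_subset[OF injt *(4)]])
    then show "x = y" using * by simp
  qed
  have card: "card (realised (map_fm id g \<psi>) (g ` A)) = card (realised \<psi> A)"
    if \<psi>: "\<psi> \<in> x_formulas L (univ M)" for \<psi>
  proof -
    have "{d \<in> univ M - g ` A. satisfies M d (map_fm id g \<psi>)} = g ` {c \<in> univ M - A. satisfies M c \<psi>}"
    proof (intro equalityI subsetI)
      fix d assume d: "d \<in> {d \<in> univ M - g ` A. satisfies M d (map_fm id g \<psi>)}"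
      then have "d \<in> g ` univ M" using automorphismD(2)[OF g] by simp
      then obtain c where c: "c \<in> univ M" "d = g c" by (elim imageE) (rule that)
      then have "satisfies M c \<psi>" "c \<notin> A" using d satisfies_automorphism[OF g \<psi> c(1)] by auto
      then show "d \<in> g ` {c \<in> univ M - A. satisfies M c \<psi>}" using c by simp
    next
      fix d assume "d \<in> g ` {c \<in> univ M - A. satisfies M c \<psi>}"
      then obtain c where c: "c \<in> univ M" "c \<notin> A" "satisfies M c \<psi>" "d = g c" by blast
      have "g c \<notin> g ` A" using inj_on_image_mem_iff[OF automorphismD(1)[OF g] c(1) A] c(2) by simp
      then show "d \<in> {d \<in> univ M - g ` A. satisfies M d (map_fm id g \<psi>)}"
        using c automorphism_in[OF g c(1)] satisfies_automorphism[OF g \<psi> c(1)] by simp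
    qed
    then have "realised (map_fm id g \<psi>) (g ` A) = (`) ?T ` realised \<psi> A"
      unfolding realised_def image_image using pattern_relabel[OF g A] by (auto simp: image_image intro!: image_cong)
    moreover have "inj_on ((`) ?T) (realised \<psi> A)"
      by (rule inj_on_subset[OF inj_on_image_Pow[OF T]]) (use pattern_subset in \<open>auto simp: realised_def\<close>)
    ultimately show ?thesis by (simp add: card_image)
  qed
  show ?thesis unfolding weight_def using card[OF \<phi>] card[of truth] by simp
qed

lemma random_measure_exists:
  assumes amalg: "\<And>n. n \<ge> 2 \<Longrightarrow> disjoint_amalgamation n (age L M)"
  obtains \<mu> where "invariant_keisler_measure L M \<mu>"
    "\<And>\<phi>. \<phi> \<in> x_formulas L (univ M) \<Longrightarrow> infinite (defined_set M \<phi>) \<Longrightarrow>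
      measure \<mu> (types_containing L M \<phi>) > 0"
proof -
  have cnt: "countable (x_formulas L (univ M))"
    by (rule countable_formulas[OF finite_language countable_univ])
  have inf: "infinite (univ M)" using infinite_univ amalg by simp
  have pos: "card (realised truth A) > 0" if "finite A" for A
    using finite_realised[OF that] realised_nonempty[OF inf that] by (simp add: card_gt_0_iff)
  define \<nu> where "\<nu> \<phi> = weight \<phi> (params \<phi>)" for \<phi>
  have P: "params \<phi> \<subseteq> univ M" if "\<phi> \<in> x_formulas L (univ M)" for \<phi> using that by (simp add: formulas_def)
  obtain \<mu> where \<mu>: "keisler_measure L M \<mu>"
    "\<And>\<phi>. \<phi> \<in> x_formulas L (univ M) \<Longrightarrow> measure \<mu> (types_containing L M \<phi>) = \<nu> \<phi>"
  proof (rule keisler_measure_exists[OF cnt, of \<nu>])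
    show "0 \<le> \<nu> \<phi>" for \<phi> by (simp add: \<nu>_def weight_def)
    show "\<nu> truth = 1" using pos[of "{}"] by (simp add: \<nu>_def weight_def)
    fix \<phi> \<psi> \<theta>
    assume F: "\<phi> \<in> x_formulas L (univ M)" "\<psi> \<in> x_formulas L (univ M)" "\<theta> \<in> x_formulas L (univ M)"
      and disj: "\<And>a. a \<in> univ M \<Longrightarrow> \<not> (satisfies M a \<phi> \<and> satisfies M a \<psi>)"
      and un: "\<And>a. a \<in> univ M \<Longrightarrow> satisfies M a \<theta> \<longleftrightarrow> satisfies M a \<phi> \<or> satisfies M a \<psi>"
    \<comment> \<open>Over all the parameters involved, disjoint formulas have disjoint sets of
      realised patterns, so cardinalities add.\<close>
    let ?B = "params \<phi> \<union> params \<psi> \<union> params \<theta>"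
    have B: "finite ?B" "?B \<subseteq> univ M" using finite_params F P by auto
    have "realised \<theta> ?B = realised \<phi> ?B \<union> realised \<psi> ?B"
      using un by (auto simp: realised_def)
    moreover have "realised \<phi> ?B \<inter> realised \<psi> ?B = {}"
    proof -
      have "pat ?B c \<noteq> pat ?B d" if c: "c \<in> univ M - ?B" "satisfies M c \<phi>" and d: "d \<in> univ M - ?B" "satisfies M d \<psi>" for c d
      proof
        assume "pat ?B c = pat ?B d"
        then have "satisfies M c \<psi>" using satisfies_of_pat[OF F(2) _ B c(1) d(1)] d(2) by blast
        then show False using disj c by blast
      qed
      then show ?thesis unfolding realised_def by blast
    qed
    ultimately have "card (realised \<theta> ?B) = card (realised \<phi> ?B) + card (realised \<psi> ?B)"
      using finite_realised[OF B(1)] by (simp add: card_Un_disjoint)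
    then have "weight \<theta> ?B = weight \<phi> ?B + weight \<psi> ?B" by (simp add: weight_def add_divide_distrib)
    moreover have "weight \<theta> ?B = \<nu> \<theta>" "weight \<phi> ?B = \<nu> \<phi>" "weight \<psi> ?B = \<nu> \<psi>"
      unfolding \<nu>_def using F B by (auto intro!: weight_mono[OF amalg])
    ultimately show "\<nu> \<theta> = \<nu> \<phi> + \<nu> \<psi>" by simp
  qed blast
  have "invariant_keisler_measure L M \<mu>"
  proof (rule invariant_measureI[OF cnt \<mu>(1)])
    fix g \<phi> assume g: "automorphism M g" and \<phi>: "\<phi> \<in> x_formulas L (univ M)"
    have "map_fm id g \<phi> \<in> x_formulas L (univ M)"
      using \<phi> automorphismD(2)[OF g] by (intro map_fm_in_formulas) auto
    moreover have "\<nu> (map_fm id g \<phi>) = \<nu> \<phi>"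
      unfolding \<nu>_def using weight_automorphism[OF g \<phi> P[OF \<phi>]] by (simp add: fm.set_map)
    ultimately show "measure \<mu> (types_containing L M (map_fm id g \<phi>)) = measure \<mu> (types_containing L M \<phi>)"
      using \<mu>(2) \<phi> by simp
  qed
  moreover have "measure \<mu> (types_containing L M \<phi>) > 0"
    if \<phi>: "\<phi> \<in> x_formulas L (univ M)" and inf\<phi>: "infinite (defined_set M \<phi>)" for \<phi>
  proof -
    \<comment> \<open>An infinite definable set has a solution outside the parameters, hence at
      least one realised pattern and positive weight.\<close>
    obtain c where "c \<in> defined_set M \<phi>" "c \<notin> params \<phi>"
      using inf\<phi> finite_params[of \<phi>] by (meson finite_subset subsetI)
    then have "realised \<phi> (params \<phi>) \<noteq> {}" by (auto simp: realised_def defined_set_def)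
    then have "card (realised \<phi> (params \<phi>)) > 0"
      using finite_realised[OF finite_params] by (simp add: card_gt_0_iff)
    then have "\<nu> \<phi> > 0" unfolding \<nu>_def weight_def
      using pos[OF finite_params] by (intro divide_pos_pos) simp_all
    then show ?thesis using \<mu>(2)[OF \<phi>] by simp
  qed
  ultimately show ?thesis using that by blast
qed

end

section \<open>Forking\<close>

fun conjs :: "('r, 'c) fm list \<Rightarrow> ('r, 'c) fm" where
  "conjs [] = truth"
| "conjs (\<phi> # \<phi>s) = Conj \<phi> (conjs \<phi>s)"

lemma sat_conjs: "sat M \<sigma> (conjs \<phi>s) \<longleftrightarrow> (\<forall>\<phi> \<in> set \<phi>s. sat M \<sigma> \<phi>)"
  by (induction \<phi>s) (auto simp: truth_def)

lemma satisfies_conjs [simp]: "satisfies M a (conjs \<phi>s) \<longleftrightarrow> (\<forall>\<phi> \<in> set \<phi>s. satisfies M a \<phi>)"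
  by (simp add: satisfies_def sat_conjs)

lemma conjs_in_formulas:
  "0 \<in> X \<Longrightarrow> set \<phi>s \<subseteq> formulas L X C \<Longrightarrow> conjs \<phi>s \<in> formulas L X C"
proof (induction \<phi>s)
  case Nil
  then show ?case by (auto simp: truth_def formulas_def)
qed auto

lemma map_fm_conjs: "map_fm id g (conjs \<phi>s) = conjs (map (map_fm id g) \<phi>s)"
  by (induction \<phi>s) (auto simp: truth_def)

fun exs :: "nat list \<Rightarrow> ('r, 'c) fm \<Rightarrow> ('r, 'c) fm" where
  "exs [] \<phi> = \<phi>"
| "exs (v # vs) \<phi> = Ex v (exs vs \<phi>)"

lemma sat_exs:
  "sat M \<sigma> (exs vs \<phi>) \<longleftrightarrow>
    (\<exists>\<tau>. (\<forall>v \<in> set vs. \<tau> v \<in> univ M) \<and> (\<forall>v. v \<notin> set vs \<longrightarrow> \<tau> v = \<sigma> v) \<and> sat M \<tau> \<phi>)"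
proof (induction vs arbitrary: \<sigma>)
  case Nil
  have "\<tau> = \<sigma>" if "\<forall>v. \<tau> v = \<sigma> v" for \<tau> using that by auto
  then show ?case by auto
next
  case (Cons v vs)
  show ?case
  proof
    assume "sat M \<sigma> (exs (v # vs) \<phi>)"
    then obtain a \<tau> where a: "a \<in> univ M" "\<forall>w \<in> set vs. \<tau> w \<in> univ M"
      "\<forall>w. w \<notin> set vs \<longrightarrow> \<tau> w = (\<sigma>(v := a)) w" "sat M \<tau> \<phi>"
      by (auto simp: Cons.IH)
    then have "\<tau> v \<in> univ M" by (cases "v \<in> set vs") auto
    then show "\<exists>\<tau>. (\<forall>w \<in> set (v # vs). \<tau> w \<in> univ M) \<and> (\<forall>w. w \<notin> set (v # vs) \<longrightarrow> \<tau> w = \<sigma> w) \<and> sat M \<tau> \<phi>"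
      using a by (intro exI[of _ \<tau>]) auto
  next
    assume "\<exists>\<tau>. (\<forall>w \<in> set (v # vs). \<tau> w \<in> univ M) \<and> (\<forall>w. w \<notin> set (v # vs) \<longrightarrow> \<tau> w = \<sigma> w) \<and> sat M \<tau> \<phi>"
    then obtain \<tau> where \<tau>: "\<forall>w \<in> set (v # vs). \<tau> w \<in> univ M" "\<forall>w. w \<notin> set (v # vs) \<longrightarrow> \<tau> w = \<sigma> w" "sat M \<tau> \<phi>"
      by blast
    then have "sat M (\<sigma>(v := \<tau> v)) (exs vs \<phi>)"
      unfolding Cons.IH by (intro exI[of _ \<tau>]) auto
    then show "sat M \<sigma> (exs (v # vs) \<phi>)" using \<tau> by auto
  qed
qed

fun subst_tm :: "('c \<Rightarrow> 'd tm) \<Rightarrow> 'c tm \<Rightarrow> 'd tm" where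
  "subst_tm u (Var i) = Var i"
| "subst_tm u (Par c) = u c"

text \<open>Serves to replace parameters by free variables that can then be quantified. Bound
  variables are not renamed, so \<open>sat_subst\<close> asks that the substituted variables avoid
  \<open>bound_vars\<close>.\<close>

fun subst_fm :: "('c \<Rightarrow> 'd tm) \<Rightarrow> ('r, 'c) fm \<Rightarrow> ('r, 'd) fm" where
  "subst_fm u (Rel R ts) = Rel R (map (subst_tm u) ts)"
| "subst_fm u (Eq s t) = Eq (subst_tm u s) (subst_tm u t)"
| "subst_fm u (Neg \<phi>) = Neg (subst_fm u \<phi>)"
| "subst_fm u (Conj \<phi> \<psi>) = Conj (subst_fm u \<phi>) (subst_fm u \<psi>)"
| "subst_fm u (Ex i \<phi>) = Ex i (subst_fm u \<phi>)"

fun bound_vars :: "('r, 'c) fm \<Rightarrow> nat set" where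
  "bound_vars (Rel R ts) = {}"
| "bound_vars (Eq s t) = {}"
| "bound_vars (Neg \<phi>) = bound_vars \<phi>"
| "bound_vars (Conj \<phi> \<psi>) = bound_vars \<phi> \<union> bound_vars \<psi>"
| "bound_vars (Ex i \<phi>) = insert i (bound_vars \<phi>)"

lemma finite_bound_vars: "finite (bound_vars \<phi>)"
  by (induction \<phi>) auto

lemma well_formed_subst [simp]: "well_formed L (subst_fm u \<phi>) = well_formed L \<phi>"
  by (induction \<phi>) auto

lemma params_subst: "params (subst_fm u \<phi>) \<subseteq> (\<Union>c \<in> params \<phi>. set_tm (u c))"
proof (induction \<phi>)
  case (Rel R ts)
  have "set_tm (subst_tm u t) \<subseteq> (\<Union>c \<in> set_tm t. set_tm (u c))" for t by (cases t) auto
  then show ?case by fastforce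
next
  case (Eq s t)
  have "set_tm (subst_tm u t) \<subseteq> (\<Union>c \<in> set_tm t. set_tm (u c))" for t by (cases t) auto
  then show ?case by fastforce
qed auto

lemma tm_val_subst:
  "(\<And>c. c \<in> set_tm t \<Longrightarrow> tm_val \<sigma> (u c) = h c) \<Longrightarrow> tm_val \<sigma> (subst_tm u t) = tm_val \<sigma> (map_tm h t)"
  by (cases t) auto

lemma sat_subst:
  "(\<And>c. c \<in> params \<phi> \<Longrightarrow> tm_val \<sigma> (u c) = h c) \<Longrightarrow>
   (\<And>c. c \<in> params \<phi> \<Longrightarrow> tm_vars (u c) \<inter> bound_vars \<phi> = {}) \<Longrightarrow>
   sat M \<sigma> (subst_fm u \<phi>) \<longleftrightarrow> sat M \<sigma> (map_fm id h \<phi>)"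
proof (induction \<phi> arbitrary: \<sigma>)
  case (Rel R ts)
  have "map (tm_val \<sigma>) (map (subst_tm u) ts) = map (tm_val \<sigma>) (map (map_tm h) ts)"
    using Rel by (auto intro!: tm_val_subst)
  then show ?case by (metis fm.map(1) id_apply sat.simps(1) subst_fm.simps(1))
next
  case (Eq s t)
  then show ?case using tm_val_subst[of s \<sigma> u h] tm_val_subst[of t \<sigma> u h] by simp
next
  case (Neg \<phi>)
  then show ?case by simp
next
  case (Conj \<phi> \<psi>)
  have "sat M \<sigma> (subst_fm u \<phi>) \<longleftrightarrow> sat M \<sigma> (map_fm id h \<phi>)"
    by (rule Conj.IH(1)) (use Conj.prems in auto)
  moreover have "sat M \<sigma> (subst_fm u \<psi>) \<longleftrightarrow> sat M \<sigma> (map_fm id h \<psi>)"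
    by (rule Conj.IH(2)) (use Conj.prems in auto)
  ultimately show ?case by (simp add: id_def)
next
  case (Ex i \<phi>)
  have "sat M (\<sigma>(i := a)) (subst_fm u \<phi>) \<longleftrightarrow> sat M (\<sigma>(i := a)) (map_fm id h \<phi>)" for a
  proof (rule Ex.IH)
    fix c assume c: "c \<in> params \<phi>"
    then have "i \<notin> tm_vars (u c)" using Ex.prems(2)[of c] by auto
    then have "tm_val (\<sigma>(i := a)) (u c) = tm_val \<sigma> (u c)" by (intro tm_val_cong) auto
    then show "tm_val (\<sigma>(i := a)) (u c) = h c" using Ex.prems(1)[of c] c by simp
    show "tm_vars (u c) \<inter> bound_vars \<phi> = {}" using Ex.prems(2)[of c] c by auto
  qed
  then show ?case by (simp add: id_def)
qed

lemma true_in_sentence: "free_vars \<phi> = {} \<Longrightarrow> true_in M \<phi> \<longleftrightarrow> sat M \<sigma> \<phi>"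
  unfolding true_in_def using sat_cong[of \<phi>] by (metis empty_iff)

lemma true_in_Ex:
  assumes "free_vars \<psi> \<subseteq> {0}"
  shows "true_in M (Ex 0 \<psi>) \<longleftrightarrow> (\<exists>a \<in> univ M. satisfies M a \<psi>)"
proof -
  have "true_in M (Ex 0 \<psi>) \<longleftrightarrow> sat M \<sigma> (Ex 0 \<psi>)" for \<sigma>
    using assms by (intro true_in_sentence) auto
  then show ?thesis using satisfies_sat[OF assms] by simp
qed

lemma Ex_in_sentences: "\<psi> \<in> x_formulas L C \<Longrightarrow> Ex 0 \<psi> \<in> sentences L C"
  by (auto simp: formulas_def)

lemma elementary_true_in:
  assumes ee: "elementary_extension L M N" and ne: "univ M \<noteq> {}" and \<phi>: "\<phi> \<in> sentences L (univ M)"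
  shows "true_in M \<phi> \<longleftrightarrow> true_in N \<phi>"
proof -
  obtain m where m: "m \<in> univ M" using ne by blast
  have "\<phi> \<in> formulas L UNIV (univ M)" using \<phi> by (auto simp: formulas_def)
  then have "sat M (\<lambda>_. m) \<phi> \<longleftrightarrow> sat N (\<lambda>_. m) \<phi>" using ee m by (auto simp: elementary_extension_def)
  moreover have "free_vars \<phi> = {}" using \<phi> by (simp add: formulas_def)
  ultimately show ?thesis using true_in_sentence by metis
qed

text \<open>The truth values of finitely many sentences with parameters in \<open>N\<close> are one
  existential statement over \<open>M\<close>, the parameters outside \<open>M\<close> being
  quantified; elementarity provides witnesses in \<open>M\<close>. The map \<open>h\<close> need not
  be injective unless equalities are among the sentences.\<close>

lemma finite_transfer:
  assumes ee: "elementary_extension L M N" and ne: "univ M \<noteq> {}"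
    and \<Phi>: "finite \<Phi>" "\<Phi> \<subseteq> sentences L (univ N)"
  obtains h where "\<And>a. a \<in> univ M \<Longrightarrow> h a = a" "\<And>a. h a \<in> univ M"
    "\<And>\<phi>. \<phi> \<in> \<Phi> \<Longrightarrow> true_in N \<phi> \<longleftrightarrow> true_in M (map_fm id h \<phi>)"
proof -
  obtain m where m: "m \<in> univ M" using ne by blast
  have MN: "univ M \<subseteq> univ N" using ee by (simp add: elementary_extension_def)
  define B where "B = (\<Union>\<phi>\<in>\<Phi>. params \<phi>) - univ M"
  have B: "finite B" "B \<subseteq> univ N" using \<Phi> finite_params by (auto simp: B_def formulas_def)
  obtain f where f: "bij_betw f B {0..<card B}" using ex_bij_betw_finite_nat[OF B(1)] by blast
  \<comment> \<open>All bound variables lie below \<open>n\<close>, so the variables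
    \<open>n + f c\<close> introduced for parameters are not captured.\<close>
  define n where "n = Suc (Max (insert 0 (\<Union>\<phi>\<in>\<Phi>. bound_vars \<phi>)))"
  have n: "i < n" if "\<phi> \<in> \<Phi>" "i \<in> bound_vars \<phi>" for \<phi> i
  proof -
    have "i \<le> Max (insert 0 (\<Union>\<phi>\<in>\<Phi>. bound_vars \<phi>))"
      using \<Phi>(1) finite_bound_vars that by (intro Max_ge) auto
    then show ?thesis by (simp add: n_def)
  qed
  define u where "u c = (if c \<in> univ M then Par c else Var (n + f c))" for c
  define vs where "vs = [n..<n + card B]"
  have ub: "tm_vars (u c) \<inter> bound_vars \<phi> = {}" if "\<phi> \<in> \<Phi>" for \<phi> c
    using n[OF that, of "n + f c"] by (auto simp: u_def)
  have fv: "free_vars \<phi> = {}" if "\<phi> \<in> \<Phi>" for \<phi> using \<Phi>(2) that by (auto simp: formulas_def)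
  have parB: "c \<in> univ M \<or> c \<in> B" if "\<phi> \<in> \<Phi>" "c \<in> params \<phi>" for \<phi> c using that by (auto simp: B_def)
  obtain \<phi>s where \<phi>s: "set \<phi>s = \<Phi>" using finite_list[OF \<Phi>(1)] by blast
  \<comment> \<open>Sentences false in \<open>N\<close> enter negated, so that truth values are
    preserved in both directions.\<close>
  define lit where "lit \<phi> = (if true_in N \<phi> then subst_fm u \<phi> else Neg (subst_fm u \<phi>))" for \<phi>
  define \<Psi> where "\<Psi> = exs vs (conjs (map lit \<phi>s))"
  have wf: "well_formed L \<Psi>" and pars: "params \<Psi> \<subseteq> univ M"
  proof -
    have lit: "well_formed L (lit \<phi>)" "params (lit \<phi>) \<subseteq> univ M" if "\<phi> \<in> \<Phi>" for \<phi>
    proof -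
      show "well_formed L (lit \<phi>)" using \<Phi>(2) that by (auto simp: lit_def formulas_def)
      have "set_tm (u c) \<subseteq> univ M" for c by (auto simp: u_def)
      then have "params (subst_fm u \<phi>) \<subseteq> univ M" using params_subst[of u \<phi>] by fastforce
      then show "params (lit \<phi>) \<subseteq> univ M" by (simp add: lit_def)
    qed
    have exs: "well_formed L (exs ws \<psi>) = well_formed L \<psi>" "params (exs ws \<psi>) = params \<psi>"
      for ws and \<psi> :: "('a, 'b) fm"
      by (induction ws) auto
    have conjs: "well_formed L (conjs xs)" "params (conjs xs) \<subseteq> univ M"
      if "\<And>x. x \<in> set xs \<Longrightarrow> well_formed L x \<and> params x \<subseteq> univ M" for xs
      using that by (induction xs) (auto simp: truth_def)
    have lits: "well_formed L x \<and> params x \<subseteq> univ M" if "x \<in> set (map lit \<phi>s)" for x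
      using that lit by (auto simp: \<phi>s)
    show "well_formed L \<Psi>" "params \<Psi> \<subseteq> univ M"
      unfolding \<Psi>_def exs by (rule conjs[OF lits], assumption)+
  qed
  define \<tau> where "\<tau> v = (if v \<in> set vs then inv_into B f (v - n) else m)" for v
  have \<tau>B: "\<tau> (n + f c) = c" "n + f c \<in> set vs" if "c \<in> B" for c
  proof -
    have "f c < card B" using f that by (auto simp: bij_betw_def)
    then show "n + f c \<in> set vs" by (simp add: vs_def)
    then show "\<tau> (n + f c) = c" using f that by (simp add: \<tau>_def bij_betw_def)
  qed
  have "sat N \<tau> (lit \<phi>)" if \<phi>: "\<phi> \<in> \<Phi>" for \<phi>
  proof -
    have "sat N \<tau> (subst_fm u \<phi>) \<longleftrightarrow> sat N \<tau> (map_fm id (\<lambda>c. c) \<phi>)"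
    proof (rule sat_subst)
      show "tm_val \<tau> (u c) = c" if "c \<in> params \<phi>" for c
        using parB[OF \<phi> that] \<tau>B(1)[of c] by (auto simp: u_def B_def)
    qed (rule ub[OF \<phi>])
    also have "map_fm id (\<lambda>c. c) \<phi> = \<phi>" by (rule map_fm_ident) simp
    finally show ?thesis using true_in_sentence[OF fv[OF \<phi>], of N \<tau>] by (simp add: lit_def)
  qed
  moreover have "\<tau> v \<in> univ N" if "v \<in> set vs" for v
  proof -
    have "v - n \<in> f ` B" using f that by (auto simp: bij_betw_def vs_def)
    then have "inv_into B f (v - n) \<in> B" by (rule inv_into_into)
    then show ?thesis using B(2) that by (auto simp: \<tau>_def)
  qed
  ultimately have "sat N (\<lambda>_. m) \<Psi>"
    unfolding \<Psi>_def sat_exs sat_conjs by (intro exI[of _ \<tau>]) (auto simp: \<phi>s \<tau>_def)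
  moreover have "\<Psi> \<in> formulas L UNIV (univ M)" using wf pars by (simp add: formulas_def)
  ultimately have "sat M (\<lambda>_. m) \<Psi>" using ee m by (auto simp: elementary_extension_def)
  then obtain \<tau>' where \<tau>': "\<And>v. v \<in> set vs \<Longrightarrow> \<tau>' v \<in> univ M" "\<And>\<phi>. \<phi> \<in> \<Phi> \<Longrightarrow> sat M \<tau>' (lit \<phi>)"
    unfolding \<Psi>_def sat_exs sat_conjs by (auto simp: \<phi>s)
  define h where "h c = (if c \<in> univ M \<union> B then tm_val \<tau>' (u c) else m)" for c
  show ?thesis
  proof (rule that)
    show "h a = a" if "a \<in> univ M" for a using that by (simp add: h_def u_def)
    show "h a \<in> univ M" for a using m \<tau>'(1) \<tau>B(2) by (auto simp: h_def u_def)
    fix \<phi> assume \<phi>: "\<phi> \<in> \<Phi>"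
    have "sat M \<tau>' (subst_fm u \<phi>) \<longleftrightarrow> sat M \<tau>' (map_fm id h \<phi>)"
      by (rule sat_subst[OF _ ub[OF \<phi>]]) (use parB[OF \<phi>] in \<open>auto simp: h_def\<close>)
    moreover have "true_in M (map_fm id h \<phi>) \<longleftrightarrow> sat M \<tau>' (map_fm id h \<phi>)"
      using fv[OF \<phi>] by (intro true_in_sentence) simp
    ultimately show "true_in N \<phi> \<longleftrightarrow> true_in M (map_fm id h \<phi>)"
      using \<tau>'(2)[OF \<phi>] by (auto simp: lit_def split: if_splits)
  qed
qed

text \<open>By Ramsey's theorem some infinite subsequence has the same coincidences between
  positions for every pair of indices in increasing order. This makes it a sunflower: a value shared
  by two different tuples sits at a position that is constant along the subsequence.\<close>

lemma uniform_coincidences: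
  fixes bs :: "nat \<Rightarrow> 'a list"
  obtains Y :: "nat set" where "infinite Y"
    "\<And>i j s u l. i \<in> Y \<Longrightarrow> j \<in> Y \<Longrightarrow> i \<noteq> j \<Longrightarrow> s < n \<Longrightarrow> u < n \<Longrightarrow> bs i ! s = bs j ! u \<Longrightarrow> l \<in> Y \<Longrightarrow>
      bs l ! s = bs i ! s"
proof -
  let ?P = "Pow ({..<n} \<times> {..<n})"
  obtain code where code: "bij_betw code ?P {0..<card ?P}"
    using ex_bij_betw_finite_nat[of ?P] by auto
  \<comment> \<open>The colour of a pair is its set of coinciding positions; \<open>Min\<close> and
    \<open>Max\<close> order the pair, and \<open>code\<close> makes the colour a number.\<close>
  define rel where "rel i j = {(s, u). s < n \<and> u < n \<and> bs i ! s = bs j ! u}" for i j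
  have rel: "rel i j \<in> ?P" for i j by (auto simp: rel_def)
  have "\<forall>x\<in>UNIV. \<forall>y\<in>UNIV. x \<noteq> y \<longrightarrow> code (rel (Min {x, y}) (Max {x, y})) < card ?P"
    using code rel by (auto simp: bij_betw_def)
  from Ramsey2[OF infinite_UNIV_nat, where f = "\<lambda>X. code (rel (Min X) (Max X))", OF this]
  obtain Y t where Y: "infinite Y"
    and t': "\<forall>x\<in>Y. \<forall>y\<in>Y. x \<noteq> y \<longrightarrow> code (rel (Min {x, y}) (Max {x, y})) = t"
    by (elim exE conjE) (rule that)
  note t = t'[rule_format]
  have same: "rel i j = rel i' j'" if "i \<in> Y" "j \<in> Y" "i < j" "i' \<in> Y" "j' \<in> Y" "i' < j'" for i j i' j'
  proof -
    have "code (rel i j) = code (rel i' j')" using t[of i j] t[of i' j'] that by simp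
    then show ?thesis using code rel by (auto simp: bij_betw_def inj_on_def)
  qed
  have above: "\<exists>l \<in> Y. l > i" for i using Y by (meson infinite_nat_iff_unbounded)
  have diag: "bs l ! s = bs i ! s"
    if ij: "i \<in> Y" "j \<in> Y" "i < j" "s < n" "bs i ! s = bs j ! s" and l: "l \<in> Y" for i j l s
  proof -
    have "(s, s) \<in> rel i j" using ij by (simp add: rel_def)
    then have "(s, s) \<in> rel (min i l) (max i l)" if "i \<noteq> l"
      using same[OF ij(1,2,3), of "min i l" "max i l"] ij(1) l that by (auto simp: min_def max_def)
    then show ?thesis by (cases "i = l") (auto simp: rel_def min_def max_def split: if_splits)
  qed
  show ?thesis
  proof (rule that[OF Y])
    fix i j s u l
    assume i: "i \<in> Y" and j: "j \<in> Y" and ij: "i \<noteq> j" and s: "s < n" and u: "u < n"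
      and eq: "bs i ! s = bs j ! u" and l: "l \<in> Y"
    \<comment> \<open>Comparison with a later tuple turns a coincidence between positions
      \<open>s\<close> and \<open>u\<close> into one at position \<open>s\<close> alone, to which
      \<open>diag\<close> applies.\<close>
    obtain x where x: "x \<in> Y" "x > max i j" using above by blast
    show "bs l ! s = bs i ! s"
    proof (cases "i < j")
      case True
      have "(s, u) \<in> rel i j" using s u eq by (simp add: rel_def)
      then have "(s, u) \<in> rel i x" "(s, u) \<in> rel j x"
        using same[OF i j True i x(1)] same[OF i j True j x(1)] x(2) by auto
      then have "bs i ! s = bs j ! s" by (simp add: rel_def)
      then show ?thesis by (rule diag[OF i j True s _ l])
    next
      case False
      then have ji: "j < i" using ij by simp
      have "(u, s) \<in> rel j i" using s u eq by (simp add: rel_def)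
      then have "(u, s) \<in> rel j x" using same[OF j i ji j x(1)] x(2) by auto
      then have "bs i ! s = bs x ! s" using eq by (simp add: rel_def)
      moreover have "i < x" using x(2) by simp
      ultimately show ?thesis using diag[OF i x(1) _ s _ l] by blast
    qed
  qed
qed

section \<open>Moving forking and dividing from the extension down to the base structure\<close>

context homogeneous_structure
begin

text \<open>Finite because the language is, and by homogeneity enough to determine the orbit of an
  \<open>n\<close>-tuple of \<open>M\<close>. This is the part of a type that is carried from
  \<open>N\<close> to \<open>M\<close>.\<close>

definition tuple_atoms :: "nat \<Rightarrow> ('r, nat) fm set" where
  "tuple_atoms n = {Rel R (map Par is) |R is. R \<in> dom L \<and> length is = k + 1 \<and> set is \<subseteq> {..<n}} \<union>
     {Eq (Par i) (Par j) |i j. i < n \<and> j < n}"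

definition same_diagram :: "'a list \<Rightarrow> ('r, 'a) rstruct \<Rightarrow> 'a list \<Rightarrow> bool" where
  "same_diagram b N c \<longleftrightarrow> length b = length c \<and>
     (\<forall>\<theta> \<in> tuple_atoms (length b). true_in M (inst \<theta> b) \<longleftrightarrow> true_in N (inst \<theta> c))"

lemma finite_tuple_atoms: "finite (tuple_atoms n)"
proof -
  have "finite ((\<lambda>(R, is). Rel R (map Par is) :: ('r, nat) fm) ` (dom L \<times> {is. set is \<subseteq> {..<n} \<and> length is = k + 1}))"
    using finite_language by (intro finite_imageI finite_cartesian_product finite_lists_length_eq) auto
  moreover have "{Rel R (map Par is) |R is. R \<in> dom L \<and> length is = k + 1 \<and> set is \<subseteq> {..<n}} \<subseteq>
      (\<lambda>(R, is). Rel R (map Par is) :: ('r, nat) fm) ` (dom L \<times> {is. set is \<subseteq> {..<n} \<and> length is = k + 1})"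
    by force
  moreover have "{Eq (Par i) (Par j) :: ('r, nat) fm |i j. i < n \<and> j < n} \<subseteq>
      (\<lambda>(i, j). Eq (Par i) (Par j)) ` ({..<n} \<times> {..<n})" by force
  moreover have "finite ((\<lambda>(i, j). Eq (Par i) (Par j) :: ('r, nat) fm) ` ({..<n} \<times> {..<n}))" by simp
  ultimately show ?thesis unfolding tuple_atoms_def by (meson finite_Un finite_subset)
qed

lemma tuple_atoms_sentences: "tuple_atoms n \<subseteq> sentences L {..<n}"
proof
  fix \<theta> assume "\<theta> \<in> tuple_atoms n"
  then consider (Rel) R "is" where "\<theta> = Rel R (map Par is)" "R \<in> dom L" "length is = k + 1" "set is \<subseteq> {..<n}"
    | (Eq) i j where "\<theta> = Eq (Par i) (Par j)" "i < n" "j < n"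
    by (auto simp: tuple_atoms_def)
  then show "\<theta> \<in> sentences L {..<n}"
  proof cases
    case Rel
    then obtain m where m: "L R = Some m" by auto
    then have "m = k + 1" by (rule arity)
    then show ?thesis using Rel m by (auto simp: formulas_def)
  qed (auto simp: formulas_def)
qed

lemma true_in_atom:
  "true_in N (inst (Eq (Par i) (Par j)) b) \<longleftrightarrow> b ! i = b ! j"
  "true_in N (inst (Rel R (map Par is)) b) \<longleftrightarrow> map ((!) b) is \<in> interp N R"
  by (auto simp: true_in_def inst_def comp_def)

text \<open>The equality atoms make sending \<open>b ! i\<close> to \<open>c ! i\<close> a
  well-defined injection although entries may repeat; the relational atoms make it a partial
  isomorphism.\<close>

lemma same_diagram_automorphism:
  assumes b: "set b \<subseteq> univ M" and c: "set c \<subseteq> univ M"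
    and same: "\<And>\<theta>. \<theta> \<in> tuple_atoms (length b) \<Longrightarrow> true_in M (inst \<theta> b) \<longleftrightarrow> true_in M (inst \<theta> c)"
    and len: "length b = length c"
  obtains g where "automorphism M g" "map g b = c"
proof -
  let ?n = "length b"
  have eq: "b ! i = b ! j \<longleftrightarrow> c ! i = c ! j" if "i < ?n" "j < ?n" for i j
    using same[of "Eq (Par i) (Par j)"] that unfolding true_in_atom by (auto simp: tuple_atoms_def)
  define f where "f a = c ! (SOME i. i < ?n \<and> b ! i = a)" for a
  have f: "f (b ! i) = c ! i" if "i < ?n" for i
  proof -
    let ?j = "SOME j. j < ?n \<and> b ! j = b ! i"
    have "?j < ?n \<and> b ! ?j = b ! i" by (rule someI[of _ i]) (use that in simp)
    then show ?thesis using eq[of ?j i] that by (simp add: f_def)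
  qed
  have inj: "inj_on f (set b)"
  proof (rule inj_onI)
    fix x y assume "x \<in> set b" "y \<in> set b" "f x = f y"
    then obtain i j where "i < ?n" "x = b ! i" "j < ?n" "y = b ! j" by (metis in_set_conv_nth)
    then show "x = y" using eq[of i j] f \<open>f x = f y\<close> by simp
  qed
  have fb: "f ` set b \<subseteq> univ M"
  proof
    fix x assume "x \<in> f ` set b"
    then obtain i where "i < ?n" "x = c ! i" using f by (metis imageE in_set_conv_nth)
    then show "x \<in> univ M" using c len by auto
  qed
  have "pullback M (\<lambda>a. a) (set b) = pullback M f (set b)"
    unfolding pullback_eq_iff
  proof (intro allI impI)
    fix R t assume t: "set t \<subseteq> set b"
    have "\<exists>i. i < ?n \<and> b ! i = a" if "a \<in> set t" for a using t that by (metis in_set_conv_nth subsetD)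
    then obtain ix where ix: "\<And>a. a \<in> set t \<Longrightarrow> ix a < ?n \<and> b ! ix a = a" by metis
    define "is" where "is = map ix t"
    have isb: "map ((!) b) is = t" unfolding is_def map_map by (rule map_idI) (use ix in auto)
    have isc: "map ((!) c) is = map f t"
      unfolding is_def map_map by (rule map_cong[OF refl]) (use ix f in \<open>metis comp_apply\<close>)
    show "map (\<lambda>a. a) t \<in> interp M R \<longleftrightarrow> map f t \<in> interp M R"
    proof (cases "R \<in> dom L \<and> length t = k + 1")
      case True
      then have "Rel R (map Par is) \<in> tuple_atoms ?n"
        unfolding tuple_atoms_def using ix
        by (intro UnI1 CollectI exI[of _ R] exI[of _ "is"]) (auto simp: is_def)
      from same[OF this] show ?thesis unfolding true_in_atom isb isc by simp
    next
      case False
      have "map f t \<notin> interp M R" "t \<notin> interp M R" using False interpD(2,5)[of _ R] by fastforce+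
      then show ?thesis by simp
    qed
  qed
  then obtain g where g: "automorphism M g" "\<And>a. a \<in> set b \<Longrightarrow> g a = f a"
    using extend_partial_isomorphism[of "set b" "\<lambda>a. a" f] b inj fb by auto
  have "map g b = c" using g(2) f len by (intro nth_equalityI) auto
  then show ?thesis using that g(1) by blast
qed

lemma transfer_diagram:
  assumes h: "\<And>\<theta>. \<theta> \<in> tuple_atoms (length b) \<Longrightarrow> true_in N (inst \<theta> b) \<longleftrightarrow> true_in M (map_fm id h (inst \<theta> b))"
  shows "same_diagram (map h b) N b"
  unfolding same_diagram_def
proof (intro conjI ballI)
  fix \<theta> assume \<theta>: "\<theta> \<in> tuple_atoms (length (map h b))"
  then have "params \<theta> \<subseteq> {..<length b}" using tuple_atoms_sentences by (auto simp: formulas_def)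
  then show "true_in M (inst \<theta> (map h b)) \<longleftrightarrow> true_in N (inst \<theta> b)" using h[of \<theta>] \<theta> by (simp add: map_fm_inst)
qed simp

lemma inst_atoms_sentences:
  assumes "set b \<subseteq> C"
  shows "(\<lambda>\<theta>. inst \<theta> b) ` tuple_atoms (length b) \<subseteq> sentences L C"
  using tuple_atoms_sentences inst_in_formulas[OF _ refl assms] by blast

text \<open>That dividing formulas cover \<open>\<phi>\<close> is a single sentence, and the
  diagrams of their parameters add finitely many more. The tuples \<open>b\<close> stay in
  \<open>N\<close>, where dividing is defined; \<open>map h b\<close> are their copies in
  \<open>M\<close>.\<close>

lemma forks_in_M:
  assumes ee: "elementary_extension L M N" and \<phi>: "\<phi> \<in> x_formulas L (univ M)" and forks: "forks L N \<phi>"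
  obtains D and h :: "'a \<Rightarrow> 'a" where "finite D"
    "\<And>\<theta> b. (\<theta>, b) \<in> D \<Longrightarrow> set b \<subseteq> univ N \<and> \<theta> \<in> x_formulas L {..<length b} \<and> divides L N \<theta> b \<and>
       set (map h b) \<subseteq> univ M \<and> same_diagram (map h b) N b"
    "\<And>a. a \<in> univ M \<Longrightarrow> satisfies M a \<phi> \<Longrightarrow> \<exists>(\<theta>, b) \<in> D. satisfies M a (inst \<theta> (map h b))"
proof -
  obtain D where D: "finite D" "\<forall>(\<theta>, b) \<in> D. set b \<subseteq> univ N \<and> \<theta> \<in> x_formulas L {..<length b} \<and> divides L N \<theta> b"
    "\<forall>a \<in> univ N. satisfies N a \<phi> \<longrightarrow> (\<exists>(\<theta>, b) \<in> D. satisfies N a (inst \<theta> b))"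
    using forks unfolding forks_def by blast
  have DD: "set b \<subseteq> univ N" "\<theta> \<in> x_formulas L {..<length b}" "divides L N \<theta> b" if "(\<theta>, b) \<in> D" for \<theta> b
    using D(2) that by auto
  have MN: "univ M \<subseteq> univ N" using ee by (simp add: elementary_extension_def)
  obtain ds where ds: "set ds = D" using finite_list[OF D(1)] by blast
  \<comment> \<open>A solution of \<open>\<phi>\<close> that escapes all the dividing formulas; that
    none exists is the sentence to be transferred.\<close>
  define \<psi> where "\<psi> = Conj \<phi> (conjs (map (\<lambda>(\<theta>, b). Neg (inst \<theta> b)) ds))"
  have inst_N: "inst \<theta> b \<in> x_formulas L (univ N)" if "(\<theta>, b) \<in> D" for \<theta> b
    using inst_in_formulas[OF DD(2)[OF that] refl DD(1)[OF that]] .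
  have "\<phi> \<in> x_formulas L (univ N)" using \<phi> MN by (auto simp: formulas_def)
  moreover have "conjs (map (\<lambda>(\<theta>, b). Neg (inst \<theta> b)) ds) \<in> x_formulas L (univ N)"
    by (rule conjs_in_formulas) (use inst_N ds in auto)
  ultimately have \<psi>: "\<psi> \<in> x_formulas L (univ N)" by (simp add: \<psi>_def)
  define \<Phi> where "\<Phi> = insert (Ex 0 \<psi>) (\<Union>(\<theta>, b)\<in>D. (\<lambda>\<theta>. inst \<theta> b) ` tuple_atoms (length b))"
  have "finite \<Phi>" using D(1) finite_tuple_atoms by (auto simp: \<Phi>_def)
  moreover have "\<Phi> \<subseteq> sentences L (univ N)"
  proof -
    have "(\<lambda>\<theta>. inst \<theta> b) ` tuple_atoms (length b) \<subseteq> sentences L (univ N)" if "(\<theta>, b) \<in> D" for \<theta> b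
      using DD(1)[OF that] by (rule inst_atoms_sentences)
    then show ?thesis unfolding \<Phi>_def using Ex_in_sentences[OF \<psi>] by auto
  qed
  ultimately obtain h where h: "\<And>a. a \<in> univ M \<Longrightarrow> h a = a" "\<And>a. h a \<in> univ M"
    "\<And>\<phi>. \<phi> \<in> \<Phi> \<Longrightarrow> true_in N \<phi> \<longleftrightarrow> true_in M (map_fm id h \<phi>)"
    using finite_transfer[OF ee nonempty] by metis
  show ?thesis
  proof (rule that[OF D(1)])
    fix \<theta> b assume b: "(\<theta>, b) \<in> D"
    have "same_diagram (map h b) N b"
      by (rule transfer_diagram, rule h(3)) (use b in \<open>force simp: \<Phi>_def\<close>)
    then show "set b \<subseteq> univ N \<and> \<theta> \<in> x_formulas L {..<length b} \<and> divides L N \<theta> b \<and>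
       set (map h b) \<subseteq> univ M \<and> same_diagram (map h b) N b"
      using DD[OF b] h(2) by auto
  next
    fix a assume a: "a \<in> univ M" "satisfies M a \<phi>"
    have "\<not> true_in N (Ex 0 \<psi>)"
    proof -
      have "\<not> satisfies N a \<psi>" if "a \<in> univ N" for a
        using D(3) that by (fastforce simp: \<psi>_def ds)
      moreover have fv: "free_vars \<psi> \<subseteq> {0}" using \<psi> by (simp add: formulas_def)
      ultimately show ?thesis unfolding true_in_Ex[OF fv] by blast
    qed
    then have "\<not> true_in M (Ex 0 (map_fm id h \<psi>))" using h(3)[of "Ex 0 \<psi>"] by (simp add: \<Phi>_def id_def)
    moreover have fv: "free_vars (map_fm id h \<psi>) \<subseteq> {0}" using \<psi> by (simp add: formulas_def)
    ultimately have nsat: "\<not> satisfies M a (map_fm id h \<psi>)" unfolding true_in_Ex[OF fv] using a(1) by blast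
    have h\<phi>: "map_fm id h \<phi> = \<phi>" using \<phi> h(1) by (intro map_fm_ident) (auto simp: formulas_def)
    have inst: "map_fm id h (inst \<theta> b) = inst \<theta> (map h b)" if "(\<theta>, b) \<in> D" for \<theta> b
      using DD(2)[OF that] by (intro map_fm_inst) (auto simp: formulas_def)
    have "map (map_fm id h) (map (\<lambda>(\<theta>, b). Neg (inst \<theta> b)) ds) = map (\<lambda>(\<theta>, b). Neg (inst \<theta> (map h b))) ds"
      unfolding map_map by (rule map_cong[OF refl]) (auto simp: ds id_def inst[unfolded id_def])
    then have "map_fm id h (conjs (map (\<lambda>(\<theta>, b). Neg (inst \<theta> b)) ds)) =
        conjs (map (\<lambda>(\<theta>, b). Neg (inst \<theta> (map h b))) ds)" unfolding map_fm_conjs by metis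
    then have "map_fm id h \<psi> = Conj \<phi> (conjs (map (\<lambda>(\<theta>, b). Neg (inst \<theta> (map h b))) ds))"
      unfolding \<psi>_def fm.map h\<phi> by simp
    then show "\<exists>(\<theta>, b) \<in> D. satisfies M a (inst \<theta> (map h b))" using nsat a(2) by (force simp: ds)
  qed
qed

text \<open>For finitely many members of a dividing sequence, inconsistency of subfamilies and the
  diagrams amount to finitely many sentences. In \<open>M\<close> equal diagrams make all the copies
  conjugate to \<open>c\<close>.\<close>

lemma divides_in_M:
  assumes ee: "elementary_extension L M N" and b: "set b \<subseteq> univ N" and \<theta>: "\<theta> \<in> x_formulas L {..<length b}"
    and c: "set c \<subseteq> univ M" "same_diagram c N b"
    and bs': "\<forall>i. length (bs i) = length b \<and> set (bs i) \<subseteq> univ N \<and> tuple_type L N (bs i) = tuple_type L N b"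
    and inc': "\<forall>J. finite J \<longrightarrow> card J = q \<longrightarrow> \<not> (\<exists>a \<in> univ N. \<forall>i \<in> J. satisfies N a (inst \<theta> (bs i)))"
    and I: "finite (I :: nat set)"
  obtains h where "inj_on h (\<Union>i\<in>I. set (bs i))" "\<forall>i \<in> I. set (map h (bs i)) \<subseteq> univ M"
    "\<forall>i \<in> I. \<exists>g. automorphism M g \<and> map g c = map h (bs i)"
    "\<forall>J. J \<subseteq> I \<longrightarrow> card J = q \<longrightarrow> \<not> (\<exists>a \<in> univ M. \<forall>i \<in> J. satisfies M a (inst \<theta> (map h (bs i))))"
proof -
  note bs = bs'[rule_format] and inc = inc'[rule_format]
  have inst_N: "inst \<theta> (bs i) \<in> x_formulas L (univ N)" for i
    using inst_in_formulas[OF \<theta>, of "bs i"] bs by auto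
  define \<psi> where "\<psi> J = conjs (map (\<lambda>i. inst \<theta> (bs i)) (sorted_list_of_set J))" for J
  have \<psi>: "\<psi> J \<in> x_formulas L (univ N)" for J
    unfolding \<psi>_def by (rule conjs_in_formulas) (use inst_N in auto)
  define B where "B = (\<Union>i\<in>I. set (bs i))"
  have B: "finite B" "B \<subseteq> univ N" using I bs by (auto simp: B_def)
  \<comment> \<open>Three groups: solvability of each subfamily, the diagrams of the tuples, and all
    equalities between entries. The last makes \<open>h\<close> injective, which preserves
    coincidences between tuples.\<close>
  define \<Phi> where "\<Phi> = (\<lambda>J. Ex 0 (\<psi> J)) ` Pow I \<union> (\<Union>i\<in>I. (\<lambda>\<alpha>. inst \<alpha> (bs i)) ` tuple_atoms (length (bs i)))
    \<union> (\<lambda>(x, y). Eq (Par x) (Par y)) ` (B \<times> B)"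
  have "finite \<Phi>" using I B(1) finite_tuple_atoms by (auto simp: \<Phi>_def)
  moreover have "\<Phi> \<subseteq> sentences L (univ N)"
  proof -
    have "Ex 0 (\<psi> J) \<in> sentences L (univ N)" for J by (rule Ex_in_sentences[OF \<psi>])
    moreover have "(\<lambda>\<alpha>. inst \<alpha> (bs i)) ` tuple_atoms (length (bs i)) \<subseteq> sentences L (univ N)" for i
      by (rule inst_atoms_sentences) (use bs in blast)
    moreover have "Eq (Par x) (Par y) \<in> sentences L (univ N)" if "x \<in> B" "y \<in> B" for x y
      using B(2) that by (auto simp: formulas_def)
    ultimately show ?thesis unfolding \<Phi>_def by auto
  qed
  ultimately obtain h where h: "\<And>a. a \<in> univ M \<Longrightarrow> h a = a" "\<And>a. h a \<in> univ M"
    "\<And>\<phi>. \<phi> \<in> \<Phi> \<Longrightarrow> true_in N \<phi> \<longleftrightarrow> true_in M (map_fm id h \<phi>)"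
    using finite_transfer[OF ee nonempty] by metis
  have hM: "set (map h (bs i)) \<subseteq> univ M" for i using h(2) by auto
  show ?thesis
  proof (rule that)
    show "inj_on h (\<Union>i\<in>I. set (bs i))"
      unfolding B_def[symmetric]
    proof (rule inj_onI)
      fix x y assume xy: "x \<in> B" "y \<in> B" "h x = h y"
      then have "Eq (Par x) (Par y) \<in> \<Phi>" by (auto simp: \<Phi>_def)
      from h(3)[OF this] xy(3) show "x = y" by (simp add: true_in_def)
    qed
    show "\<forall>i \<in> I. set (map h (bs i)) \<subseteq> univ M" using hM by blast
    show "\<forall>i \<in> I. \<exists>g. automorphism M g \<and> map g c = map h (bs i)"
    proof
      fix i assume i: "i \<in> I"
      have d: "same_diagram (map h (bs i)) N (bs i)"
        by (rule transfer_diagram, rule h(3)) (use i in \<open>auto simp: \<Phi>_def\<close>)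
      have len: "length c = length b" "length (bs i) = length b" using c(2) bs by (auto simp: same_diagram_def)
      have "true_in M (inst \<alpha> c) \<longleftrightarrow> true_in M (inst \<alpha> (map h (bs i)))" if \<alpha>: "\<alpha> \<in> tuple_atoms (length c)" for \<alpha>
      proof -
        have "\<alpha> \<in> sentences L {..<length b}" using \<alpha> tuple_atoms_sentences len by auto
        then have "true_in N (inst \<alpha> (bs i)) \<longleftrightarrow> true_in N (inst \<alpha> b)"
          using bs[of i] len by (auto simp: tuple_type_def)
        then show ?thesis using d c(2) \<alpha> len by (auto simp: same_diagram_def)
      qed
      then obtain g where "automorphism M g" "map g c = map h (bs i)"
        using same_diagram_automorphism[OF c(1) hM, of i] len by (metis length_map)
      then show "\<exists>g. automorphism M g \<and> map g c = map h (bs i)" by blast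
    qed
    show "\<forall>J. J \<subseteq> I \<longrightarrow> card J = q \<longrightarrow> \<not> (\<exists>a \<in> univ M. \<forall>i \<in> J. satisfies M a (inst \<theta> (map h (bs i))))"
    proof (intro allI impI)
      fix J assume J: "J \<subseteq> I" "card J = q"
      then have fin: "finite J" using I finite_subset by blast
      have fv: "free_vars (\<psi> J) \<subseteq> {0}" using \<psi> by (simp add: formulas_def)
      have "\<not> true_in N (Ex 0 (\<psi> J))"
        unfolding true_in_Ex[OF fv] using inc[OF fin J(2)] fin by (auto simp: \<psi>_def)
      moreover have "Ex 0 (\<psi> J) \<in> \<Phi>" using J(1) by (auto simp: \<Phi>_def)
      ultimately have "\<not> true_in M (Ex 0 (map_fm id h (\<psi> J)))" using h(3)[of "Ex 0 (\<psi> J)"] by (simp add: id_def)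
      moreover have "free_vars (map_fm id h (\<psi> J)) \<subseteq> {0}" using fv by simp
      moreover have "map_fm id h (inst \<theta> (bs i)) = inst \<theta> (map h (bs i))" for i
        using \<theta> bs[of i] by (intro map_fm_inst) (auto simp: formulas_def)
      then have "map_fm id h (\<psi> J) = conjs (map (\<lambda>i. inst \<theta> (map h (bs i))) (sorted_list_of_set J))"
        by (simp add: \<psi>_def map_fm_conjs comp_def)
      ultimately show "\<not> (\<exists>a \<in> univ M. \<forall>i \<in> J. satisfies M a (inst \<theta> (map h (bs i))))"
        using true_in_Ex fin by fastforce
    qed
  qed
qed

text \<open>Conjugate instances have equal measure. If it were positive, sufficiently many instances
  would be expected to contain a type more than \<open>q\<close> times, and some type would contain
  \<open>q\<close> of them, against inconsistency.\<close>

lemma divides_measure_zero: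
  assumes ee: "elementary_extension L M N" and \<mu>: "invariant_keisler_measure L M \<mu>"
    and b: "set b \<subseteq> univ N" and \<theta>: "\<theta> \<in> x_formulas L {..<length b}" and div: "divides L N \<theta> b"
    and c: "set c \<subseteq> univ M" "same_diagram c N b"
  shows "measure \<mu> (types_containing L M (inst \<theta> c)) = 0"
proof (rule ccontr)
  let ?m = "measure \<mu> (types_containing L M (inst \<theta> c))"
  assume "?m \<noteq> 0"
  then have pos: "?m > 0" by (simp add: less_le)
  have K: "keisler_measure L M \<mu>" using \<mu> by (simp add: invariant_keisler_measure_def)
  from div[unfolded divides_def] obtain q and bs :: "nat \<Rightarrow> 'a list" where
      bs': "\<forall>i. length (bs i) = length b \<and> set (bs i) \<subseteq> univ N \<and> tuple_type L N (bs i) = tuple_type L N b"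
    and inc': "\<forall>J. finite J \<longrightarrow> card J = q \<longrightarrow> \<not> (\<exists>a \<in> univ N. \<forall>i \<in> J. satisfies N a (inst \<theta> (bs i)))"
    by (elim exE conjE) (rule that)
  note bs = bs'[rule_format] and inc = inc'[rule_format]
  \<comment> \<open>So many instances that the expected number of those in a type exceeds
    \<open>q\<close>.\<close>
  obtain l :: nat where l: "real q < real l * ?m" using pos reals_Archimedean3 by blast
  obtain h where hM': "\<forall>i \<in> {..<l}. set (map h (bs i)) \<subseteq> univ M"
    and g': "\<forall>i \<in> {..<l}. \<exists>g. automorphism M g \<and> map g c = map h (bs i)"
    and incM': "\<forall>J. J \<subseteq> {..<l} \<longrightarrow> card J = q \<longrightarrow> \<not> (\<exists>a \<in> univ M. \<forall>i \<in> J. satisfies M a (inst \<theta> (map h (bs i))))"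
    by (rule divides_in_M[OF ee b \<theta> c bs' inc' finite_lessThan[of l]]) (rule that)
  note hM = hM'[rule_format] and g = g'[rule_format] and incM = incM'[rule_format]
  have len: "length c = length b" using c(2) by (simp add: same_diagram_def)
  define U where "U i = types_containing L M (inst \<theta> (map h (bs i)))" for i
  have form: "inst \<theta> (map h (bs i)) \<in> x_formulas L (univ M)" if "i \<in> {..<l}" for i
    using inst_in_formulas[OF \<theta>, of "map h (bs i)"] bs[of i] hM[OF that] by simp
  have formc: "inst \<theta> c \<in> x_formulas L (univ M)" using inst_in_formulas[OF \<theta> len c(1)] .
  have U: "measure \<mu> (U i) = ?m" if i: "i \<in> {..<l}" for i
  proof -
    from g[OF i] obtain g where g: "automorphism M g" "map g c = map h (bs i)" by blast
    have "map_fm id g (inst \<theta> c) = inst \<theta> (map g c)"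
      using \<theta> len by (intro map_fm_inst) (auto simp: formulas_def)
    then show ?thesis using measure_automorphism[OF \<mu> g(1) formc] g(2) by (simp add: U_def)
  qed
  have "U i \<in> sets \<mu>" if "i \<in> {..<l}" for i
    unfolding U_def using keisler_measureD(3)[OF K form[OF that]] .
  \<comment> \<open>With \<open>T\<close> equal to the whole index set the subtracted sums are
    empty, and some type lies in at least the expected number of sets.\<close>
  from exists_ge_expected_difference[where U = U, OF keisler_measureD(1)[OF K] finite_lessThan[of l] order_refl this null_sets.empty_sets]
  obtain p where p: "p \<in> space \<mu>" and ge: "(\<Sum>i<l. measure \<mu> (U i)) \<le> real (card {i \<in> {..<l}. p \<in> U i})"
    by auto
  have "real l * ?m \<le> real (card {i \<in> {..<l}. p \<in> U i})" using ge U by simp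
  then have "q \<le> card {i \<in> {..<l}. p \<in> U i}" using l by linarith
  then obtain J where J: "J \<subseteq> {i \<in> {..<l}. p \<in> U i}" "card J = q" "finite J"
    by (meson obtain_subset_with_card_n)
  have pt: "p \<in> type_space L M" using p keisler_measureD(2)[OF K] by simp
  have sub: "(\<lambda>i. inst \<theta> (map h (bs i))) ` J \<subseteq> p" using J(1) by (auto simp: U_def types_containing_def)
  from type_spaceD(2)[OF pt finite_imageI[OF J(3)] sub]
  obtain a where a: "a \<in> univ M" "\<forall>\<phi> \<in> (\<lambda>i. inst \<theta> (map h (bs i))) ` J. satisfies M a \<phi>"
    by (elim bexE) (rule that)
  have "J \<subseteq> {..<l}" using J(1) by blast
  moreover have "\<forall>i \<in> J. satisfies M a (inst \<theta> (map h (bs i)))" using a(2) by simp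
  ultimately show False using incM[OF _ J(2)] a(1) by blast
qed

text \<open>The clopen set of \<open>\<phi>\<close> is covered by the finitely many null sets of the
  transferred dividing formulas.\<close>

lemma forks_measure_zero:
  assumes ee: "elementary_extension L M N" and \<mu>: "invariant_keisler_measure L M \<mu>"
    and \<phi>: "\<phi> \<in> x_formulas L (univ M)" and forks: "forks L N \<phi>"
  shows "measure \<mu> (types_containing L M \<phi>) = 0"
proof -
  have K: "keisler_measure L M \<mu>" using \<mu> by (simp add: invariant_keisler_measure_def)
  interpret prob_space \<mu> by (rule keisler_measureD(1)[OF K])
  obtain D h where D: "finite D"
    "\<And>\<theta> b. (\<theta>, b) \<in> D \<Longrightarrow> set b \<subseteq> univ N \<and> \<theta> \<in> x_formulas L {..<length b} \<and> divides L N \<theta> b \<and>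
       set (map h b) \<subseteq> univ M \<and> same_diagram (map h b) N b"
    "\<And>a. a \<in> univ M \<Longrightarrow> satisfies M a \<phi> \<Longrightarrow> \<exists>(\<theta>, b) \<in> D. satisfies M a (inst \<theta> (map h b))"
    by (rule forks_in_M[OF ee \<phi> forks]) (rule that)
  define U where "U = (\<lambda>(\<theta>, b). types_containing L M (inst \<theta> (map h b)))"
  have form: "inst \<theta> (map h b) \<in> x_formulas L (univ M)" if "(\<theta>, b) \<in> D" for \<theta> b
    using D(2)[OF that] by (intro inst_in_formulas[of _ _ _ "length b"]) auto
  have null: "U d \<in> null_sets \<mu>" if "d \<in> D" for d
  proof -
    obtain \<theta> b where d: "d = (\<theta>, b)" by (cases d)
    have "measure \<mu> (types_containing L M (inst \<theta> (map h b))) = 0"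
      using D(2)[of \<theta> b] that d by (intro divides_measure_zero[OF ee \<mu>, of b]) auto
    then show ?thesis using keisler_measureD(3)[OF K form] that d
      by (simp add: U_def null_sets_def emeasure_eq_measure)
  qed
  have "types_containing L M \<phi> \<subseteq> (\<Union>d\<in>D. U d)"
  proof
    fix p assume p: "p \<in> types_containing L M \<phi>"
    then have pt: "p \<in> type_space L M" "\<phi> \<in> p" by (auto simp: types_containing_def)
    show "p \<in> (\<Union>d\<in>D. U d)"
    proof (rule ccontr)
      assume n: "p \<notin> (\<Union>d\<in>D. U d)"
      let ?q = "insert \<phi> ((\<lambda>(\<theta>, b). Neg (inst \<theta> (map h b))) ` D)"
      have "Neg (inst \<theta> (map h b)) \<in> p" if "(\<theta>, b) \<in> D" for \<theta> b
      proof -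
        have "p \<notin> types_containing L M (inst \<theta> (map h b))" using n that by (auto simp: U_def)
        then show ?thesis using type_Neg[OF pt(1) form[OF that]] pt(1) by (auto simp: types_containing_def)
      qed
      then have "?q \<subseteq> p" using pt(2) by auto
      then obtain a where "a \<in> univ M" "\<forall>\<psi> \<in> ?q. satisfies M a \<psi>"
        using type_spaceD(2)[OF pt(1), of ?q] D(1) by blast
      then show False using D(3)[of a] by fastforce
    qed
  qed
  moreover have "(\<Union>d\<in>D. U d) \<in> null_sets \<mu>" using null D(1) by (intro null_sets_UN') (auto intro: countable_finite)
  ultimately have "types_containing L M \<phi> \<in> null_sets \<mu>"
    using keisler_measureD(3)[OF K \<phi>] by (rule null_sets_subset[rotated 2])
  then show ?thesis by (simp add: measure_def null_setsD1)
qed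

text \<open>Induction on \<open>I\<close>, adding a tuple by \<open>joint_realisation\<close> over
  the union of the earlier ones. The last premise is the sunflower condition; it ensures that the
  two types to be joined agree over the common entries.\<close>

lemma sunflower_realisation:
  fixes t :: "nat \<Rightarrow> 'a list"
  assumes amalg: "disjoint_amalgamation 3 (age L M)"
    and b: "set b \<subseteq> univ M" and c: "c \<in> univ M" "c \<notin> set b"
  shows "finite I \<Longrightarrow> (\<And>i. i \<in> I \<Longrightarrow> \<exists>g. automorphism M g \<and> map g b = t i) \<Longrightarrow>
    (\<And>i j l s. i \<in> I \<Longrightarrow> j \<in> I \<Longrightarrow> i \<noteq> j \<Longrightarrow> s < length b \<Longrightarrow> t i ! s \<in> set (t j) \<Longrightarrow> l \<in> I \<Longrightarrow> t l ! s = t i ! s) \<Longrightarrow>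
    \<exists>d \<in> univ M - (\<Union>i\<in>I. set (t i)). \<forall>i \<in> I. \<exists>f. automorphism M f \<and> map f b = t i \<and> f c = d"
proof (induction I rule: finite_induct)
  case empty
  then show ?case using c by auto
next
  case (insert j I)
  note auts = insert.prems(1) and sun = insert.prems(2)
  obtain g where g: "automorphism M g" "map g b = t j" using auts[of j] by blast
  have tM: "set (t i) \<subseteq> univ M" if i: "i \<in> insert j I" for i
  proof -
    obtain g where g: "automorphism M g" "map g b = t i" using auts[OF i] by blast
    have "set (t i) = g ` set b" using g(2) by (metis list.set_map)
    then show ?thesis using automorphism_in[OF g(1)] b by auto
  qed
  have len: "length (t i) = length b" if i: "i \<in> insert j I" for i
    using auts[OF i] by (metis length_map)
  have gc: "g c \<in> univ M" "g c \<notin> set (t j)"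
  proof -
    show "g c \<in> univ M" using automorphism_in[OF g(1) c(1)] .
    have "set (t j) = g ` set b" using g(2) by (metis list.set_map)
    then show "g c \<notin> set (t j)" using inj_on_image_mem_iff[OF automorphismD(1)[OF g(1)] c(1) b] c(2) by simp
  qed
  show ?case
  proof (cases "I = {}")
    case True
    then show ?thesis using gc g by (intro bexI[of _ "g c"]) auto
  next
    case False
    then obtain i\<^sub>0 where i0: "i\<^sub>0 \<in> I" by blast
    have "\<exists>d \<in> univ M - (\<Union>i\<in>I. set (t i)). \<forall>i \<in> I. \<exists>f. automorphism M f \<and> map f b = t i \<and> f c = d"
    proof (rule insert.IH)
      show "\<exists>g. automorphism M g \<and> map g b = t i" if "i \<in> I" for i using auts that by blast
      show "t l ! s = t i ! s" if "i \<in> I" "i' \<in> I" "i \<noteq> i'" "s < length b" "t i ! s \<in> set (t i')" "l \<in> I" for i i' l s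
        using sun[of i i' s l] that by blast
    qed
    then obtain d where d\<^sub>0: "d \<in> univ M - (\<Union>i\<in>I. set (t i))"
      and d': "\<forall>i \<in> I. \<exists>f. automorphism M f \<and> map f b = t i \<and> f c = d"
      by (elim bexE) (rule that)
    have d: "d \<in> univ M" "d \<notin> (\<Union>i\<in>I. set (t i))" using d\<^sub>0 by blast+
    let ?Z = "\<Union>i\<in>I. set (t i)"
    obtain f where f: "automorphism M f" "map f b = t i\<^sub>0" "f c = d" using d'[rule_format, OF i0] by blast
    obtain f' where f': "automorphism M f'" "\<And>a. a \<in> univ M \<Longrightarrow> f' (f a) = a"
      "\<And>a. a \<in> univ M \<Longrightarrow> f (f' a) = a" using automorphism_inverse[OF f(1)] by metis
    have s: "automorphism M (\<lambda>a. g (f' a))" by (rule automorphism_comp[OF g(1) f'(1)])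
    \<comment> \<open>A common entry sits at one position \<open>u\<close> in all tuples, so
      \<open>f'\<close> takes it back to \<open>b ! u\<close> and \<open>g\<close> returns it to its
      place.\<close>
    have sR: "g (f' y) = y" if y: "y \<in> ?Z \<inter> set (t j)" for y
    proof -
      from y obtain i where i: "i \<in> I" "y \<in> set (t i)" by blast
      obtain u where u: "u < length b" "y = t j ! u" using y len[of j] by (auto simp: in_set_conv_nth)
      have "j \<noteq> i" using i(1) insert.hyps(2) by blast
      then have eq: "t i\<^sub>0 ! u = t j ! u" using sun[of j i u i\<^sub>0] i i0 u by blast
      have "f (b ! u) = y" using f(2) u eq by (metis nth_map)
      moreover have "b ! u \<in> univ M" using b u(1) by auto
      ultimately have "f' y = b ! u" using f'(2) by metis
      then show ?thesis using g(2) u by (metis nth_map)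
    qed
    have sd: "g (f' d) = g c" using f'(2)[OF c(1)] f(3) by simp
    have Z: "finite ?Z" "?Z \<subseteq> univ M" using insert.hyps(1) tM by auto
    have T: "finite (set (t j))" "set (t j) \<subseteq> univ M" using tM[of j] by auto
    have "\<exists>e u v. e \<in> univ M \<and> e \<notin> ?Z \<union> set (t j) \<and> automorphism M u \<and> (\<forall>a \<in> ?Z. u a = a) \<and> u d = e \<and>
        automorphism M v \<and> (\<forall>a \<in> set (t j). v a = a) \<and> v (g c) = e"
    proof (rule joint_realisation[OF amalg Z T refl d(1,2) gc s _ sd])
      show "g (f' a) = a" if "a \<in> ?Z \<inter> set (t j)" for a using that by (rule sR)
      fix e u v
      assume "e \<in> univ M" "e \<notin> ?Z \<union> set (t j)" "automorphism M u" "\<And>a. a \<in> ?Z \<Longrightarrow> u a = a" "u d = e"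
        "automorphism M v" "\<And>a. a \<in> set (t j) \<Longrightarrow> v a = a" "v (g c) = e"
      then show ?thesis by (intro exI[of _ e] exI[of _ u] exI[of _ v] conjI ballI)
    qed
    then obtain e u v where e: "e \<in> univ M" "e \<notin> ?Z \<union> set (t j)"
      and u: "automorphism M u" "u d = e" and uZ: "\<forall>a \<in> ?Z. u a = a"
      and v: "automorphism M v" "v (g c) = e" and vT: "\<forall>a \<in> set (t j). v a = a"
      by (elim exE conjE) (rule that)
    have "\<exists>f. automorphism M f \<and> map f b = t i \<and> f c = e" if i: "i \<in> insert j I" for i
    proof (cases "i = j")
      case True
      have "map (\<lambda>a. v (g a)) b = map v (t j)" unfolding g(2)[symmetric] by simp
      also have "\<dots> = t j" by (rule map_idI) (use vT in blast)
      finally show ?thesis using True automorphism_comp[OF v(1) g(1)] v(2) by blast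
    next
      case False
      then have i: "i \<in> I" using i by blast
      from d'[rule_format, OF i] obtain f where f: "automorphism M f" "map f b = t i" "f c = d" by blast
      have "map (\<lambda>a. u (f a)) b = map u (t i)" unfolding f(2)[symmetric] by simp
      also have "\<dots> = t i" by (rule map_idI) (use uZ i in blast)
      finally have "automorphism M (\<lambda>a. u (f a)) \<and> map (\<lambda>a. u (f a)) b = t i \<and> u (f c) = e"
        using automorphism_comp[OF u(1) f(1)] f(3) u(2) by simp
      then show ?thesis by blast
    qed
    then show ?thesis using e by (intro bexI[of _ e]) auto
  qed
qed

lemma infinite_not_forks:
  assumes amalg: "disjoint_amalgamation 3 (age L M)" and ee: "elementary_extension L M N"
    and \<phi>: "\<phi> \<in> x_formulas L (univ M)" and inf: "infinite (defined_set M \<phi>)"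
  shows "\<not> forks L N \<phi>"
proof
  assume forks: "forks L N \<phi>"
  obtain D h where D: "finite D"
    "\<And>\<theta> b. (\<theta>, b) \<in> D \<Longrightarrow> set b \<subseteq> univ N \<and> \<theta> \<in> x_formulas L {..<length b} \<and> divides L N \<theta> b \<and>
       set (map h b) \<subseteq> univ M \<and> same_diagram (map h b) N b"
    "\<And>a. a \<in> univ M \<Longrightarrow> satisfies M a \<phi> \<Longrightarrow> \<exists>(\<theta>, b) \<in> D. satisfies M a (inst \<theta> (map h b))"
    by (rule forks_in_M[OF ee \<phi> forks]) (rule that)
  have "finite (\<Union>(\<theta>, b)\<in>D. set (map h b))" using D(1) by auto
  \<comment> \<open>The solution must avoid the parameters of the dividing formulas, since
    \<open>sunflower_realisation\<close> asks that \<open>c\<close> is not an entry of its tuple;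
    infinitude provides it.\<close>
  then obtain c where c: "c \<in> defined_set M \<phi>" "c \<notin> (\<Union>(\<theta>, b)\<in>D. set (map h b))"
    using inf by (meson finite_subset subsetI)
  then have cM: "c \<in> univ M" and "satisfies M c \<phi>" by (auto simp: defined_set_def)
  then obtain \<theta> b where b: "(\<theta>, b) \<in> D" "satisfies M c (inst \<theta> (map h b))" using D(3) by blast
  define b' where "b' = map h b"
  note Db = D(2)[OF b(1), folded b'_def]
  have cb: "c \<notin> set b'" using c(2) b(1) by (auto simp: b'_def)
  have len: "length b' = length b" by (simp add: b'_def)
  have div: "divides L N \<theta> b" using Db by blast
  from div[unfolded divides_def] obtain q and bs :: "nat \<Rightarrow> 'a list" where
      bs': "\<forall>i. length (bs i) = length b \<and> set (bs i) \<subseteq> univ N \<and> tuple_type L N (bs i) = tuple_type L N b"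
    and inc': "\<forall>J. finite J \<longrightarrow> card J = q \<longrightarrow> \<not> (\<exists>a \<in> univ N. \<forall>i \<in> J. satisfies N a (inst \<theta> (bs i)))"
    by (elim exE conjE) (rule that)
  note bs = bs'[rule_format] and inc = inc'[rule_format]
  obtain Y where Y: "infinite Y"
    "\<And>i j s u l. i \<in> Y \<Longrightarrow> j \<in> Y \<Longrightarrow> i \<noteq> j \<Longrightarrow> s < length b \<Longrightarrow> u < length b \<Longrightarrow> bs i ! s = bs j ! u \<Longrightarrow> l \<in> Y \<Longrightarrow>
      bs l ! s = bs i ! s"
    using uniform_coincidences[of "length b" bs] by blast
  obtain I where I: "finite I" "card I = q" "I \<subseteq> Y" using infinite_arbitrarily_large[OF Y(1)] by blast
  have Dbs: "set b \<subseteq> univ N" "\<theta> \<in> x_formulas L {..<length b}" "set b' \<subseteq> univ M" "same_diagram b' N b"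
    using Db by blast+
  obtain h' where inj: "inj_on h' (\<Union>i\<in>I. set (bs i))"
    and g': "\<forall>i \<in> I. \<exists>g. automorphism M g \<and> map g b' = map h' (bs i)"
    and incM': "\<forall>J. J \<subseteq> I \<longrightarrow> card J = q \<longrightarrow> \<not> (\<exists>a \<in> univ M. \<forall>i \<in> J. satisfies M a (inst \<theta> (map h' (bs i))))"
    by (rule divides_in_M[OF ee Dbs bs' inc' I(1)]) (rule that)
  note g = g'[rule_format] and incM = incM'[rule_format]
  have "\<exists>d \<in> univ M - (\<Union>i\<in>I. set (map h' (bs i))). \<forall>i \<in> I. \<exists>f. automorphism M f \<and> map f b' = map h' (bs i) \<and> f c = d"
  proof (rule sunflower_realisation[OF amalg _ cM cb I(1) g])
    show "set b' \<subseteq> univ M" using Db by blast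
    fix i j l s assume i: "i \<in> I" and j: "j \<in> I" and ij: "i \<noteq> j" and s: "s < length b'"
      and mem: "map h' (bs i) ! s \<in> set (map h' (bs j))" and l: "l \<in> I"
    have lens: "length (bs x) = length b" for x using bs by blast
    obtain u where u: "u < length b" "map h' (bs i) ! s = h' (bs j ! u)"
      using mem lens[of j] by (auto simp: in_set_conv_nth)
    have sb: "s < length b" using s len by simp
    have "h' (bs i ! s) = h' (bs j ! u)" using u sb lens[of i] by simp
    moreover have "bs i ! s \<in> (\<Union>i\<in>I. set (bs i))" "bs j ! u \<in> (\<Union>i\<in>I. set (bs i))"
      using i j sb u(1) lens nth_mem by (metis UN_I)+
    \<comment> \<open>Injectivity of \<open>h'\<close> brings the coincidence back to
      \<open>N\<close>, where the sunflower property was obtained.\<close>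
    ultimately have "bs i ! s = bs j ! u" using inj unfolding inj_on_def by blast
    then have "bs l ! s = bs i ! s" using Y(2)[of i j s u l] i j l ij sb u(1) I(3) by blast
    then show "map h' (bs l) ! s = map h' (bs i) ! s" using sb lens by simp
  qed
  then obtain d where d\<^sub>0: "d \<in> univ M - (\<Union>i\<in>I. set (map h' (bs i)))"
    and d': "\<forall>i \<in> I. \<exists>f. automorphism M f \<and> map f b' = map h' (bs i) \<and> f c = d"
    by (elim bexE) (rule that)
  note d = DiffD1[OF d\<^sub>0] d'[rule_format]
  have form: "inst \<theta> b' \<in> x_formulas L (univ M)" using Db len by (intro inst_in_formulas[of _ _ _ "length b"]) auto
  have "satisfies M d (inst \<theta> (map h' (bs i)))" if i: "i \<in> I" for i
  proof -
    from d(2)[OF i] obtain f where f: "automorphism M f" "map f b' = map h' (bs i)" "f c = d" by blast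
    have "map_fm id f (inst \<theta> b') = inst \<theta> (map f b')"
      using Db len by (intro map_fm_inst) (auto simp: formulas_def)
    then show ?thesis using satisfies_automorphism[OF f(1) form cM] b(2) f by (simp add: b'_def)
  qed
  then show False using incM[OF order_refl I(2)] d(1) by blast
qed

text \<open>All points of \<open>M\<close> have the same type, so \<open>x = a\<close> divides along
  any sequence of distinct points, and a formula with finitely many solutions is a finite
  disjunction of such equations.\<close>

lemma finite_forks:
  assumes inf: "infinite (univ M)" and ee: "elementary_extension L M N"
    and \<phi>: "\<phi> \<in> x_formulas L (univ M)" and fin: "finite (defined_set M \<phi>)"
  shows "forks L N \<phi>"
proof -
  have MN: "univ M \<subseteq> univ N" using ee by (simp add: elementary_extension_def)
  define \<theta> where "\<theta> = (Eq (Var 0) (Par 0) :: ('r, nat) fm)"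
  have \<theta>: "inst \<theta> [a] = Eq (Var 0) (Par a)" for a by (simp add: \<theta>_def inst_def)
  define D where "D = (\<lambda>a. (\<theta>, [a])) ` defined_set M \<phi>"
  obtain e :: "nat \<Rightarrow> 'a" where e: "inj e" "range e \<subseteq> univ M" using infinite_countable_subset[OF inf] by blast
  have tt: "tuple_type L N [x] = tuple_type L N [y]" if xy: "x \<in> univ M" "y \<in> univ M" for x y
  proof -
    obtain g where g: "automorphism M g" "g x = y" using point_transitive[OF xy] by metis
    have "true_in N (inst \<eta> [x]) \<longleftrightarrow> true_in N (inst \<eta> [y])" if \<eta>: "\<eta> \<in> sentences L {..<1}" for \<eta>
    proof -
      have ix: "inst \<eta> [x] \<in> sentences L (univ M)" "inst \<eta> [y] \<in> sentences L (univ M)"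
        using inst_in_formulas[OF \<eta>, of "[x]"] inst_in_formulas[OF \<eta>, of "[y]"] xy by auto
      have gx: "map_fm id g (inst \<eta> [x]) = inst \<eta> [y]"
        using map_fm_inst[of \<eta> "[x]" g] \<eta> g(2) by (auto simp: formulas_def)
      have "sat M (\<lambda>i. g x) (map_fm id g (inst \<eta> [x])) \<longleftrightarrow> sat M (\<lambda>i. x) (inst \<eta> [x])"
        using sat_automorphism[OF g(1), of "inst \<eta> [x]" "\<lambda>_. x"] ix xy by (auto simp: formulas_def)
      then have "true_in M (inst \<eta> [y]) \<longleftrightarrow> true_in M (inst \<eta> [x])"
        unfolding gx using true_in_sentence ix by (metis (mono_tags, lifting) empty_subsetI formulas_def mem_Collect_eq subset_antisym)
      then show ?thesis using elementary_true_in[OF ee nonempty] ix by blast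
    qed
    then show ?thesis by (auto simp: tuple_type_def)
  qed
  have div: "divides L N \<theta> [a]" if a: "a \<in> univ M" for a
    unfolding divides_def
  proof (intro exI[of _ 2] exI[of _ "\<lambda>i. [e i]"] conjI allI impI)
    show "length [e i] = length [a]" "set [e i] \<subseteq> univ N" "tuple_type L N [e i] = tuple_type L N [a]" for i
      using e(2) MN tt[of "e i" a] a by auto
    fix I :: "nat set" assume "finite I" "card I = 2"
    then obtain i j where "i \<in> I" "j \<in> I" "i \<noteq> j" by (metis card_2_iff')
    then show "\<not> (\<exists>x\<in>univ N. \<forall>i\<in>I. satisfies N x (inst \<theta> [e i]))"
      using inj_eq[OF e(1)] unfolding \<theta> by (metis satisfies_simps(3) tm_val.simps)
  qed
  obtain as where as: "set as = defined_set M \<phi>" using finite_list[OF fin] by blast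
  \<comment> \<open>By elementarity \<open>\<phi>\<close> acquires no new solutions in
    \<open>N\<close>; this is the sentence that says so when negated.\<close>
  define \<psi> where "\<psi> = Conj \<phi> (conjs (map (\<lambda>a. Neg (Eq (Var 0) (Par a))) as))"
  have dM: "defined_set M \<phi> \<subseteq> univ M" by (auto simp: defined_set_def)
  have "conjs (map (\<lambda>a. Neg (Eq (Var 0) (Par a))) as) \<in> x_formulas L (univ M)"
    by (rule conjs_in_formulas) (use as dM in \<open>auto simp: formulas_def\<close>)
  then have \<psi>: "\<psi> \<in> x_formulas L (univ M)" using \<phi> by (simp add: \<psi>_def)
  then have fv: "free_vars \<psi> \<subseteq> {0}" by (simp add: formulas_def)
  have "\<not> true_in M (Ex 0 \<psi>)"
    unfolding true_in_Ex[OF fv] using as by (auto simp: \<psi>_def defined_set_def)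
  then have nN: "\<not> true_in N (Ex 0 \<psi>)" using elementary_true_in[OF ee nonempty Ex_in_sentences[OF \<psi>]] by simp
  show ?thesis
    unfolding forks_def
  proof (intro exI[of _ D] conjI ballI impI)
    show "finite D" using fin by (simp add: D_def)
    show "case d of (\<theta>, b) \<Rightarrow> set b \<subseteq> univ N \<and> \<theta> \<in> x_formulas L {..<length b} \<and> divides L N \<theta> b" if "d \<in> D" for d
      using that dM MN div by (auto simp: D_def \<theta>_def formulas_def)
    fix a assume "a \<in> univ N" "satisfies N a \<phi>"
    then have "a \<in> set as" using nN unfolding true_in_Ex[OF fv] by (auto simp: \<psi>_def)
    then have "(\<theta>, [a]) \<in> D" using as by (auto simp: D_def)
    moreover have "satisfies N a (inst \<theta> [a])" by (simp add: \<theta>)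
    ultimately show "\<exists>(\<theta>, b)\<in>D. satisfies N a (inst \<theta> b)" by blast
  qed
qed

end

section \<open>Failure of amalgamation\<close>

context homogeneous_structure
begin

text \<open>The labellings \<open>e\<close> and \<open>f\<close> are unrelated: the relations of a
  new point to a finite set can be chosen without regard to the relations inside that set.\<close>

definition transferable :: bool where
  "transferable \<longleftrightarrow> (\<forall>(V :: nat set) e f c. finite V \<longrightarrow> inj_on e V \<longrightarrow> e ` V \<subseteq> univ M \<longrightarrow>
     inj_on f V \<longrightarrow> f ` V \<subseteq> univ M \<longrightarrow> c \<in> univ M - e ` V \<longrightarrow>
     (\<exists>d \<in> univ M - f ` V. pattern f V d = pattern e V c))"

lemma age_finite: "S \<in> age L M \<Longrightarrow> finite (univ S)"
  and age_structure: "S \<in> age L M \<Longrightarrow> is_structure L S"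
  by (auto simp: age_def)

lemma age_induced: "S \<in> age L M \<Longrightarrow> induced S W \<in> age L M"
proof -
  assume S: "S \<in> age L M"
  then obtain f where f: "inj_on f (univ S)" "f ` univ S \<subseteq> univ M" "S = pullback M f (univ S)"
    unfolding age_iff[OF struct] by blast
  have "induced S W = pullback M f (univ S \<inter> W)" using f(3) induced_pullback by metis
  moreover have "inj_on f (univ S \<inter> W)" using f(1) by (rule inj_on_subset) simp
  ultimately show ?thesis
    using pullback_in_age[OF struct, of "univ S \<inter> W" f] f(2) age_finite[OF S] by auto
qed

lemma structure_tuple:
  assumes "is_structure L S" "t \<in> interp S R"
  shows "length t = k + 1" "set t \<subseteq> univ S" "distinct t" "card (set t) = k + 1" "L R = Some (k + 1)"
proof -
  note * = is_structureD[OF assms]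
  show 1: "length t = k + 1" "set t \<subseteq> univ S" "distinct t" "L R = Some (k + 1)"
    using * arity[OF *(1)] by auto
  show "card (set t) = k + 1" using distinct_card[OF 1(3)] 1(1) by simp
qed

text \<open>Relations on tuples through the label \<open>x\<close> are exactly the atoms of the
  pattern of \<open>d\<close>, with \<open>Var 0\<close> in place of \<open>x\<close>. Thus adding a
  vertex to a labelling amounts to choosing a pattern.\<close>

lemma pattern_extension:
  assumes "x \<in> set t" "set t \<subseteq> insert x V" "x \<notin> V"
  shows "map (f(x := d)) t \<in> interp M R \<longleftrightarrow>
    (R, map (\<lambda>v. if v = x then Var 0 else Par v) t) \<in> pattern f V d"
    (is "?l \<longleftrightarrow> (R, ?ts) \<in> _")
proof -
  have eq: "map (tm_val (\<lambda>_. d)) (map (map_tm f) ?ts) = map (f(x := d)) t" by simp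
  have "(R, ?ts) \<in> atoms V" if ?l
  proof -
    note * = interpD[OF that]
    have "distinct t" "length t = k + 1" using *(2,4) by (auto simp: distinct_map)
    moreover have "inj_on (\<lambda>v. if v = x then Var 0 else Par v :: 'b tm) (set t)"
      by (rule inj_onI) (auto split: if_splits)
    ultimately show ?thesis using *(5) assms
      by (auto simp: atoms_def atom_lists_def distinct_map image_iff)
  qed
  moreover have "(R, ?ts) \<in> pattern f V d \<longleftrightarrow> (R, ?ts) \<in> atoms V \<and> ?l"
    unfolding pattern_def mem_Collect_eq case_prod_conv satisfies_simps eq ..
  ultimately show ?thesis by blast
qed

text \<open>The pattern that \<open>x\<close> has in \<open>S'\<close> is realised, by
  transferability, over a copy of \<open>S\<close> without \<open>x\<close>, even though
  \<open>S\<close> and \<open>S'\<close> may differ away from \<open>x\<close>.\<close>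

lemma extend_in_age:
  assumes tr: transferable and x: "x \<in> V" and S: "is_structure L S" "univ S = V"
    and S': "S' \<in> age L M" "univ S' = V" and del: "induced S (V - {x}) \<in> age L M"
    and agree: "\<And>R t. x \<in> set t \<Longrightarrow> t \<in> interp S R \<longleftrightarrow> t \<in> interp S' R"
  shows "S \<in> age L M"
proof -
  let ?W = "V - {x}"
  obtain f' where f': "inj_on f' V" "f' ` V \<subseteq> univ M" "S' = pullback M f' V"
    using S' unfolding age_iff[OF struct] by blast
  have "univ (induced S ?W) = ?W" using S(2) by auto
  then obtain f where f: "inj_on f ?W" "f ` ?W \<subseteq> univ M" "induced S ?W = pullback M f ?W"
    using del unfolding age_iff[OF struct] by metis
  have V: "finite V" using age_finite[OF S'(1)] S'(2) by simp
  have e: "inj_on f' ?W" "f' ` ?W \<subseteq> univ M" using f'(1,2) by (auto intro: inj_on_subset)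
  have c: "f' x \<in> univ M - f' ` ?W" using f'(1,2) x by (auto simp: inj_on_def)
  have "\<exists>d \<in> univ M - f ` ?W. pattern f ?W d = pattern f' ?W (f' x)"
    using tr[unfolded transferable_def, rule_format, OF _ e f(1,2) c] V by blast
  then obtain d where d: "d \<in> univ M - f ` ?W" "pattern f ?W d = pattern f' ?W (f' x)" by (elim bexE) (rule that)
  have VW: "V = insert x ?W" using x by blast
  have "inj_on (f(x := d)) V"
  proof -
    have "inj_on (f(x := d)) ?W" using f(1) inj_on_cong[of ?W "f(x := d)" f] by simp
    moreover have "(f(x := d)) ` ?W = f ` ?W" by (rule image_cong) auto
    ultimately have "inj_on (f(x := d)) (insert x ?W)" unfolding inj_on_insert using d(1) by simp
    then show ?thesis using VW by metis
  qed
  moreover have "(f(x := d)) ` V \<subseteq> univ M" using f(2) d(1) by auto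
  moreover have "S = pullback M (f(x := d)) V"
  proof (rule rstruct_eqI)
    show "univ S = univ (pullback M (f(x := d)) V)" using S(2) by simp
    fix R
    have "t \<in> interp S R \<longleftrightarrow> map (f(x := d)) t \<in> interp M R" if t: "set t \<subseteq> V" for t
    proof (cases "x \<in> set t")
      case True
      have tW: "set t \<subseteq> insert x ?W" using t by blast
      have "t \<in> interp S R \<longleftrightarrow> t \<in> interp (pullback M f' V) R" using agree[OF True] f'(3) by simp
      also have "\<dots> \<longleftrightarrow> map (f'(x := f' x)) t \<in> interp M R" using t by simp
      also have "\<dots> \<longleftrightarrow> (R, map (\<lambda>v. if v = x then Var 0 else Par v) t) \<in> pattern f' ?W (f' x)"
        by (rule pattern_extension[OF True tW]) simp
      also have "\<dots> \<longleftrightarrow> (R, map (\<lambda>v. if v = x then Var 0 else Par v) t) \<in> pattern f ?W d" using d(2) by simp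
      also have "\<dots> \<longleftrightarrow> map (f(x := d)) t \<in> interp M R"
        by (rule pattern_extension[OF True tW, symmetric]) simp
      finally show ?thesis .
    next
      case False
      then have tW: "set t \<subseteq> ?W" using t by blast
      then have "t \<in> interp S R \<longleftrightarrow> t \<in> interp (induced S ?W) R" by simp
      also have "\<dots> \<longleftrightarrow> t \<in> interp (pullback M f ?W) R" using f(3) by simp
      also have "\<dots> \<longleftrightarrow> map f t \<in> interp M R" using tW by simp
      also have "map f t = map (f(x := d)) t" using False by auto
      finally show ?thesis .
    qed
    then show "interp S R = interp (pullback M (f(x := d)) V) R"
      using structure_tuple(2)[OF S(1)] S(2) by auto
  qed
  ultimately show ?thesis using pullback_in_age[OF struct V, of "f(x := d)"] by simp
qed

lemma injection_into_univ:
  assumes inf: "infinite (univ M)" and V: "finite V"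
  obtains s where "inj_on s V" "s ` V \<subseteq> univ M"
proof -
  obtain F where F: "finite F" "card F = card V" "F \<subseteq> univ M" using infinite_arbitrarily_large[OF inf] by blast
  obtain s where "bij_betw s V F" using finite_same_card_bij[OF V F(1)] F(2) by auto
  then show ?thesis using that F(3) by (auto simp: bij_betw_def)
qed

text \<open>The relations of a structure, all of whose subsets of size \<open>k + 1\<close> are allowed, are replaced by
  those of a member of the age, first on the sets missing a vertex \<open>x\<^sub>1\<close>, then on those missing
  \<open>x\<^sub>2\<close>, and so on. Transferability shows that no step changes membership in the age.\<close>

lemma locally_in_age:
  assumes tr: transferable and inf: "infinite (univ M)"
  shows "is_structure L S \<Longrightarrow> finite (univ S) \<Longrightarrow>
    (\<And>e. e \<subseteq> univ S \<Longrightarrow> card e = k + 1 \<Longrightarrow> induced S e \<in> age L M) \<Longrightarrow> (S :: ('r, nat) rstruct) \<in> age L M"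
proof (induction "card (univ S)" arbitrary: S rule: less_induct)
  case less
  note S = less.prems(1,2) and loc = less.prems(3)
  define V where "V = univ S"
  have V: "finite V" using S(2) by (simp add: V_def)
  obtain s where s: "inj_on s V" "s ` V \<subseteq> univ M" using injection_into_univ[OF inf V] by metis
  define P where "P = pullback M s V"
  have P: "P \<in> age L M" unfolding P_def using pullback_in_age[OF struct V s] .
  have PS: "is_structure L P" by (rule age_structure[OF P])
  have uP: "univ P = V" by (simp add: P_def)
  consider "card V \<le> k" | "card V = k + 1" | "card V > k + 1" by linarith
  then show ?case
  proof cases
    case 1
    have none: "interp T R = {}" if T: "is_structure L T" "univ T = V" for T :: "('r, nat) rstruct" and R
    proof (rule ccontr)
      assume "interp T R \<noteq> {}"
      then obtain t where "t \<in> interp T R" by blast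
      note * = structure_tuple[OF T(1) this]
      have "card (set t) \<le> card V" using card_mono[OF V] *(2) T(2) by simp
      then show False using *(4) 1 by simp
    qed
    have "S = P" using none[OF S(1)] none[OF PS uP] uP by (intro rstruct_eqI) (auto simp: V_def)
    then show ?thesis using P by simp
  next
    case 2
    then show ?thesis using loc[of V] induced_univ[OF S(1)] by (simp add: V_def)
  next
    case 3
    \<comment> \<open>The interpolation from \<open>Hyb {} = S\<close> to \<open>Hyb V = P\<close>.
      The latter holds because a related tuple has \<open>k + 1 < card V\<close> entries and cannot
      cover \<open>V\<close>.\<close>
    define Hyb where "Hyb X = \<lparr>univ = V, interp = (\<lambda>R. {t \<in> interp S R. X \<subseteq> set t} \<union> {t \<in> interp P R. \<not> X \<subseteq> set t})\<rparr>" for X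
    have Hyb: "univ (Hyb X) = V"
      "t \<in> interp (Hyb X) R \<longleftrightarrow> (if X \<subseteq> set t then t \<in> interp S R else t \<in> interp P R)" for X R t
      by (auto simp: Hyb_def)
    have HS: "is_structure L (Hyb X)" for X
      unfolding is_structure_def
    proof (intro allI ballI)
      fix R t assume "t \<in> interp (Hyb X) R"
      then have "t \<in> interp S R \<or> t \<in> interp P R" unfolding Hyb by presburger
      then show "L R = Some (length t) \<and> set t \<subseteq> univ (Hyb X) \<and> distinct t"
        using is_structureD[OF S(1)] is_structureD[OF PS] unfolding Hyb uP V_def by blast
    qed
    have full: "set t = e" if "is_structure L T" "t \<in> interp T R" "set t \<subseteq> e" "card e = k + 1" for T :: "('r, nat) rstruct" and t R e
    proof -
      have "finite e" using that(4) card.infinite by fastforce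
      then show ?thesis using card_subset_eq[OF _ that(3)] structure_tuple(4)[OF that(1,2)] that(4) by simp
    qed
    \<comment> \<open>A related tuple inside a set \<open>e\<close> of size \<open>k + 1\<close> has
      all of \<open>e\<close> as entries, so the hybrid follows either \<open>S\<close> or
      \<open>P\<close> throughout \<open>e\<close>.\<close>
    have Hyb_e: "induced (Hyb X) e \<in> age L M" if e: "e \<subseteq> V" "card e = k + 1" for X e
    proof -
      have "induced (Hyb X) e = induced (if X \<subseteq> e then S else P) e"
      proof (rule rstruct_eqI)
        show "univ (induced (Hyb X) e) = univ (induced (if X \<subseteq> e then S else P) e)"
          using Hyb uP by (simp add: V_def)
        fix R
        have "t \<in> interp (Hyb X) R \<longleftrightarrow> t \<in> interp (if X \<subseteq> e then S else P) R" if "set t \<subseteq> e" for t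
          using full[OF S(1) _ that e(2)] full[OF PS _ that e(2)] unfolding Hyb by auto
        then show "interp (induced (Hyb X) e) R = interp (induced (if X \<subseteq> e then S else P) e) R"
          unfolding induced_sel by blast
      qed
      then show ?thesis using loc[of e] e age_induced[OF P, of e] by (simp add: V_def)
    qed
    have "Hyb X \<in> age L M \<longrightarrow> Hyb {} \<in> age L M" if "finite X" "X \<subseteq> V" for X
      using that
    proof (induction X rule: finite_induct)
      case empty
      then show ?case by simp
    next
      case (insert x X)
      show ?case
      proof
        assume H: "Hyb (insert x X) \<in> age L M"
        have "Hyb X \<in> age L M"
        \<comment> \<open>\<open>Hyb X\<close> and \<open>Hyb (insert x X)\<close> agree on all
          tuples through \<open>x\<close>, and removing \<open>x\<close> leaves a smaller structure
          that satisfies the local condition again.\<close>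
        proof (rule extend_in_age[OF tr _ HS Hyb(1) H Hyb(1)])
          show "x \<in> V" using insert.prems by simp
          show "induced (Hyb X) (V - {x}) \<in> age L M"
          proof (rule less.hyps)
            have u: "univ (induced (Hyb X) (V - {x})) = V - {x}" using Hyb by auto
            show "card (univ (induced (Hyb X) (V - {x}))) < card (univ S)"
              unfolding u V_def[symmetric] using V \<open>x \<in> V\<close> by (rule card_Diff1_less)
            show "is_structure L (induced (Hyb X) (V - {x}))" by (rule is_structure_induced[OF HS])
            show "finite (univ (induced (Hyb X) (V - {x})))" unfolding u using V by simp
            fix e assume e: "e \<subseteq> univ (induced (Hyb X) (V - {x}))" "card e = k + 1"
            then have eV: "e \<subseteq> V - {x}" unfolding u by simp
            then have "induced (induced (Hyb X) (V - {x})) e = induced (Hyb X) e"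
              by (intro rstruct_eqI) (auto simp: Hyb)
            then show "induced (induced (Hyb X) (V - {x})) e \<in> age L M"
              using Hyb_e[of e X] eV e(2) by auto
          qed
          show "t \<in> interp (Hyb X) R \<longleftrightarrow> t \<in> interp (Hyb (insert x X)) R" if "x \<in> set t" for R t
            unfolding Hyb using that by simp
        qed
        then show "Hyb {} \<in> age L M" using insert.IH insert.prems by blast
      qed
    qed
    from this[OF V order_refl] have imp: "Hyb V \<in> age L M \<Longrightarrow> Hyb {} \<in> age L M" by blast
    have "Hyb V = P"
    proof (rule rstruct_eqI)
      have "\<not> V \<subseteq> set t" if "t \<in> interp S R \<or> t \<in> interp P R" for t R
      proof
        assume "V \<subseteq> set t"
        then have "card V \<le> card (set t)" by (intro card_mono) auto
        then show False using structure_tuple(4)[OF S(1), of t R] structure_tuple(4)[OF PS, of t R] that 3 by auto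
      qed
      then show "interp (Hyb V) R = interp P R" for R unfolding set_eq_iff Hyb by auto
    qed (simp add: Hyb uP)
    moreover have "Hyb {} = S" by (rule rstruct_eqI) (auto simp: Hyb V_def)
    ultimately show ?thesis using imp P by simp
  qed
qed

text \<open>Keep the given relations inside the faces and fill in the rest from any member of the
  age. A set of size \<open>k + 1\<close> lies in a face or takes its relations from the filler, so
  membership in the age follows from the local criterion.\<close>

lemma disjoint_amalgamation_of_transferable:
  assumes tr: transferable and inf: "infinite (univ M)"
  shows "disjoint_amalgamation n (age L M)"
  unfolding disjoint_amalgamation_def
proof (intro allI impI)
  fix m A K B assume prob: "amalgamation_problem n (age L M) m A K B"
  define W where "W I = {1..m} \<union> (\<Union>i \<in> I. K i)" for I
  note P = prob[unfolded amalgamation_problem_def, folded W_def]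
  have K: "\<And>i. i \<in> {1..n} \<Longrightarrow> finite (K i)"
    using P[THEN conjunct2, THEN conjunct2, THEN conjunct1] by simp
  have disj: "disjoint_family_on K {1..n}"
    using P[THEN conjunct2, THEN conjunct2, THEN conjunct2, THEN conjunct1] .
  note BP = P[THEN conjunct2, THEN conjunct2, THEN conjunct2, THEN conjunct2, THEN conjunct1, rule_format]
  have B: "B I \<in> age L M" "univ (B I) = W I" if "I \<subset> {1..n}" for I using BP[OF that] by simp_all
  note BB = P[THEN conjunct2, THEN conjunct2, THEN conjunct2, THEN conjunct2, THEN conjunct2, rule_format]
  define V where "V = W {1..n}"
  have V: "finite V" unfolding V_def W_def using K by auto
  have WV: "W I \<subseteq> V" if "I \<subset> {1..n}" for I using that by (auto simp: V_def W_def)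
  have WI: "W I \<inter> W J = W (I \<inter> J)" if "I \<subset> {1..n}" "J \<subset> {1..n}" for I J
  proof (intro equalityI subsetI)
    fix v assume v: "v \<in> W I \<inter> W J"
    show "v \<in> W (I \<inter> J)"
    proof (cases "v \<in> {1..m}")
      case False
      then obtain i j where ij: "i \<in> I" "v \<in> K i" "j \<in> J" "v \<in> K j" using v by (auto simp: W_def)
      then have "i = j" using disj that unfolding disjoint_family_on_def by blast
      then show ?thesis using ij by (auto simp: W_def)
    qed (simp add: W_def)
  qed (auto simp: W_def)
  have cons: "t \<in> interp (B I) R \<longleftrightarrow> t \<in> interp (B J) R"
    if I: "I \<subset> {1..n}" and J: "J \<subset> {1..n}" and t: "set t \<subseteq> W I" "set t \<subseteq> W J" for I J t R
  proof -
    have tIJ: "set t \<subseteq> W (I \<inter> J)" using t WI[OF I J] by blast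
    have "interp (induced (B I) (W (I \<inter> J))) R = interp (induced (B J) (W (I \<inter> J))) R" using BB[OF I J] by simp
    then show ?thesis using tIJ by (auto simp: set_eq_iff)
  qed
  obtain s where s: "inj_on s V" "s ` V \<subseteq> univ M" using injection_into_univ[OF inf V] by metis
  \<comment> \<open>The filler is a member of the age and not the empty structure, because sets of
    size \<open>k + 1\<close> without relations may be forbidden.\<close>
  define Q where "Q = pullback M s V"
  have Q: "Q \<in> age L M" unfolding Q_def using pullback_in_age[OF struct V s] .
  define S where "S = \<lparr>univ = V, interp = (\<lambda>R. {t. set t \<subseteq> V \<and>
      (if \<exists>I. I \<subset> {1..n} \<and> set t \<subseteq> W I then \<exists>I. I \<subset> {1..n} \<and> set t \<subseteq> W I \<and> t \<in> interp (B I) R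
       else t \<in> interp Q R)})\<rparr>"
  have uS: "univ S = V" by (simp add: S_def)
  have inB: "t \<in> interp S R \<longleftrightarrow> t \<in> interp (B I) R" if I: "I \<subset> {1..n}" and t: "set t \<subseteq> W I" for t R I
  proof -
    have ex: "\<exists>J. J \<subset> {1..n} \<and> set t \<subseteq> W J" using I t by blast
    have tV: "set t \<subseteq> V" using t WV[OF I] by (rule subset_trans)
    have 1: "t \<in> interp S R \<longleftrightarrow> (\<exists>J. J \<subset> {1..n} \<and> set t \<subseteq> W J \<and> t \<in> interp (B J) R)"
      unfolding S_def by (simp only: rstruct.simps mem_Collect_eq if_P[OF ex] tV simp_thms)
    show ?thesis
    proof
      assume "t \<in> interp S R"
      then obtain J where J: "J \<subset> {1..n}" "set t \<subseteq> W J" "t \<in> interp (B J) R" unfolding 1 by (elim exE conjE) (rule that)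
      then show "t \<in> interp (B I) R" using cons[OF I J(1) t J(2)] by simp
    next
      assume "t \<in> interp (B I) R"
      then show "t \<in> interp S R" unfolding 1 using I t by (intro exI[of _ I] conjI)
    qed
  qed
  have inQ: "t \<in> interp S R \<longleftrightarrow> t \<in> interp Q R" if "set t \<subseteq> V" "\<not> (\<exists>I. I \<subset> {1..n} \<and> set t \<subseteq> W I)" for t R
    unfolding S_def by (simp only: rstruct.simps mem_Collect_eq if_not_P[OF that(2)] that(1) simp_thms)
  have sub: "set t \<subseteq> V" if "t \<in> interp S R" for t R using that by (simp add: S_def)
  have ind: "induced S (W I) = B I" if I: "I \<subset> {1..n}" for I
  proof (rule rstruct_eqI)
    show "univ (induced S (W I)) = univ (B I)" using B(2)[OF I] WV[OF I] uS by auto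
    fix R
    have "set t \<subseteq> W I" if "t \<in> interp (B I) R" for t
      using structure_tuple(2)[OF age_structure[OF B(1)[OF I]] that] B(2)[OF I] by simp
    then show "interp (induced S (W I)) R = interp (B I) R" using inB[OF I] by auto
  qed
  have SS: "is_structure L S"
    unfolding is_structure_def uS
  proof (intro allI ballI)
    fix R t assume t: "t \<in> interp S R"
    show "L R = Some (length t) \<and> set t \<subseteq> V \<and> distinct t"
    proof (cases "\<exists>I. I \<subset> {1..n} \<and> set t \<subseteq> W I")
      case True
      then obtain I where I: "I \<subset> {1..n}" "set t \<subseteq> W I" by blast
      then have "t \<in> interp (B I) R" using t inB by blast
      then show ?thesis using is_structureD[OF age_structure[OF B(1)[OF I(1)]]] sub[OF t] by blast
    next
      case False
      then have "t \<in> interp Q R" using t inQ[OF sub[OF t]] by simp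
      then show ?thesis using is_structureD[OF age_structure[OF Q]] sub[OF t] by blast
    qed
  qed
  have "S \<in> age L M"
  proof (rule locally_in_age[OF tr inf SS])
    show "finite (univ S)" using V uS by simp
    fix e assume e: "e \<subseteq> univ S" "card e = k + 1"
    show "induced S e \<in> age L M"
    proof (cases "\<exists>I. I \<subset> {1..n} \<and> e \<subseteq> W I")
      case True
      then obtain I where I: "I \<subset> {1..n}" "e \<subseteq> W I" by blast
      then have "induced S e = induced (induced S (W I)) e"
        by (intro rstruct_eqI) auto
      then show ?thesis unfolding ind[OF I(1)] using age_induced[OF B(1)[OF I(1)]] by simp
    next
      \<comment> \<open>No face contains \<open>e\<close>, so any relation on all of
        \<open>e\<close> comes from \<open>Q\<close>; tuples covering only part of \<open>e\<close>
        carry no relation.\<close>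
      case False
      have fin: "finite e" using e(2) card.infinite by fastforce
      have full: "set t = e" if "is_structure L T" "t \<in> interp T R" "set t \<subseteq> e" for T :: "('r, nat) rstruct" and t R
        using card_subset_eq[OF fin that(3)] structure_tuple(4)[OF that(1,2)] e(2) by simp
      have "induced S e = induced Q e"
      proof (rule rstruct_eqI)
        show "univ (induced S e) = univ (induced Q e)" using uS by (simp add: Q_def)
        fix R
        have "t \<in> interp S R \<longleftrightarrow> t \<in> interp Q R" if t: "set t \<subseteq> e" for t
        proof (cases "set t = e")
          case True
          have "\<not> (\<exists>I. I \<subset> {1..n} \<and> set t \<subseteq> W I)" unfolding True by (rule False)
          then show ?thesis using inQ[of t R] True e(1) uS by simp
        next
          case False
          then show ?thesis using full[OF SS _ t] full[OF age_structure[OF Q] _ t] by blast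
        qed
        then show "interp (induced S e) R = interp (induced Q e) R" by auto
      qed
      then show ?thesis using age_induced[OF Q] by simp
    qed
  qed
  then show "\<exists>S\<in>age L M. univ S = {1..m} \<union> \<Union> (K ` {1..n}) \<and>
      (\<forall>I. I \<subset> {1..n} \<longrightarrow> induced S ({1..m} \<union> \<Union> (K ` I)) = B I)"
    using uS ind by (intro bexI[of _ S]) (auto simp: V_def W_def)
qed

text \<open>Exchangeability in terms of labellings: enumerating \<open>V\<close> by
  \<open>\<beta>\<close> brings the formula and both labellings into the form of tuples.\<close>

lemma exchangeable_maps:
  assumes ex: "exchangeable L M \<mu>" and V: "finite V"
    and e: "inj_on e V" "e ` V \<subseteq> univ M" and f: "inj_on f V" "f ` V \<subseteq> univ M"
    and \<phi>: "\<phi> \<in> x_formulas L V" "atoms_mention_x \<phi>"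
  shows "measure \<mu> (types_containing L M (map_fm id e \<phi>)) = measure \<mu> (types_containing L M (map_fm id f \<phi>))"
proof -
  define n where "n = card V"
  obtain \<beta> where \<beta>: "bij_betw \<beta> V {0..<n}" using ex_bij_betw_finite_nat[OF V] by (auto simp: n_def)
  define \<gamma> where "\<gamma> = inv_into V \<beta>"
  have \<gamma>: "bij_betw \<gamma> {0..<n} V" unfolding \<gamma>_def by (rule bij_betw_inv_into[OF \<beta>])
  have \<gamma>\<beta>: "\<gamma> (\<beta> v) = v" if "v \<in> V" for v
    unfolding \<gamma>_def using \<beta> that by (simp add: bij_betw_def)
  define l where "l h = map (\<lambda>i. h (\<gamma> i)) [0..<n]" for h :: "'b \<Rightarrow> 'a"
  have l: "length (l h) = n" "distinct (l h)" "set (l h) \<subseteq> univ M" "inst (map_fm id \<beta> \<phi>) (l h) = map_fm id h \<phi>"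
    if h: "inj_on h V" "h ` V \<subseteq> univ M" for h
  proof -
    show "length (l h) = n" by (simp add: l_def)
    have "inj_on (\<lambda>i. h (\<gamma> i)) {0..<n}"
      using comp_inj_on[of \<gamma> "{0..<n}" h] \<gamma> h(1) by (simp add: bij_betw_def comp_def)
    then show "distinct (l h)" by (simp add: l_def distinct_map)
    show "set (l h) \<subseteq> univ M" using h(2) \<gamma> by (auto simp: l_def bij_betw_def)
    show "inst (map_fm id \<beta> \<phi>) (l h) = map_fm id h \<phi>"
      unfolding inst_def map_fm_compose
    proof (rule map_fm_cong_params)
      fix v assume "v \<in> params \<phi>"
      then have v: "v \<in> V" using \<phi>(1) by (auto simp: formulas_def)
      then have "\<beta> v < n" using \<beta> by (auto simp: bij_betw_def)
      then show "l h ! \<beta> v = h v" using \<gamma>\<beta>[OF v] by (simp add: l_def)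
    qed
  qed
  have form: "map_fm id \<beta> \<phi> \<in> x_formulas L {..<n}"
    using \<phi>(1) \<beta> by (intro map_fm_in_formulas) (auto simp: bij_betw_def)
  have mention: "atoms_mention_x (map_fm id \<beta> \<phi>)" using \<phi>(2) by (simp add: atoms_mention_x_map)
  show ?thesis
    using ex[unfolded exchangeable_def, rule_format, OF l(1)[OF e] l(1)[OF f] l(2)[OF e] l(2)[OF f] l(3)[OF e] l(3)[OF f] form mention]
    unfolding l(4)[OF e] l(4)[OF f] .
qed

text \<open>If a pattern occurs over \<open>e\<close> but not over \<open>f\<close>, the formula
  describing it has no solutions over \<open>f\<close>. By exchangeability it is null over
  \<open>e\<close> for every invariant measure, although there it has infinitely many
  solutions.\<close>

lemma infinite_measure_zero_set:
  assumes amalg2: "disjoint_amalgamation 2 (age L M)" and oc: "overlap_closed k L (age L M)"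
    and nt: "\<not> transferable"
  obtains \<phi> where "\<phi> \<in> x_formulas L (univ M)" "infinite (defined_set M \<phi>)"
    "\<And>\<mu>. invariant_keisler_measure L M \<mu> \<Longrightarrow> measure \<mu> (types_containing L M \<phi>) = 0"
proof -
  have inf: "infinite (univ M)" by (rule infinite_univ[OF amalg2])
  obtain V :: "nat set" and e f c where V: "finite V" and e: "inj_on e V" "e ` V \<subseteq> univ M"
    and f: "inj_on f V" "f ` V \<subseteq> univ M" and c: "c \<in> univ M - e ` V"
    and no': "\<not> (\<exists>d \<in> univ M - f ` V. pattern f V d = pattern e V c)"
    using nt unfolding transferable_def not_all not_imp by (elim exE conjE) (rule that)
  have no: "pattern f V d \<noteq> pattern e V c" if "d \<in> univ M - f ` V" for d using no' that by blast
  define lit where "lit = (\<lambda>(R, ts). if (R, ts) \<in> pattern e V c then Rel R ts else Neg (Rel R ts))"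
  obtain as where as: "set as = atoms V" using finite_list[OF finite_atoms[OF V]] by blast
  obtain vs where vs: "set vs = V" using finite_list[OF V] by blast
  \<comment> \<open>The pattern of \<open>c\<close> over \<open>V\<close> as one formula, with
    \<open>x\<close> different from all parameters. All its atoms mention \<open>x\<close>, as
    exchangeability requires.\<close>
  define \<psi> where "\<psi> = conjs (map lit as @ map (\<lambda>v. Neg (Eq (Var 0) (Par v))) vs)"
  have sat: "satisfies M d (map_fm id h \<psi>) \<longleftrightarrow> d \<notin> h ` V \<and> pattern h V d = pattern e V c" for d and h :: "nat \<Rightarrow> 'a"
  proof -
    have "satisfies M d (map_fm id h (lit (R, ts))) \<longleftrightarrow> ((R, ts) \<in> pattern h V d \<longleftrightarrow> (R, ts) \<in> pattern e V c)"
      if "(R, ts) \<in> atoms V" for R ts using that by (auto simp: lit_def pattern_def)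
    then have "(\<forall>x \<in> atoms V. satisfies M d (map_fm id h (lit x))) \<longleftrightarrow>
        (\<forall>x \<in> atoms V. x \<in> pattern h V d \<longleftrightarrow> x \<in> pattern e V c)" by auto
    also have "\<dots> \<longleftrightarrow> pattern h V d = pattern e V c"
      using pattern_subset[of h V d] pattern_subset[of e V c] by blast
    finally have 1: "(\<forall>x \<in> atoms V. satisfies M d (map_fm id h (lit x))) \<longleftrightarrow> pattern h V d = pattern e V c" .
    have 2: "satisfies M d (map_fm id h (Neg (Eq (Var 0) (Par v)))) \<longleftrightarrow> d \<noteq> h v" for v by simp
    have "satisfies M d (map_fm id h \<psi>) \<longleftrightarrow> (\<forall>x \<in> atoms V. satisfies M d (map_fm id h (lit x))) \<and>
        (\<forall>v \<in> V. satisfies M d (map_fm id h (Neg (Eq (Var 0) (Par v)))))"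
    proof -
      have eq: "set (map (map_fm id h) (map lit as @ map (\<lambda>v. Neg (Eq (Var 0) (Par v))) vs)) =
          (\<lambda>x. map_fm id h (lit x)) ` atoms V \<union> (\<lambda>v. map_fm id h (Neg (Eq (Var 0) (Par v)))) ` V"
        unfolding set_map set_append image_Un image_image as vs ..
      show ?thesis unfolding \<psi>_def map_fm_conjs satisfies_conjs eq ball_Un ball_simps by simp
    qed
    then show ?thesis unfolding 1 2 by blast
  qed
  have lit_form: "lit x \<in> x_formulas L V" "atoms_mention_x (lit x)" if x: "x \<in> atoms V" for x
  proof -
    obtain R ts where x': "x = (R, ts)" by (cases x)
    have ts: "R \<in> dom L" "length ts = k + 1" "Var 0 \<in> set ts" "set ts \<subseteq> insert (Var 0) (Par ` V)"
      using x by (auto simp: x' atoms_def atom_lists_def)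
    then obtain m where m: "L R = Some m" by auto
    then have "m = k + 1" by (rule arity)
    then have "Rel R ts \<in> x_formulas L V" using m ts by (fastforce simp: formulas_def)
    then show "lit x \<in> x_formulas L V" by (simp add: lit_def x')
    show "atoms_mention_x (lit x)" using ts by (simp add: lit_def x')
  qed
  have \<psi>: "\<psi> \<in> x_formulas L V"
    unfolding \<psi>_def by (rule conjs_in_formulas) (use lit_form(1) in \<open>auto simp: as vs formulas_def\<close>)
  have mention: "atoms_mention_x \<psi>"
  proof -
    have conj: "atoms_mention_x (conjs xs)" if "\<And>x. x \<in> set xs \<Longrightarrow> atoms_mention_x x" for xs :: "('r, nat) fm list"
      using that by (induction xs) (auto simp: truth_def)
    show ?thesis unfolding \<psi>_def by (rule conj) (use lit_form(2) in \<open>auto simp: as vs\<close>)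
  qed
  have form: "map_fm id e \<psi> \<in> x_formulas L (univ M)" "map_fm id f \<psi> \<in> x_formulas L (univ M)"
    using \<psi> e(2) f(2) by (auto intro: map_fm_in_formulas)
  have "infinite (defined_set M (map_fm id e \<psi>))"
  proof
    assume fin: "finite (defined_set M (map_fm id e \<psi>))"
    let ?T = "defined_set M (map_fm id e \<psi>) \<union> e ` V"
    have "finite ?T" "?T \<subseteq> univ M" "e ` V \<subseteq> ?T" "c \<in> univ M" "c \<notin> e ` V"
      using fin V e(2) c by (auto simp: defined_set_def)
    then obtain g where g: "automorphism M g" "\<And>a. a \<in> e ` V \<Longrightarrow> g a = a" "g c \<notin> ?T"
      using free_realisation[OF amalg2, of ?T "e ` V" c] by metis
    have "pattern e V (g c) = pattern e V c" using pattern_image[OF g(1) e(2), of c e] c g(2) by simp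
    moreover have "g c \<notin> e ` V" using g(3) by blast
    ultimately have "satisfies M (g c) (map_fm id e \<psi>)" unfolding sat by blast
    moreover have "g c \<in> univ M" using automorphism_in[OF g(1)] c by blast
    ultimately show False using g(3) by (simp add: defined_set_def)
  qed
  moreover have "measure \<mu> (types_containing L M (map_fm id e \<psi>)) = 0" if \<mu>: "invariant_keisler_measure L M \<mu>" for \<mu>
  proof -
    have "types_containing L M (map_fm id f \<psi>) \<subseteq> types_containing L M (Neg truth)"
      using types_containing_mono_iff[OF form(2), of "Neg truth"] no by (auto simp: sat)
    then have "types_containing L M (map_fm id f \<psi>) = {}"
      by (simp add: types_containing_Neg types_containing_truth)
    then show ?thesis
      using exchangeable_maps[OF exchangeable_of_overlap_closed[OF inf oc \<mu>] V e f \<psi> mention] by simp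
  qed
  ultimately show ?thesis using that form(1) by blast
qed

end

theorem theorem5p12:
  fixes k :: nat
    and L :: "'r language"
    and M :: "('r, 'a) rstruct"
  assumes "k \<ge> 1"
    and "finite (dom L)"
    and "\<forall>R n. L R = Some n \<longrightarrow> n = k + 1"
    and "is_structure L M"
    and "univ M \<noteq> {}"
    and "countable (univ M)"
    and "homogeneous M"
    and "tuple_transitive k M"
    and "overlap_closed k L (age L M)"
    and "disjoint_amalgamation 2 (age L M)"
    and "disjoint_amalgamation 3 (age L M)"
  shows "(\<forall>\<mu>. invariant_keisler_measure L M \<mu> \<longrightarrow> exchangeable L M \<mu>) \<and>
    (\<forall>N. monster L M N \<longrightarrow>
       ((\<forall>n \<ge> 2. disjoint_amalgamation n (age L M)) \<longrightarrow>
          (\<exists>\<mu>. invariant_keisler_measure L M \<mu> \<and>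
             (\<forall>\<phi> \<in> x_formulas L (univ M). \<not> forks L N \<phi> \<longrightarrow>
                measure \<mu> (types_containing L M \<phi>) > 0))) \<and>
       ((\<exists>n. \<not> disjoint_amalgamation n (age L M)) \<longrightarrow>
          forking_ideal L M N \<subset> measure_zero_ideal L M))"
proof -
  interpret homogeneous_structure k L M
    using assms(1-7) by unfold_locales auto
  have inf: "infinite (univ M)" by (rule infinite_univ[OF assms(10)])
  show ?thesis
  proof (intro conjI allI impI)
    fix \<mu> assume "invariant_keisler_measure L M \<mu>"
    then show "exchangeable L M \<mu>" by (rule exchangeable_of_overlap_closed[OF inf assms(9)])
  next
    fix N assume "monster L M N" and amalg: "\<forall>n\<ge>2. disjoint_amalgamation n (age L M)"
    then have ee: "elementary_extension L M N" by (simp add: monster_def)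
    \<comment> \<open>Positivity on infinite definable sets suffices: by
      \<open>finite_forks\<close>, a formula that does not fork has infinitely many
      solutions.\<close>
    obtain \<mu> where \<mu>: "invariant_keisler_measure L M \<mu>"
      "\<And>\<phi>. \<phi> \<in> x_formulas L (univ M) \<Longrightarrow> infinite (defined_set M \<phi>) \<Longrightarrow> measure \<mu> (types_containing L M \<phi>) > 0"
      using random_measure_exists amalg by metis
    show "\<exists>\<mu>. invariant_keisler_measure L M \<mu> \<and>
             (\<forall>\<phi> \<in> x_formulas L (univ M). \<not> forks L N \<phi> \<longrightarrow> measure \<mu> (types_containing L M \<phi>) > 0)"
      using \<mu> finite_forks[OF inf ee] by (intro exI[of _ \<mu>] conjI ballI impI) blast+
  next
    fix N assume "monster L M N" and fail: "\<exists>n. \<not> disjoint_amalgamation n (age L M)"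
    then have ee: "elementary_extension L M N" by (simp add: monster_def)
    have "\<not> transferable" using fail disjoint_amalgamation_of_transferable[OF _ inf] by blast
    then obtain \<phi> where \<phi>: "\<phi> \<in> x_formulas L (univ M)" "infinite (defined_set M \<phi>)"
      "\<And>\<mu>. invariant_keisler_measure L M \<mu> \<Longrightarrow> measure \<mu> (types_containing L M \<phi>) = 0"
      using infinite_measure_zero_set[OF assms(10,9)] by metis
    have "forking_ideal L M N \<subseteq> measure_zero_ideal L M"
      unfolding forking_ideal_def measure_zero_ideal_def using forks_measure_zero[OF ee] by blast
    moreover have "defined_set M \<phi> \<in> measure_zero_ideal L M"
      unfolding measure_zero_ideal_def using \<phi> by blast
    \<comment> \<open>The ideals consist of sets, so every formula defining the same set must be
      excluded; \<open>infinite_not_forks\<close> depends on the set alone.\<close>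
    moreover have "defined_set M \<phi> \<notin> forking_ideal L M N"
    proof
      assume "defined_set M \<phi> \<in> forking_ideal L M N"
      then obtain \<psi> where "defined_set M \<phi> = defined_set M \<psi>" "\<psi> \<in> x_formulas L (univ M)" "forks L N \<psi>"
        unfolding forking_ideal_def by blast
      then show False using infinite_not_forks[OF assms(11) ee] \<phi>(2) by simp
    qed
    ultimately show "forking_ideal L M N \<subset> measure_zero_ideal L M" by blast
  qed
qed

end
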